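(* Let $d\in\mathbb{N}$ and let $\mathcal{V}\in C^1(\mathbb{R}^d;\mathbb{R})$ be bounded from below by a constant $\underline{\mathcal{V}}\in\mathbb{R}$, with $\nabla\mathcal{V}$ antisymmetric (i.e. $\nabla\mathcal{V}(-x)=-\nabla\mathcal{V}(x)$ for all $x$), uniformly continuous, locally Lipschitz continuous and bounded. Let $\psi\in C(\mathbb{R}_{\ge 0};\mathbb{R}_{\ge 0})$ be bounded and locally Lipschitz continuous and assume that there exists $\underline{\psi}>0$ with $\psi(x)\ge\underline{\psi}>0$ for all $x\in\mathbb{R}_{\ge 0}$. Let $f_0\in\mathcal{P}_c(\mathbb{R}^d\times\mathbb{R}^d)$ satisfy $\int r\,\mathrm{d}f_0(r,v)=0$ and assume that there exists $r_0\ge 0$ (possibly depending on $f_0$) such that $$\int\int\nabla\mathcal{V}\big(R(r,v)-R(r',v')\big)\cdot\big(R(r,v)-R(r',v')\big)\,\mathrm{d}f_0(r,v)\,\mathrm{d}f_0(r',v')\ge 0$$ holds for all $R\in L^2(\mathbb{R}^d\times\mathbb{R}^d,f_0;\mathbb{R}^d)$ satisfying $\int R(r,v)\,\mathrm{d}f_0(r,v)=0$ and $\|R\|_{L^2}\ge r_0$. Then the solution $(f_t)_{t\ge 0}$ of the mean-field equation (in the weak sense stated in the context) with initial condition $f_0$ satisfies, for all $t\ge 0$, $$\int|r|^2\,\mathrm{d}f_t(r,v)\le\frac{1}{\underline{\psi}}\Big(1+2\sqrt{2}\,\big(\mathcal{H}(f_0)-\underline{\mathcal{V}}\big)^{1/2}\Big)\max\Big\{r_0,\Big(\int|r|^2\,\mathrm{d}f_0(r,v)\Big)^{1/2}\Big\}$$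 $$+\frac{\|\psi\|_\infty}{\underline{\psi}}\max\Big\{r_0^2,\int|r|^2\,\mathrm{d}f_0(r,v)\Big\}+\frac{2}{\underline{\psi}^2}\big(\mathcal{H}(f_0)-\underline{\mathcal{V}}\big).$$ Moreover, for every $p\in[1,2)$, $$\lim_{t\to\infty}\mathrm{dist}_{\mathcal{P}_p(\mathbb{R}^d\times\mathbb{R}^d)}(f_t,\mathcal{L})=0,$$ where, with $\bar v=\int v\,\mathrm{d}f_0(r,v)$, $\mathcal{L}$ is the set of all $f\in\mathcal{P}_2(\mathbb{R}^d\times\mathbb{R}^d)$ of the form $f=g(r)\,\delta(v-\bar v)$ (i.e. $f=g\otimes\delta_{\bar v}$ with $g$ a Borel probability measure on $\mathbb{R}^d$) such that $\int\nabla\mathcal{V}(r-r')\,\mathrm{d}g(r')=0$ for all $r\in\mathrm{supp}(g)$.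
   Context: For $p\in[1,\infty)$, $\mathcal{P}_p(\mathbb{R}^d\times\mathbb{R}^d)$ is the set of Borel probability measures on $\mathbb{R}^d\times\mathbb{R}^d$ with finite $p$-th moment, equipped with the $p$-Wasserstein distance $\mathcal{W}_p(\mu,\nu)=\inf_{\pi\in\Pi(\mu,\nu)}\big(\int|(x-x',y-y')|^p\,\mathrm{d}\pi(x,y,x',y')\big)^{1/p}$, where $\Pi(\mu,\nu)$ is the set of couplings of $\mu$ and $\nu$; $\mathrm{dist}_{\mathcal{P}_p}(f,\mathcal{L})=\inf_{g\in\mathcal{L}}\mathcal{W}_p(f,g)$. $\mathcal{P}_c(\mathbb{R}^d\times\mathbb{R}^d)$ is the set of compactly supported Borel probability measures, equipped with the $\infty$-Wasserstein distance $\mathcal{W}_\infty(\mu,\nu)=\inf_{\pi\in\Pi(\mu,\nu)}\sup\{|(x-x',y-y')| : (x,y,x',y')\in\mathrm{supp}(\pi)\}$. The Hamiltonian is $$\mathcal{H}(f)=\frac12\int|v-\bar v|^2\,\mathrm{d}f(r,v)+\frac12\int\int\mathcal{V}(r-r')\,\mathrm{d}f(r,v)\,\mathrm{d}f(r',v'),$$ where $\bar v$ is the mean velocity $\int v\,\mathrm{d}f(r,v)$ (which is conserved along solutions). $\|\psi\|_\infty$ is the supremum norm. Given $f_0\in\mathcal{P}_c(\mathbb{R}^d\times\mathbb{R}^d)$ with $\int r\,\mathrm{d}f_0(r,v)=0$, and $\bar v:=\int v\,\mathrm{d}f_0(r,v)$, the solution of the mean-field equation with initial condition $f_0$ is the (unique)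 $f\in C([0,\infty);\mathcal{P}_c(\mathbb{R}^d\times\mathbb{R}^d))$, $t\mapsto f_t$, such that for all test functions $h\in C_c^\infty([0,\infty)\times\mathbb{R}^d\times\mathbb{R}^d)$ $$\int_0^\infty\!\!\int\big(\partial_t h_t(r,v)+(v-\bar v)\cdot\nabla_r h_t(r,v)\big)\,\mathrm{d}f_t(r,v)\,\mathrm{d}t+\int h_0(r,v)\,\mathrm{d}f_0(r,v)$$ $$=\int_0^\infty\!\!\int\Big(\int\big[\psi(|r-r'|)(v-v')-\nabla\mathcal{V}(r'-r)\big]\,\mathrm{d}f_t(r',v')\Big)\cdot\nabla_v h_t(r,v)\,\mathrm{d}f_t(r,v)\,\mathrm{d}t.$$ Under the stated hypotheses on $\mathcal V$ and $\psi$ this solution exists and is unique.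
   Formalization: The second-moment bound is stated only for lower bounds $\underline{\mathcal V}\le 0$; for $\underline{\mathcal V}>0$ it can fail (e.g. $\mathcal V$ a positive constant equal to $\underline{\mathcal V}$). The convergence statement holds for every $\underline{\mathcal V}$. *)

theory Defs
  imports "HOL-Probability.Probability"
begin

section \<open>Differentiability\<close>

definition grad :: "('b::euclidean_space \<Rightarrow> real) \<Rightarrow> 'b \<Rightarrow> 'b" where
  "grad f x = (THE D. GDERIV f x :> D)"

text \<open>\<open>Ck_on k S f\<close>: \<open>f\<close> is of class \<open>C\<^sup>k\<close> on \<open>S\<close>. Derivatives are taken within \<open>S\<close>,
  i.e. one-sided at boundary points; \<open>S\<close> is meant to be \<open>UNIV\<close> or a half-space, where
  derivatives within \<open>S\<close> are unique.\<close>

primrec Ck_on :: "nat \<Rightarrow> 'b::euclidean_space set \<Rightarrow> ('b \<Rightarrow> real) \<Rightarrow> bool" where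
  "Ck_on 0 S f \<longleftrightarrow> continuous_on S f"
| "Ck_on (Suc k) S f \<longleftrightarrow>
     (\<exists>f'. (\<forall>x\<in>S. (f has_derivative (\<lambda>y. f' x \<bullet> y)) (at x within S)) \<and>
           (\<forall>b\<in>Basis. Ck_on k S (\<lambda>x. f' x \<bullet> b)))"

definition smooth_on :: "'b::euclidean_space set \<Rightarrow> ('b \<Rightarrow> real) \<Rightarrow> bool" where
  "smooth_on S f \<longleftrightarrow> (\<forall>k. Ck_on k S f)"

definition locally_lipschitz_on ::
    "'b::metric_space set \<Rightarrow> ('b \<Rightarrow> 'c::metric_space) \<Rightarrow> bool" where
  "locally_lipschitz_on S f \<longleftrightarrow> (\<forall>x\<in>S. \<exists>u>0. \<exists>L. L-lipschitz_on (cball x u \<inter> S) f)"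

section \<open>Spaces of probability measures and Wasserstein distances\<close>

definition borel_prob :: "'b::euclidean_space measure set" where
  "borel_prob = {\<mu>. prob_space \<mu> \<and> sets \<mu> = sets borel}"

definition msupport :: "'b::euclidean_space measure \<Rightarrow> 'b set" where
  "msupport \<mu> = {x. \<forall>U. open U \<and> x \<in> U \<longrightarrow> emeasure \<mu> U > 0}"

definition Pp :: "real \<Rightarrow> 'b::euclidean_space measure set" where
  "Pp p = {\<mu> \<in> borel_prob. integrable \<mu> (\<lambda>x. norm x powr p)}"

definition Pc :: "'b::euclidean_space measure set" where
  "Pc = {\<mu> \<in> borel_prob. compact (msupport \<mu>)}"

definition couplings ::
    "'b::euclidean_space measure \<Rightarrow> 'b measure \<Rightarrow> ('b \<times> 'b) measure set" where
  "couplings \<mu> \<nu> = {\<pi> \<in> borel_prob. distr \<pi> borel fst = \<mu> \<and> distr \<pi> borel snd = \<nu>}"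

text \<open>The following real-valued distances are meant for arguments in \<open>Pp p\<close> and \<open>Pc\<close>
  respectively. There the cost is integrable (bounded on the support) for every coupling, and
  couplings exist, so that neither the integral nor the infimum or supremum degenerates.\<close>

definition wasserstein :: "real \<Rightarrow> 'b::euclidean_space measure \<Rightarrow> 'b measure \<Rightarrow> real" where
  "wasserstein p \<mu> \<nu> =
     (INF \<pi>\<in>couplings \<mu> \<nu>. (\<integral>z. norm (fst z - snd z) powr p \<partial>\<pi>) powr (1 / p))"

definition wasserstein_inf :: "'b::euclidean_space measure \<Rightarrow> 'b measure \<Rightarrow> real" where
  "wasserstein_inf \<mu> \<nu> =
     (INF \<pi>\<in>couplings \<mu> \<nu>. SUP z\<in>msupport \<pi>. norm (fst z - snd z))"

text \<open>Extended-valued, so that the distance to the empty set is \<open>\<infinity>\<close> and not an unspecified real.\<close>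

definition dist_Pp ::
    "real \<Rightarrow> 'b::euclidean_space measure \<Rightarrow> 'b measure set \<Rightarrow> ennreal" where
  "dist_Pp p \<mu> A = (INF \<nu>\<in>A. ennreal (wasserstein p \<mu> \<nu>))"

section \<open>The mean-field equation\<close>

text \<open>Phase space points are pairs \<open>(r, v)\<close> of position and velocity.\<close>

definition mean_velocity :: "('a::euclidean_space \<times> 'a) measure \<Rightarrow> 'a" where
  "mean_velocity f = (\<integral>z. snd z \<partial>f)"

definition hamiltonian :: "('a::euclidean_space \<Rightarrow> real) \<Rightarrow> ('a \<times> 'a) measure \<Rightarrow> real" where
  "hamiltonian V f =
     1/2 * (\<integral>z. (norm (snd z - mean_velocity f))\<^sup>2 \<partial>f)
   + 1/2 * (\<integral>z. (\<integral>z'. V (fst z - fst z') \<partial>f) \<partial>f)"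

definition test_functions :: "(real \<times> 'a::euclidean_space \<times> 'a \<Rightarrow> real) set" where
  "test_functions =
     {h. smooth_on ({0..} \<times> UNIV \<times> UNIV) h \<and>
         compact (closure (support_on ({0..} \<times> UNIV \<times> UNIV) h))}"

definition d_t :: "(real \<times> 'a::euclidean_space \<times> 'a \<Rightarrow> real) \<Rightarrow> real \<Rightarrow> 'a \<times> 'a \<Rightarrow> real" where
  "d_t h t z = vector_derivative (\<lambda>s. h (s, z)) (at t within {0..})"

definition grad_r :: "(real \<times> 'a::euclidean_space \<times> 'a \<Rightarrow> real) \<Rightarrow> real \<Rightarrow> 'a \<times> 'a \<Rightarrow> 'a" where
  "grad_r h t z = grad (\<lambda>r. h (t, r, snd z)) (fst z)"

definition grad_v :: "(real \<times> 'a::euclidean_space \<times> 'a \<Rightarrow> real) \<Rightarrow> real \<Rightarrow> 'a \<times> 'a \<Rightarrow> 'a" where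
  "grad_v h t z = grad (\<lambda>v. h (t, fst z, v)) (snd z)"

definition Pc_continuous :: "(real \<Rightarrow> ('b::euclidean_space) measure) \<Rightarrow> bool" where
  "Pc_continuous f \<longleftrightarrow>
     (\<forall>t\<ge>0. f t \<in> Pc) \<and>
     (\<forall>t\<ge>0. ((\<lambda>s. wasserstein_inf (f s) (f t)) \<longlongrightarrow> 0) (at t within {0..}))"

text \<open>The values of \<open>f\<close> at negative times and of \<open>\<psi>\<close> at negative arguments are irrelevant. The
  initial condition enters through the weak formulation only.\<close>

definition mean_field_solution ::
    "('a::euclidean_space \<Rightarrow> real) \<Rightarrow> (real \<Rightarrow> real) \<Rightarrow> ('a \<times> 'a) measure
     \<Rightarrow> (real \<Rightarrow> ('a \<times> 'a) measure) \<Rightarrow> bool" where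
  "mean_field_solution V \<psi> f0 f \<longleftrightarrow>
     Pc_continuous f \<and>
     (\<forall>h\<in>test_functions.
        (LINT t:{0..}|lborel.
           (\<integral>z. d_t h t z + (snd z - mean_velocity f0) \<bullet> grad_r h t z \<partial>(f t)))
        + (\<integral>z. h (0, z) \<partial>f0)
      = (LINT t:{0..}|lborel.
           (\<integral>z. (\<integral>z'. \<psi> (norm (fst z - fst z')) *\<^sub>R (snd z - snd z')
                        - grad V (fst z' - fst z) \<partial>(f t))
                \<bullet> grad_v h t z \<partial>(f t))))"

definition equilibria ::
    "('a::euclidean_space \<Rightarrow> real) \<Rightarrow> 'a \<Rightarrow> ('a \<times> 'a) measure set" where
  "equilibria V vbar =
     {f \<in> Pp 2. \<exists>g\<in>borel_prob. f = g \<Otimes>\<^sub>M return borel vbar \<and>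
        (\<forall>r\<in>msupport g. (\<integral>r'. grad V (r - r') \<partial>g) = 0)}"

end

theory Submission
  imports Defs "HOL-Computational_Algebra.Polynomial"
begin

text \<open>Testing the weak equation with products of cutoffs in time and space shows that the integral of
  a smooth function against \<open>f t\<close> is differentiable. With smooth functions that do not increase along
  the characteristics (products of functions vanishing near finitely many trajectories) this bounds
  the \<open>f t\<close>-mass of the image of a compact set under the flow \<open>\<Phi>\<close> from below by its \<open>f0\<close>-mass; both being
  probability measures, \<open>f t\<close> is the push-forward of \<open>f0\<close> by \<open>\<Phi> t\<close>.

  In Lagrangian variables \<open>R\<close>, \<open>W\<close> the energy decreases at a rate of at least \<open>\<psi>min\<close> times the
  kinetic part \<open>K\<close>, while \<open>\<integral> R \<bullet> W\<close> plus a function equivalent to the second moment grows at most at the rate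
  \<open>K\<close> as long as the second moment is at least \<open>r0\<^sup>2\<close>; comparing the time at which the second moment is
  maximal with the last earlier time at which it was at most \<open>max (r0\<^sup>2) (inertia 0)\<close> gives the
  moment bound. Since \<open>K\<close> is integrable in time with controlled growth, it tends to 0, and so does
  the mean square of the force. By the second moment bound, every sequence of times has a
  subsequence along which the position marginals converge almost surely in a Skorohod representation,
  and the limit is an equilibrium; uniform integrability of the \<open>p\<close>-th powers for \<open>p < 2\<close> turns this
  into convergence of the Wasserstein distance.\<close>

section \<open>Probability measures concentrated on a compact set\<close>

text \<open>The obstacle is that the coefficients are only locally Lipschitz: the flow is not
  smooth, and a test function composed with it is not admissible in the weak equation. Squared
  distances to single trajectories are smooth in space, and by Gronwall's inequality they become
  nonincreasing along characteristics once multiplied by exp (- 2 L t). This gives only inequalities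
  of masses, but an inequality between two probability measures on all Borel sets is an equality. In
  the moment bound, friction adds a term without a sign to the derivative of \<integral> R \<bullet>
  W, because \<open>\<psi>\<close> varies with the distance. That term is a total time derivative
  and is removed by adding an average over pairs of a function of their distance. The square of the
  velocities is absorbed by the energy divided by \<open>\<psi>min\<close>. What remains is minus
  half the virial, whose sign for large second moment is the hypothesis on \<open>f0\<close>. The
  restriction to p < 2 has its origin in the moment bound: second moments stay bounded, but need not
  converge to that of the limit. The compactness argument yields no rate.\<close>

lemma uniform_difference_quotient:
  fixes g gd :: "real \<Rightarrow> 'b::metric_space \<Rightarrow> real"
  assumes K: "compact K"
    and joint: "continuous_on ({a..b} \<times> K) (\<lambda>(t, z). gd t z)"
    and deriv: "\<And>t z. t \<in> {a..b} \<Longrightarrow> z \<in> K \<Longrightarrow>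
      ((\<lambda>s. g s z) has_real_derivative gd t z) (at t within {a..b})"
    and t: "t \<in> {a..b}" and e: "e > 0"
  obtains d where "d > 0"
    "\<And>s z. s \<in> {a..b} \<Longrightarrow> \<bar>s - t\<bar> < d \<Longrightarrow> z \<in> K \<Longrightarrow>
      \<bar>g s z - g t z - gd t z * (s - t)\<bar> \<le> e * \<bar>s - t\<bar>"
proof -
  have "uniformly_continuous_on ({a..b} \<times> K) (\<lambda>(t, z). gd t z)"
    using joint K by (intro compact_uniformly_continuous compact_Times) auto
  then obtain d where d: "d > 0" and
    *: "\<And>x y. x \<in> {a..b} \<times> K \<Longrightarrow> y \<in> {a..b} \<times> K \<Longrightarrow> dist y x < d \<Longrightarrow>
      dist ((\<lambda>(t, z). gd t z) y) ((\<lambda>(t, z). gd t z) x) < e"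
    unfolding uniformly_continuous_on_def using e by meson
  have "\<bar>g s z - g t z - gd t z * (s - t)\<bar> \<le> e * \<bar>s - t\<bar>"
    if s: "s \<in> {a..b}" "\<bar>s - t\<bar> < d" and z: "z \<in> K" for s z
  proof -
    let ?S = "{min s t..max s t}"
    \<comment> \<open>Subtracting the linear part at \<open>t\<close> reduces the claim to a bound
      on the derivative \<open>gd u z - gd t z\<close>, which uniform continuity on the compact
      product keeps below \<open>e\<close>.\<close>
    have "norm ((g s z - gd t z * s) - (g t z - gd t z * t)) \<le> e * norm (s - t)"
    proof (rule field_differentiable_bound[where S="?S" and f'="\<lambda>u. gd u z - gd t z"])
      show "convex ?S" by simp
      fix u assume u: "u \<in> ?S"
      then have uab: "u \<in> {a..b}" using s t by auto
      have "((\<lambda>s. g s z) has_real_derivative gd u z) (at u within ?S)"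
        using deriv[OF uab z] by (rule DERIV_subset) (use s t in auto)
      then show "((\<lambda>s. g s z - gd t z * s) has_real_derivative gd u z - gd t z) (at u within ?S)"
        by (auto intro!: derivative_eq_intros)
      have "dist (u, z) (t, z) < d"
        using u s by (auto simp: dist_Pair_Pair dist_real_def)
      then show "norm (gd u z - gd t z) \<le> e"
        using *[of "(t, z)" "(u, z)"] uab t z by (auto simp: dist_norm)
    qed auto
    then show ?thesis by (simp add: algebra_simps)
  qed
  with d show ?thesis using that by blast
qed

lemma mvt_within:
  fixes m m' :: "real \<Rightarrow> real"
  assumes "a \<le> b" "\<And>t. t \<in> {a..b} \<Longrightarrow> (m has_real_derivative m' t) (at t within {a..b})"
  shows "\<exists>x\<in>{a..b}. m b - m a = m' x * (b - a)"
  using mvt_very_simple[of a b m "\<lambda>t. (*) (m' t)"] assms by (auto simp: has_field_derivative_def)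

text \<open>\<open>K\<close> is any compact set of full measure, not necessarily the support, so
  that the notion passes to products with \<open>K \<times> L\<close>. Continuous functions are
  bounded on \<open>K\<close>, hence integrable without further estimates.\<close>

locale compact_prob = prob_space M for M :: "'b::euclidean_space measure" +
  fixes K :: "'b set"
  assumes sets_M: "sets M = sets borel"
    and compact_K: "compact K"
    and AE_K: "AE z in M. z \<in> K"
begin

lemma measurable_M: "g \<in> borel_measurable borel \<Longrightarrow> g \<in> borel_measurable M"
  using measurable_cong_sets[OF sets_M refl] by auto

lemma space_M: "space M = UNIV"
  using sets_eq_imp_space_eq[OF sets_M] by simp

lemma continuous_bounded_on_K:
  fixes g :: "'b \<Rightarrow> 'd::euclidean_space"
  assumes "continuous_on UNIV g"
  obtains B where "B \<ge> 0" "\<And>z. z \<in> K \<Longrightarrow> norm (g z) \<le> B"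
proof -
  have "compact (g ` K)"
    using assms compact_K by (intro compact_continuous_image) (auto intro: continuous_on_subset)
  then obtain B where "\<And>z. z \<in> K \<Longrightarrow> norm (g z) \<le> B"
    using compact_imp_bounded bounded_iff by (metis imageI)
  then show ?thesis using that[of "max B 0"] by fastforce
qed

lemma integrable_continuous:
  fixes g :: "'b \<Rightarrow> 'd::euclidean_space"
  assumes "continuous_on UNIV g"
  shows "integrable M g"
proof -
  obtain B where B: "\<And>z. z \<in> K \<Longrightarrow> norm (g z) \<le> B"
    using continuous_bounded_on_K[OF assms] by blast
  show ?thesis
  proof (rule integrable_const_bound[where B=B])
    show "AE x in M. norm (g x) \<le> B" using AE_K by eventually_elim (use B in auto)
    show "g \<in> borel_measurable M"
      using measurable_M borel_measurable_continuous_onI[OF assms] by blast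
  qed
qed

lemma norm_integral_le:
  fixes g :: "'b \<Rightarrow> 'd::euclidean_space"
  assumes "integrable M g" "\<And>z. z \<in> K \<Longrightarrow> norm (g z) \<le> B"
  shows "norm (\<integral>z. g z \<partial>M) \<le> B"
proof -
  have "norm (\<integral>z. g z \<partial>M) \<le> (\<integral>z. norm (g z) \<partial>M)" by simp
  also have "\<dots> \<le> (\<integral>z. B \<partial>M)"
    using AE_K assms by (intro integral_mono_AE) auto
  finally show ?thesis using prob_space by simp
qed

lemma integral_mono_K:
  fixes g h :: "'b \<Rightarrow> real"
  assumes "integrable M g" "integrable M h" "\<And>z. z \<in> K \<Longrightarrow> g z \<le> h z"
  shows "(\<integral>z. g z \<partial>M) \<le> (\<integral>z. h z \<partial>M)"
  using AE_K assms by (intro integral_mono_AE) auto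

lemma integral_cong_K:
  fixes g h :: "'b \<Rightarrow> 'd::euclidean_space"
  assumes "continuous_on UNIV g" "continuous_on UNIV h" "\<And>z. z \<in> K \<Longrightarrow> g z = h z"
  shows "(\<integral>z. g z \<partial>M) = (\<integral>z. h z \<partial>M)"
  using AE_K assms integrable_continuous
  by (intro integral_cong_AE) (auto intro: borel_measurable_integrable)

text \<open>Difference quotients converge uniformly on a compact set, which replaces a dominating
  function. Continuity in space is asked everywhere, for measurability, but the derivative only on
  \<open>K\<close>: later, trajectories are known to solve their equation only when they start in
  the support of \<open>f0\<close>.\<close>

lemma has_derivative_integral:
  fixes g gd :: "real \<Rightarrow> 'b \<Rightarrow> real"
  assumes cg: "\<And>t. t \<in> {a..b} \<Longrightarrow> continuous_on UNIV (g t)"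
    and cgd: "\<And>t. t \<in> {a..b} \<Longrightarrow> continuous_on UNIV (gd t)"
    and joint: "continuous_on ({a..b} \<times> K) (\<lambda>(t, z). gd t z)"
    and deriv: "\<And>t z. t \<in> {a..b} \<Longrightarrow> z \<in> K \<Longrightarrow>
      ((\<lambda>s. g s z) has_real_derivative gd t z) (at t within {a..b})"
    and t: "t \<in> {a..b}"
  shows "((\<lambda>s. \<integral>z. g s z \<partial>M) has_real_derivative (\<integral>z. gd t z \<partial>M)) (at t within {a..b})"
  unfolding has_field_derivative_def has_derivative_within_alt
proof (intro conjI allI impI)
  show "bounded_linear ((*) (\<integral>z. gd t z \<partial>M))" by (rule bounded_linear_mult_right)
  fix e :: real assume e: "e > 0"
  obtain d where d: "d > 0" and
    pt: "\<And>s z. s \<in> {a..b} \<Longrightarrow> \<bar>s - t\<bar> < d \<Longrightarrow> z \<in> K \<Longrightarrow>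
      \<bar>g s z - g t z - gd t z * (s - t)\<bar> \<le> e * \<bar>s - t\<bar>"
    using uniform_difference_quotient[OF compact_K joint deriv t e] by blast
  show "\<exists>d>0. \<forall>y\<in>{a..b}. norm (y - t) < d \<longrightarrow>
      norm ((\<integral>z. g y z \<partial>M) - (\<integral>z. g t z \<partial>M) - (\<integral>z. gd t z \<partial>M) * (y - t)) \<le> e * norm (y - t)"
  proof (intro exI[of _ d] conjI ballI impI d)
    fix s assume s: "s \<in> {a..b}" "norm (s - t) < d"
    note int = integrable_continuous[OF cg[OF s(1)]] integrable_continuous[OF cg[OF t]]
      integrable_continuous[OF cgd[OF t]]
    have "(\<integral>z. g s z \<partial>M) - (\<integral>z. g t z \<partial>M) - (\<integral>z. gd t z \<partial>M) * (s - t)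
        = (\<integral>z. g s z - g t z - gd t z * (s - t) \<partial>M)"
      using int by simp
    also have "norm \<dots> \<le> e * norm (s - t)"
      using int pt[OF s(1)] s(2) by (intro norm_integral_le) auto
    finally show "norm ((\<integral>z. g s z \<partial>M) - (\<integral>z. g t z \<partial>M) - (\<integral>z. gd t z \<partial>M) * (s - t))
      \<le> e * norm (s - t)" .
  qed
qed

lemma continuous_integral:
  fixes g :: "'c::heine_borel \<Rightarrow> 'b \<Rightarrow> 'd::euclidean_space"
  assumes "continuous_on UNIV (\<lambda>(x, z). g x z)"
  shows "continuous_on UNIV (\<lambda>x. \<integral>z. g x z \<partial>M)"
proof (rule continuous_at_imp_continuous_on, rule ballI)
  fix x
  have cz: "continuous_on UNIV (g y)" for y
  proof -
    have "continuous_on UNIV (\<lambda>z. (y, z))"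
      by (intro continuous_on_Pair continuous_on_const continuous_on_id)
    from continuous_on_compose2[OF assms this] show ?thesis by simp
  qed
  show "isCont (\<lambda>x. \<integral>z. g x z \<partial>M) x"
    unfolding continuous_at_eps_delta
  proof (intro allI impI)
    fix e :: real assume e: "e > 0"
    \<comment> \<open>The unit ball is compact by the class \<open>heine_borel\<close>; together
      with \<open>K\<close> it provides one modulus of continuity for all \<open>z\<close>.\<close>
    have "uniformly_continuous_on (cball x 1 \<times> K) (\<lambda>(x, z). g x z)"
      using assms compact_K
      by (intro compact_uniformly_continuous compact_Times) (auto intro: continuous_on_subset)
    then obtain d where d: "d > 0" and
      *: "\<And>p q. p \<in> cball x 1 \<times> K \<Longrightarrow> q \<in> cball x 1 \<times> K \<Longrightarrow> dist q p < d \<Longrightarrow>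
        dist ((\<lambda>(x, z). g x z) q) ((\<lambda>(x, z). g x z) p) < e / 2"
      unfolding uniformly_continuous_on_def using e by (meson half_gt_zero)
    show "\<exists>d>0. \<forall>x'. dist x' x < d \<longrightarrow> dist (\<integral>z. g x' z \<partial>M) (\<integral>z. g x z \<partial>M) < e"
    proof (intro exI[of _ "min d 1"] conjI allI impI)
      fix x' assume x': "dist x' x < min d 1"
      have "dist (\<integral>z. g x' z \<partial>M) (\<integral>z. g x z \<partial>M) = norm (\<integral>z. g x' z - g x z \<partial>M)"
        using integrable_continuous[OF cz] by (simp add: dist_norm)
      also have "\<dots> \<le> e / 2"
      proof (rule norm_integral_le)
        fix z assume "z \<in> K"
        then show "norm (g x' z - g x z) \<le> e / 2"
          using *[of "(x, z)" "(x', z)"] x' by (auto simp: dist_Pair_Pair dist_commute) (simp add: dist_norm)?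
      qed (use integrable_continuous[OF cz] in auto)
      finally show "dist (\<integral>z. g x' z \<partial>M) (\<integral>z. g x z \<partial>M) < e" using e by simp
    qed (use d in auto)
  qed
qed

end

lemma compact_prob_pair:
  assumes "compact_prob M K" "compact_prob N L"
  shows "compact_prob (M \<Otimes>\<^sub>M N) (K \<times> L)"
proof -
  interpret M: compact_prob M K by fact
  interpret N: compact_prob N L by fact
  interpret pair_prob_space M N ..
  show ?thesis
  proof unfold_locales
    show "sets (M \<Otimes>\<^sub>M N) = sets borel"
      using sets_pair_measure_cong[OF M.sets_M N.sets_M] borel_prod by metis
    show "compact (K \<times> L)" using M.compact_K N.compact_K by (rule compact_Times)
    have "{x \<in> space (M \<Otimes>\<^sub>M N). fst x \<in> K \<and> snd x \<in> L} \<in> sets (M \<Otimes>\<^sub>M N)"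
    proof -
      have "{x \<in> space (M \<Otimes>\<^sub>M N). fst x \<in> K \<and> snd x \<in> L} = K \<times> L"
        using M.space_M N.space_M by (auto simp: space_pair_measure)
      moreover have "K \<in> sets M" "L \<in> sets N"
        using M.compact_K N.compact_K by (auto simp: M.sets_M N.sets_M borel_compact)
      ultimately show ?thesis by auto
    qed
    then have "AE z in M \<Otimes>\<^sub>M N. fst z \<in> K \<and> snd z \<in> L"
      by (subst AE_pair_iff[symmetric]) (use M.AE_K N.AE_K in \<open>auto simp: case_prod_beta\<close>)
    then show "AE z in M \<Otimes>\<^sub>M N. z \<in> K \<times> L" by eventually_elim auto
  qed
qed

section \<open>Supports and couplings\<close>

lemma AE_msupport:
  fixes \<mu> :: "'b::euclidean_space measure"
  assumes sets: "sets \<mu> = sets borel"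
  shows "AE x in \<mu>. x \<in> msupport \<mu>"
proof -
  let ?F = "{U. open U \<and> emeasure \<mu> U = 0}"
  have eq: "- msupport \<mu> = \<Union> ?F"
    by (auto simp: msupport_def zero_less_iff_neq_zero)
  \<comment> \<open>The complement of the support is a union of arbitrarily many open null sets;
    second countability leaves countably many of them.\<close>
  obtain F' where F': "F' \<subseteq> ?F" "countable F'" "\<Union>F' = \<Union>?F"
    using Lindelof[of ?F] by (metis (mono_tags, lifting) mem_Collect_eq)
  have "(\<Union>U\<in>F'. U) \<in> null_sets \<mu>"
    using F' by (intro null_sets_UN') (auto simp: null_sets_def sets)
  then have "- msupport \<mu> \<in> null_sets \<mu>" using F' eq by simp
  then show ?thesis by (rule AE_I') auto
qed

lemma compact_prob_Pc: "\<mu> \<in> Pc \<Longrightarrow> compact_prob \<mu> (msupport \<mu>)"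
  by (auto simp: Pc_def borel_prob_def compact_prob_def compact_prob_axioms_def intro: AE_msupport)

lemma msupport_subset:
  assumes "closed C" "AE x in \<mu>. x \<in> C" "sets \<mu> = sets borel"
  shows "msupport \<mu> \<subseteq> C"
proof
  fix x assume x: "x \<in> msupport \<mu>"
  show "x \<in> C"
  proof (rule ccontr)
    assume "x \<notin> C"
    then have "emeasure \<mu> (- C) > 0"
      using x assms(1) unfolding msupport_def by (auto simp: open_Compl)
    moreover have "AE x in \<mu>. x \<notin> - C" using assms(2) by eventually_elim auto
    then have "emeasure \<mu> (- C) = 0"
      using assms(1,3) by (subst (asm) AE_iff_measurable[of "- C"])
        (auto simp: sets_eq_imp_space_eq[OF assms(3)] borel_closed intro!: borel_comp)
    ultimately show False by simp
  qed
qed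

text \<open>Guarantees that the infimum defining a Wasserstein distance ranges over a nonempty set,
  so that it can be undercut by an actual coupling.\<close>

lemma pair_measure_in_couplings:
  assumes "\<mu> \<in> borel_prob" "\<nu> \<in> borel_prob"
  shows "\<mu> \<Otimes>\<^sub>M \<nu> \<in> couplings \<mu> \<nu>"
proof -
  have *: "prob_space \<mu>" "prob_space \<nu>" "sets \<mu> = sets borel" "sets \<nu> = sets borel"
    using assms by (auto simp: borel_prob_def)
  interpret \<mu>: prob_space \<mu> by fact
  interpret \<nu>: prob_space \<nu> by fact
  interpret pair_prob_space \<mu> \<nu> ..
  have sets: "sets (\<mu> \<Otimes>\<^sub>M \<nu>) = sets borel"
    using sets_pair_measure_cong[OF *(3,4)] borel_prod by metis
  have "distr (\<mu> \<Otimes>\<^sub>M \<nu>) borel fst = distr (\<mu> \<Otimes>\<^sub>M \<nu>) \<mu> fst"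
    using * by (intro distr_cong) auto
  also have "\<dots> = \<mu>" by (rule \<nu>.distr_pair_fst)
  finally have 1: "distr (\<mu> \<Otimes>\<^sub>M \<nu>) borel fst = \<mu>" .
  have "distr (\<mu> \<Otimes>\<^sub>M \<nu>) borel snd = distr (distr (\<nu> \<Otimes>\<^sub>M \<mu>) (\<mu> \<Otimes>\<^sub>M \<nu>) (\<lambda>(x, y). (y, x))) borel snd"
    using distr_pair_swap by simp
  also have "\<dots> = distr (\<nu> \<Otimes>\<^sub>M \<mu>) borel (snd \<circ> (\<lambda>(x, y). (y, x)))"
    using measurable_cong_sets[OF refl *(4)[symmetric]] by (intro distr_distr) auto
  also have "\<dots> = distr (\<nu> \<Otimes>\<^sub>M \<mu>) \<nu> fst"
    using * by (intro distr_cong) auto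
  also have "\<dots> = \<nu>" by (rule \<mu>.distr_pair_fst)
  finally have 2: "distr (\<mu> \<Otimes>\<^sub>M \<nu>) borel snd = \<nu>" .
  show ?thesis
    using 1 2 sets prob_space_axioms by (simp add: couplings_def borel_prob_def)
qed

text \<open>Confines the pairs over which \<open>wasserstein_inf\<close> takes its supremum to a
  compact set. The supremum of reals is then over a bounded set and really is an upper
  bound.\<close>

lemma msupport_coupling:
  assumes "\<pi> \<in> couplings \<mu> \<nu>"
  shows "msupport \<pi> \<subseteq> msupport \<mu> \<times> msupport \<nu>"
proof
  fix p assume p: "p \<in> msupport \<pi>"
  have sets: "sets \<pi> = sets borel" and d: "distr \<pi> borel fst = \<mu>" "distr \<pi> borel snd = \<nu>"
    using assms by (auto simp: couplings_def borel_prob_def)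
  have sp: "space \<pi> = UNIV" using sets_eq_imp_space_eq[OF sets] by simp
  have m: "fst \<in> borel_measurable \<pi>" "snd \<in> borel_measurable \<pi>"
    by (subst measurable_cong_sets[OF sets refl],
      intro borel_measurable_continuous_onI continuous_intros)+
  have "emeasure \<mu> U > 0" if "open U" "fst p \<in> U" for U
  proof -
    have "emeasure \<pi> (U \<times> UNIV) > 0"
      using p that by (cases p) (auto simp: msupport_def open_Times)
    moreover have "emeasure \<mu> U = emeasure \<pi> (U \<times> UNIV)"
      using that m unfolding d(1)[symmetric]
      by (subst emeasure_distr) (auto simp: sp intro!: arg_cong[where f="emeasure \<pi>"])
    ultimately show ?thesis by simp
  qed
  moreover have "emeasure \<nu> U > 0" if "open U" "snd p \<in> U" for U
  proof -
    have "emeasure \<pi> (UNIV \<times> U) > 0"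
      using p that by (cases p) (auto simp: msupport_def open_Times)
    moreover have "emeasure \<nu> U = emeasure \<pi> (UNIV \<times> U)"
      using that m unfolding d(2)[symmetric]
      by (subst emeasure_distr) (auto simp: sp intro!: arg_cong[where f="emeasure \<pi>"])
    ultimately show ?thesis by simp
  qed
  ultimately show "p \<in> msupport \<mu> \<times> msupport \<nu>"
    by (cases p) (auto simp: msupport_def)
qed

text \<open>Translates the nested real infimum and supremum into one coupling with a pointwise
  bound; all later arguments on continuity in time use only this form. The strict inequality makes
  attainment of the infimum irrelevant.\<close>

lemma coupling_of_wasserstein_inf:
  assumes "\<mu> \<in> Pc" "\<nu> \<in> Pc" "wasserstein_inf \<mu> \<nu> < e"
  obtains \<pi> where "\<pi> \<in> couplings \<mu> \<nu>" "AE z in \<pi>. norm (fst z - snd z) < e"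
proof -
  have "couplings \<mu> \<nu> \<noteq> {}"
    using pair_measure_in_couplings assms by (auto simp: Pc_def)
  then obtain \<pi> where \<pi>: "\<pi> \<in> couplings \<mu> \<nu>" "(SUP z\<in>msupport \<pi>. norm (fst z - snd z)) < e"
    using assms(3) cInf_lessD[of "(\<lambda>\<pi>. SUP z\<in>msupport \<pi>. norm (fst z - snd z)) ` couplings \<mu> \<nu>" e]
    unfolding wasserstein_inf_def by auto
  have "compact (msupport \<mu> \<times> msupport \<nu>)"
    using assms by (auto simp: Pc_def intro: compact_Times)
  then have "compact (msupport \<mu> \<times> msupport \<nu>) \<and> continuous_on (msupport \<mu> \<times> msupport \<nu>) (\<lambda>z. norm (fst z - snd z))"
    by (auto intro!: continuous_intros)
  then have "compact ((\<lambda>z. norm (fst z - snd z)) ` (msupport \<mu> \<times> msupport \<nu>))"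
    using compact_continuous_image by blast
  then have "bdd_above ((\<lambda>z. norm (fst z - snd z)) ` msupport \<pi>)"
    using msupport_coupling[OF \<pi>(1)] compact_imp_bounded bounded_imp_bdd_above
    by (meson bdd_above_mono image_mono)
  then have *: "norm (fst z - snd z) < e" if "z \<in> msupport \<pi>" for z
    using \<pi>(2) that cSUP_upper[of z "msupport \<pi>" "\<lambda>z. norm (fst z - snd z)"] by simp
  have "AE z in \<pi>. z \<in> msupport \<pi>"
    using \<pi>(1) by (intro AE_msupport) (auto simp: couplings_def borel_prob_def)
  then have "AE z in \<pi>. norm (fst z - snd z) < e" by eventually_elim (rule *)
  then show ?thesis using that \<pi>(1) by blast
qed

section \<open>Smooth functions\<close>

lemma Ck_on_Suc_imp: "Ck_on (Suc k) S f \<Longrightarrow> Ck_on k S f"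
proof (induction k arbitrary: f)
  case 0
  then obtain f' where "\<And>x. x \<in> S \<Longrightarrow> (f has_derivative (\<lambda>y. f' x \<bullet> y)) (at x within S)" by auto
  then show ?case unfolding Ck_on.simps by (rule has_derivative_continuous_on)
next
  case (Suc k)
  from Suc.prems obtain f' where
    f': "\<And>x. x \<in> S \<Longrightarrow> (f has_derivative (\<lambda>y. f' x \<bullet> y)) (at x within S)"
    "\<And>b. b \<in> Basis \<Longrightarrow> Ck_on (Suc k) S (\<lambda>x. f' x \<bullet> b)"
    by (auto simp del: Ck_on.simps(2) simp: Ck_on.simps(2)[of "Suc k"])
  then have "\<And>b. b \<in> Basis \<Longrightarrow> Ck_on k S (\<lambda>x. f' x \<bullet> b)" using Suc.IH by blast
  with f' show ?case by (auto intro!: exI[of _ f'])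
qed

lemma Ck_on_subset: "Ck_on k T f \<Longrightarrow> S \<subseteq> T \<Longrightarrow> Ck_on k S f"
proof (induction k arbitrary: f)
  case 0
  then show ?case by (auto intro: continuous_on_subset)
next
  case (Suc k)
  then obtain f' where
    "\<forall>x\<in>T. (f has_derivative (\<lambda>y. f' x \<bullet> y)) (at x within T)"
    "\<forall>b\<in>Basis. Ck_on k T (\<lambda>x. f' x \<bullet> b)" by auto
  with Suc show ?case
    by (auto intro!: exI[of _ f'] intro: has_derivative_subset)
qed

lemma Ck_on_const: "Ck_on k S (\<lambda>x. c)"
proof (induction k arbitrary: c)
  case (Suc k)
  then show ?case by (auto intro!: exI[of _ "\<lambda>_. 0"])
qed simp

lemma Ck_on_inner: "Ck_on k S (\<lambda>x. x \<bullet> c)"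
proof (cases k)
  case (Suc n)
  have "((\<lambda>x. x \<bullet> c) has_derivative (\<lambda>y. c \<bullet> y)) (at x within S)" for x
    by (auto intro!: derivative_eq_intros simp: inner_commute)
  then show ?thesis using Suc Ck_on_const by (auto intro!: exI[of _ "\<lambda>_. c"])
qed (auto intro!: continuous_intros)

lemma Ck_on_add: "Ck_on k S f \<Longrightarrow> Ck_on k S g \<Longrightarrow> Ck_on k S (\<lambda>x. f x + g x)"
proof (induction k arbitrary: f g)
  case 0
  then show ?case by (auto intro: continuous_intros)
next
  case (Suc k)
  from Suc.prems(1) obtain f' where f':
    "\<forall>x\<in>S. (f has_derivative (\<lambda>y. f' x \<bullet> y)) (at x within S)"
    "\<forall>b\<in>Basis. Ck_on k S (\<lambda>x. f' x \<bullet> b)" by auto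
  from Suc.prems(2) obtain g' where g':
    "\<forall>x\<in>S. (g has_derivative (\<lambda>y. g' x \<bullet> y)) (at x within S)"
    "\<forall>b\<in>Basis. Ck_on k S (\<lambda>x. g' x \<bullet> b)" by auto
  show ?case using f' g' Suc.IH
    by (auto intro!: exI[of _ "\<lambda>x. f' x + g' x"] has_derivative_add simp: inner_add_left)
qed

lemma Ck_on_mult: "Ck_on k S f \<Longrightarrow> Ck_on k S g \<Longrightarrow> Ck_on k S (\<lambda>x. f x * g x)"
proof (induction k arbitrary: f g)
  case 0
  then show ?case by (auto intro: continuous_intros)
next
  case (Suc k)
  from Suc.prems(1) obtain f' where f':
    "\<forall>x\<in>S. (f has_derivative (\<lambda>y. f' x \<bullet> y)) (at x within S)"
    "\<forall>b\<in>Basis. Ck_on k S (\<lambda>x. f' x \<bullet> b)" by auto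
  from Suc.prems(2) obtain g' where g':
    "\<forall>x\<in>S. (g has_derivative (\<lambda>y. g' x \<bullet> y)) (at x within S)"
    "\<forall>b\<in>Basis. Ck_on k S (\<lambda>x. g' x \<bullet> b)" by auto
  have fg: "Ck_on k S f" "Ck_on k S g" using Suc.prems Ck_on_Suc_imp by blast+
  show ?case
    unfolding Ck_on.simps
  proof (intro exI[of _ "\<lambda>x. f x *\<^sub>R g' x + g x *\<^sub>R f' x"] conjI ballI)
    fix x assume "x \<in> S"
    then have "((\<lambda>x. f x * g x) has_derivative (\<lambda>y. f x * (g' x \<bullet> y) + (f' x \<bullet> y) * g x)) (at x within S)"
      using f'(1) g'(1) by (intro has_derivative_mult) auto
    then show "((\<lambda>x. f x * g x) has_derivative (\<lambda>y. (f x *\<^sub>R g' x + g x *\<^sub>R f' x) \<bullet> y)) (at x within S)"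
      by (simp add: inner_add_left mult.commute)
  next
    fix b :: 'a assume "b \<in> Basis"
    then show "Ck_on k S (\<lambda>x. (f x *\<^sub>R g' x + g x *\<^sub>R f' x) \<bullet> b)"
      using f'(2) g'(2) fg Suc.IH by (auto simp: inner_add_left intro!: Ck_on_add)
  qed
qed

text \<open>Lifts a function on phase space to space-time, where the factors of a product test
  function have to be smooth.\<close>

lemma Ck_on_compose_snd:
  fixes \<phi> :: "'b::euclidean_space \<Rightarrow> real"
  shows "Ck_on k UNIV \<phi> \<Longrightarrow> Ck_on k UNIV (\<lambda>p::'c::euclidean_space \<times> 'b. \<phi> (snd p))"
proof (induction k arbitrary: \<phi>)
  case 0
  then show ?case by (auto intro!: continuous_intros continuous_on_compose2[of UNIV \<phi>])
next
  case (Suc k)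
  then obtain f' where f':
    "\<And>x. (\<phi> has_derivative (\<lambda>y. f' x \<bullet> y)) (at x)"
    "\<forall>b\<in>Basis. Ck_on k UNIV (\<lambda>x. f' x \<bullet> b)" by auto
  show ?case
    unfolding Ck_on.simps
  proof (intro exI[of _ "\<lambda>p. (0, f' (snd p))"] conjI ballI)
    fix p :: "'c \<times> 'b"
    have "((\<lambda>p. \<phi> (snd p)) has_derivative (\<lambda>y. f' (snd p) \<bullet> snd y)) (at p)"
      by (rule has_derivative_compose[OF _ f'(1)]) (auto intro: derivative_eq_intros)
    then show "((\<lambda>p. \<phi> (snd p)) has_derivative (\<lambda>y. (0, f' (snd p)) \<bullet> y)) (at p)"
      by (simp add: inner_prod_def)
  next
    fix b :: "'c \<times> 'b" assume "b \<in> Basis"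
    then have "snd b = 0 \<or> snd b \<in> Basis" by (auto simp: Basis_prod_def)
    then have "Ck_on k UNIV (\<lambda>x. f' x \<bullet> snd b)" using f'(2) Ck_on_const[of k UNIV 0] by auto
    then show "Ck_on k UNIV (\<lambda>p::'c \<times> 'b. (0, f' (snd p)) \<bullet> b)"
      using Suc.IH[of "\<lambda>x. f' x \<bullet> snd b"] by (simp add: inner_prod_def)
  qed
qed

text \<open>The outer function comes as the sequence \<open>gs\<close> of all its derivatives: the
  chain rule produces the factor \<open>gs (Suc n)\<close>, to which the induction hypothesis,
  stated for every \<open>n\<close>, applies again.\<close>

lemma Ck_on_compose_real:
  assumes gs: "\<And>n x. (gs n has_real_derivative gs (Suc n) x) (at x)"
  shows "Ck_on k S u \<Longrightarrow> Ck_on k S (\<lambda>x. gs n (u x))"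
proof (induction k arbitrary: n)
  case 0
  have "continuous_on UNIV (gs n)"
    using gs by (meson DERIV_isCont continuous_at_imp_continuous_on)
  then show ?case using 0 by (auto intro!: continuous_on_compose2[of UNIV "gs n"])
next
  case (Suc k)
  then obtain f' where f':
    "\<forall>x\<in>S. (u has_derivative (\<lambda>y. f' x \<bullet> y)) (at x within S)"
    "\<forall>b\<in>Basis. Ck_on k S (\<lambda>x. f' x \<bullet> b)" by auto
  show ?case
    unfolding Ck_on.simps
  proof (intro exI[of _ "\<lambda>x. gs (Suc n) (u x) *\<^sub>R f' x"] conjI ballI)
    fix x assume "x \<in> S"
    have "((\<lambda>x. gs n (u x)) has_derivative (\<lambda>y. gs (Suc n) (u x) * (f' x \<bullet> y))) (at x within S)"
      using f'(1) \<open>x \<in> S\<close> gs[of n "u x"]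
      by (intro has_derivative_compose[of u _ _ _ "gs n"]) (auto simp: has_field_derivative_def)
    then show "((\<lambda>x. gs n (u x)) has_derivative (\<lambda>y. (gs (Suc n) (u x) *\<^sub>R f' x) \<bullet> y)) (at x within S)"
      by simp
  next
    fix b :: 'a assume "b \<in> Basis"
    then have "Ck_on k S (\<lambda>x. gs (Suc n) (u x) * (f' x \<bullet> b))"
      using f'(2) Suc.IH Ck_on_Suc_imp[OF Suc.prems] by (intro Ck_on_mult) auto
    then show "Ck_on k S (\<lambda>x. (gs (Suc n) (u x) *\<^sub>R f' x) \<bullet> b)" by simp
  qed
qed

lemma Ck_on_1_gradient:
  assumes "Ck_on 1 UNIV f"
  obtains f' where "\<And>x. (f has_derivative (\<lambda>y. f' x \<bullet> y)) (at x)" "continuous_on UNIV f'"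
proof -
  from assms obtain f' where f': "\<And>x. (f has_derivative (\<lambda>y. f' x \<bullet> y)) (at x)"
    "\<And>b. b \<in> Basis \<Longrightarrow> continuous_on UNIV (\<lambda>x. f' x \<bullet> b)" by auto
  moreover have "continuous_on UNIV f'"
    using f'(2) by (subst continuous_on_componentwise) auto
  ultimately show ?thesis using that by blast
qed

lemma grad_eq:
  assumes "(f has_derivative (\<lambda>y. D \<bullet> y)) (at x)"
  shows "grad f x = D"
  unfolding grad_def gderiv_def
proof (rule the_equality)
  show "(f has_derivative (\<lambda>h. h \<bullet> D)) (at x)" using assms by (simp add: inner_commute)
  fix D' assume "(f has_derivative (\<lambda>h. h \<bullet> D')) (at x)"
  then have "(\<lambda>h. h \<bullet> D') = (\<lambda>y. D \<bullet> y)" using assms by (rule has_derivative_unique)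
  then have "D' \<bullet> h = D \<bullet> h" for h by (metis inner_commute)
  then show "D' = D" using vector_eq_rdot[of D' D] by blast
qed

text \<open>The recursion is forced by differentiation: the derivative of p(1/x) exp(-1/x) is x^-2
  (p(1/x) - p'(1/x)) exp(-1/x), and x^-2 is the polynomial \<open>[:0, 0, 1:]\<close> evaluated at
  1/x.\<close>

primrec flat_poly :: "nat \<Rightarrow> real poly" where
  "flat_poly 0 = 1"
| "flat_poly (Suc n) = [:0, 0, 1:] * (flat_poly n - pderiv (flat_poly n))"

text \<open>\<open>flat_exp n\<close> is the \<open>n\<close>-th derivative of the flat function \<open>exp (-1/x)\<close>.\<close>

definition flat_exp :: "nat \<Rightarrow> real \<Rightarrow> real" where
  "flat_exp n x = (if x > 0 then poly (flat_poly n) (1 / x) * exp (- (1 / x)) else 0)"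

lemma poly_times_exp_tendsto_0: "((\<lambda>y::real. poly p y * exp (- y)) \<longlongrightarrow> 0) at_top"
proof -
  have "((\<lambda>y. \<Sum>i\<le>degree p. coeff p i * (y ^ i / exp y)) \<longlongrightarrow> (\<Sum>i\<le>degree p. coeff p i * 0)) at_top"
    by (intro tendsto_intros tendsto_power_div_exp_0)
  moreover have "(\<lambda>y. \<Sum>i\<le>degree p. coeff p i * (y ^ i / exp y)) = (\<lambda>y. poly p y * exp (- y))"
    by (auto simp: poly_altdef exp_minus field_simps sum_distrib_left sum_distrib_right)
  ultimately show ?thesis by simp
qed

lemma flat_DERIV: "(flat_exp n has_real_derivative flat_exp (Suc n) x) (at x)"
proof (cases x "0::real" rule: linorder_cases)
  case less
  have "\<forall>\<^sub>F y in nhds x. flat_exp n y = 0"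
    using eventually_nhds_in_open[of "{..<0::real}" x] less
    by (auto elim!: eventually_mono simp: flat_exp_def)
  then have "((\<lambda>_. 0) has_real_derivative 0) (at x) = (flat_exp n has_real_derivative 0) (at x)"
    by (intro DERIV_cong_ev) (auto elim: eventually_mono)
  then show ?thesis using less by (simp add: flat_exp_def)
next
  case greater
  have "\<forall>\<^sub>F y in nhds x. poly (flat_poly n) (1 / y) * exp (- (1 / y)) = flat_exp n y"
    using eventually_nhds_in_open[of "{0::real<..}" x] greater
    by (auto elim!: eventually_mono simp: flat_exp_def)
  moreover have "((\<lambda>y. poly (flat_poly n) (1 / y) * exp (- (1 / y))) has_real_derivative flat_exp (Suc n) x) (at x)"
    using greater unfolding flat_exp_def
    by (auto intro!: derivative_eq_intros DERIV_chain2[OF poly_DERIV] simp: field_simps power2_eq_square)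
  ultimately show ?thesis
    by (simp only: DERIV_cong_ev[OF refl _ refl])
next
  case equal
  have "((\<lambda>y. flat_exp n y / y) \<longlongrightarrow> 0) (at_right 0)"
  proof (rule Lim_transform_eventually)
    \<comment> \<open>The factor \<open>[:0, 1:]\<close>, evaluated at the inverse of
      \<open>y\<close>, is the division by \<open>y\<close> in the difference quotient at 0.\<close>
    have "((\<lambda>y. poly ([:0, 1:] * flat_poly n) (inverse y) * exp (- inverse y)) \<longlongrightarrow> 0) (at_right 0)"
      by (rule filterlim_compose[OF poly_times_exp_tendsto_0 filterlim_inverse_at_top_right])
    then show "((\<lambda>y. poly ([:0, 1:] * flat_poly n) (1 / y) * exp (- (1 / y))) \<longlongrightarrow> 0) (at_right 0)"
      by (simp add: inverse_eq_divide)
    show "\<forall>\<^sub>F y in at_right 0. poly ([:0, 1:] * flat_poly n) (1 / y) * exp (- (1 / y)) = flat_exp n y / y"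
      unfolding eventually_at_right_field by (auto intro!: exI[of _ 1] simp: flat_exp_def field_simps)
  qed
  moreover have "((\<lambda>y. flat_exp n y / y) \<longlongrightarrow> 0) (at_left 0)"
    by (rule tendsto_eventually) (auto simp: eventually_at_left_field flat_exp_def intro!: exI[of _ "-1"])
  ultimately have "((\<lambda>y. flat_exp n y / y) \<longlongrightarrow> 0) (at 0)"
    by (simp add: filterlim_at_split)
  then show ?thesis using equal by (simp add: has_field_derivative_iff flat_exp_def)
qed

section \<open>Smooth cutoffs built from the flat function\<close>

lemma flat0: "flat_exp 0 x = (if x > 0 then exp (- (1 / x)) else 0)"
  by (simp add: flat_exp_def)

lemma flat0_nonneg: "0 \<le> flat_exp 0 x" and flat0_le_1: "flat_exp 0 x \<le> 1"
  by (auto simp: flat0)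

lemma flat1_nonneg: "0 \<le> flat_exp (Suc 0) x"
  by (auto simp: flat_exp_def)

lemma continuous_on_flat: "continuous_on S (flat_exp n)"
  using flat_DERIV by (meson DERIV_isCont continuous_at_imp_continuous_on)

text \<open>Nesting \<open>flat_exp 0\<close> in itself gives a nonincreasing cutoff whose
  denominator is a constant, so that smoothness follows from sums, products and composition alone.
  It equals 1 up to 0 and vanishes once the inner value reaches 1/2; since exp(-1/x) is at least 1 -
  1/x, this has happened at x = 2.\<close>

definition plateau :: "real \<Rightarrow> real" where
  "plateau x = flat_exp 0 (1 / 2 - flat_exp 0 x) / flat_exp 0 (1 / 2)"

definition plateau' :: "real \<Rightarrow> real" where
  "plateau' x = - (flat_exp (Suc 0) (1 / 2 - flat_exp 0 x) * flat_exp (Suc 0) x / flat_exp 0 (1 / 2))"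

lemma flat_half_pos: "flat_exp 0 (1 / 2) > 0"
  by (simp add: flat0)

lemma plateau_DERIV: "(plateau has_real_derivative plateau' x) (at x)"
  unfolding plateau_def plateau'_def
  using flat_half_pos by (auto intro!: derivative_eq_intros DERIV_chain2[OF flat_DERIV] simp: field_simps)

lemma plateau'_nonpos: "plateau' x \<le> 0"
  using flat_half_pos flat1_nonneg by (simp add: plateau'_def)

lemma plateau_nonneg: "0 \<le> plateau x"
  using flat_half_pos flat0_nonneg by (simp add: plateau_def)

lemma plateau_eq_1: "x \<le> 0 \<Longrightarrow> plateau x = 1"
  using flat_half_pos by (simp add: plateau_def flat0)

lemma flat0_ge_half: assumes "x \<ge> 2" shows "flat_exp 0 x \<ge> 1 / 2"
proof -
  have "1 / 2 \<le> 1 + (- (1 / x))" using assms by (simp add: field_simps)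
  also have "\<dots> \<le> exp (- (1 / x))" by (rule exp_ge_add_one_self)
  finally show ?thesis using assms by (simp add: flat0)
qed

lemma plateau_eq_0: "x \<ge> 2 \<Longrightarrow> plateau x = 0"
  using flat0_ge_half[of x] by (simp add: plateau_def flat0[of "1 / 2 - flat_exp 0 x"])

lemma plateau'_eq_0: "x \<ge> 2 \<Longrightarrow> plateau' x = 0"
  using flat0_ge_half[of x] by (simp add: plateau'_def flat_exp_def[of "Suc 0" "1 / 2 - flat_exp 0 x"])

lemma plateau'_eq_0': "x \<le> 0 \<Longrightarrow> plateau' x = 0"
  by (simp add: plateau'_def flat_exp_def[of "Suc 0" x])

lemma continuous_on_plateau': "continuous_on S plateau'"
proof -
  have "continuous_on S (\<lambda>x. flat_exp (Suc 0) (1 / 2 - flat_exp 0 x))"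
    by (rule continuous_on_compose2[OF continuous_on_flat[of UNIV]]) (auto intro!: continuous_intros continuous_on_flat)
  then show ?thesis using flat_half_pos unfolding plateau'_def
    by (auto intro!: continuous_intros continuous_on_flat)
qed

lemma continuous_on_plateau: "continuous_on S plateau"
  using plateau_DERIV by (meson DERIV_isCont continuous_at_imp_continuous_on)

lemma Ck_on_flat: "Ck_on k S u \<Longrightarrow> Ck_on k S (\<lambda>x. flat_exp n (u x))"
  by (rule Ck_on_compose_real[where gs=flat_exp]) (rule flat_DERIV)

lemma Ck_on_plateau:
  assumes "Ck_on k S u"
  shows "Ck_on k S (\<lambda>x. plateau (u x))"
proof -
  have "Ck_on k S (\<lambda>x. flat_exp 0 (1 / 2 + (- 1) * flat_exp 0 (u x)) * (1 / flat_exp 0 (1 / 2)))"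
    using assms by (intro Ck_on_mult Ck_on_add Ck_on_const Ck_on_flat)
  then show ?thesis by (simp add: plateau_def)
qed

lemma Ck_on_sum: "finite I \<Longrightarrow> (\<And>i. i \<in> I \<Longrightarrow> Ck_on k S (u i)) \<Longrightarrow> Ck_on k S (\<lambda>x. \<Sum>i\<in>I. u i x)"
  by (induction I rule: finite_induct) (auto intro: Ck_on_const Ck_on_add)

lemma Ck_on_norm_sq: "Ck_on k S (\<lambda>x. (norm (x - c))\<^sup>2)"
proof -
  have "Ck_on k S (\<lambda>x. \<Sum>b\<in>Basis. (x \<bullet> b + - (c \<bullet> b)) * (x \<bullet> b + - (c \<bullet> b)))"
    by (intro Ck_on_sum Ck_on_mult Ck_on_add Ck_on_inner Ck_on_const) auto
  moreover have "(\<lambda>x. \<Sum>b\<in>Basis. (x \<bullet> b + - (c \<bullet> b)) * (x \<bullet> b + - (c \<bullet> b))) = (\<lambda>x. (norm (x - c))\<^sup>2)"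
    by (subst power2_norm_eq_inner, subst euclidean_inner) (simp add: inner_diff_left)
  ultimately show ?thesis by simp
qed

section \<open>Continuous paths of compactly supported measures\<close>

lemma couplingD:
  fixes \<mu> \<nu> :: "'b::euclidean_space measure"
  assumes \<pi>: "\<pi> \<in> couplings \<mu> \<nu>"
  shows "prob_space \<pi>" "sets \<pi> = sets borel"
    and "fst \<in> borel_measurable \<pi>" "snd \<in> borel_measurable \<pi>"
    and "\<mu> = distr \<pi> borel fst" "\<nu> = distr \<pi> borel snd"
proof -
  show *: "prob_space \<pi>" "sets \<pi> = sets borel" "\<mu> = distr \<pi> borel fst" "\<nu> = distr \<pi> borel snd"
    using \<pi> by (auto simp: couplings_def borel_prob_def)
  show "fst \<in> borel_measurable \<pi>" "snd \<in> borel_measurable \<pi>"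
    by (subst measurable_cong_sets[OF *(2) refl],
      intro borel_measurable_continuous_onI continuous_intros)+
qed

locale Pc_path =
  fixes f :: "real \<Rightarrow> ('b::euclidean_space) measure"
  assumes path: "Pc_continuous f"
begin

lemma f_Pc: "t \<ge> 0 \<Longrightarrow> f t \<in> Pc"
  using path by (simp add: Pc_continuous_def)

lemma f_compact_prob: "t \<ge> 0 \<Longrightarrow> compact_prob (f t) (msupport (f t))"
  using f_Pc compact_prob_Pc by blast

lemma near_coupling:
  assumes t: "t \<ge> 0" and e: "e > 0"
  obtains d where "d > 0"
    "\<And>s. s \<ge> 0 \<Longrightarrow> \<bar>s - t\<bar> < d \<Longrightarrow> \<exists>\<pi>\<in>couplings (f s) (f t). AE z in \<pi>. norm (fst z - snd z) < e"
proof -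
  have "((\<lambda>s. wasserstein_inf (f s) (f t)) \<longlongrightarrow> 0) (at t within {0..})"
    using path t by (simp add: Pc_continuous_def)
  then have "\<forall>\<^sub>F s in at t within {0..}. wasserstein_inf (f s) (f t) < e"
    using e by (rule order_tendstoD)
  then obtain d where d: "d > 0"
    "\<And>s. s \<ge> 0 \<Longrightarrow> s \<noteq> t \<Longrightarrow> dist s t < d \<Longrightarrow> wasserstein_inf (f s) (f t) < e"
    unfolding eventually_at by auto
  have "\<exists>\<pi>\<in>couplings (f s) (f t). AE z in \<pi>. norm (fst z - snd z) < e"
    if s: "s \<ge> 0" "\<bar>s - t\<bar> < d" for s
  proof (cases "s = t")
    case False
    then show ?thesis
      using coupling_of_wasserstein_inf[OF f_Pc f_Pc d(2)] s t by (metis dist_real_def)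
  next
    \<comment> \<open>The limit in \<open>Pc_continuous\<close> says nothing about
      \<open>s = t\<close>, where the diagonal coupling serves instead.\<close>
    case True
    let ?\<pi> = "distr (f t) borel (\<lambda>x. (x, x))"
    interpret compact_prob "f t" "msupport (f t)" using f_compact_prob t by blast
    have m: "(\<lambda>x. (x, x)) \<in> borel_measurable (f t)"
      by (intro measurable_M borel_measurable_continuous_onI continuous_intros)
    have m2: "fst \<in> borel_measurable (borel :: ('b \<times> 'b) measure)" "snd \<in> borel_measurable (borel :: ('b \<times> 'b) measure)"
      by (intro borel_measurable_continuous_onI continuous_intros)+
    have id: "distr (f t) borel (\<lambda>x. x) = f t"
      by (rule distr_id2) (simp add: sets_M)
    have "distr ?\<pi> borel fst = distr (f t) borel (fst \<circ> (\<lambda>x. (x, x)))"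
      by (rule distr_distr[OF m2(1) m])
    also have "\<dots> = f t"
      using id by (simp add: comp_def)
    finally have 1: "distr ?\<pi> borel fst = f t" .
    have "distr ?\<pi> borel snd = distr (f t) borel (snd \<circ> (\<lambda>x. (x, x)))"
      by (rule distr_distr[OF m2(2) m])
    also have "\<dots> = f t"
      using id by (simp add: comp_def)
    finally have 2: "distr ?\<pi> borel snd = f t" .
    have "?\<pi> \<in> couplings (f t) (f t)"
      using 1 2 prob_space_distr[OF m] by (simp add: couplings_def borel_prob_def)
    moreover have "AE z in ?\<pi>. norm (fst z - snd z) < e"
    proof (subst AE_distr_iff[OF m])
      show "{z \<in> space borel. norm (fst z - snd z) < e} \<in> sets (borel :: ('b \<times> 'b) measure)"
        using m2 by measurable
    qed (use e in simp)
    ultimately show ?thesis using True by blast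
  qed
  with d show ?thesis using that by blast
qed

text \<open>Here the infinity-distance is essential: a coupling with displacement below 1 enlarges
  the support by at most 1, and finitely many such neighbourhoods cover the time interval. A
  distance with finite exponent would not control supports.\<close>

lemma uniform_support:
  obtains M where "M > 0" "\<And>t. t \<in> {0..T} \<Longrightarrow> msupport (f t) \<subseteq> cball 0 M"
proof -
  have "\<exists>B d. d > 0 \<and> (\<forall>s\<ge>0. \<bar>s - t\<bar> < d \<longrightarrow> msupport (f s) \<subseteq> cball 0 B)" if t: "t \<in> {0..T}" for t
  proof -
    have t0: "t \<ge> 0" using t by simp
    obtain d where d: "d > 0"
      "\<And>s. s \<ge> 0 \<Longrightarrow> \<bar>s - t\<bar> < d \<Longrightarrow> \<exists>\<pi>\<in>couplings (f s) (f t). AE z in \<pi>. norm (fst z - snd z) < 1"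
      using near_coupling[OF t0 zero_less_one] by blast
    have "bounded (msupport (f t))"
      using f_Pc[OF t0] by (simp add: Pc_def compact_imp_bounded)
    then obtain B where B: "\<And>x. x \<in> msupport (f t) \<Longrightarrow> norm x \<le> B" by (auto simp: bounded_iff)
    have "msupport (f s) \<subseteq> cball 0 (B + 1)" if s: "s \<ge> 0" "\<bar>s - t\<bar> < d" for s
    proof -
      obtain \<pi> where \<pi>: "\<pi> \<in> couplings (f s) (f t)" "AE z in \<pi>. norm (fst z - snd z) < 1"
        using d(2)[OF s] by blast
      note c = couplingD[OF \<pi>(1)]
      have "AE z in f t. norm z \<le> B"
        using f_compact_prob[OF t0, THEN compact_prob.AE_K] by eventually_elim (rule B)
      then have "AE z in \<pi>. norm (snd z) \<le> B"
        unfolding c(6) by (subst (asm) AE_distr_iff[OF c(4)]) auto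
      with \<pi>(2) have "AE z in \<pi>. fst z \<in> cball 0 (B + 1)"
      proof eventually_elim
        case (elim z)
        then show ?case using norm_triangle_ineq[of "fst z - snd z" "snd z"] by simp
      qed
      then have "AE z in f s. z \<in> cball 0 (B + 1)"
        unfolding c(5) by (subst AE_distr_iff[OF c(3)]) auto
      then show ?thesis
        using f_Pc[OF s(1)] by (intro msupport_subset) (auto simp: Pc_def borel_prob_def)
    qed
    then show ?thesis using d(1) by blast
  qed
  then obtain B d where Bd: "\<And>t. t \<in> {0..T} \<Longrightarrow> d t > 0"
    "\<And>t s. t \<in> {0..T} \<Longrightarrow> s \<ge> 0 \<Longrightarrow> \<bar>s - t\<bar> < d t \<Longrightarrow> msupport (f s) \<subseteq> cball 0 (B t)"
    by metis
  obtain C where C: "C \<subseteq> {0..T}" "finite C" "{0..T} \<subseteq> (\<Union>c\<in>C. ball c (d c))"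
    by (rule compactE_image[of "{0..T}" "{0..T}" "\<lambda>c. ball c (d c)"]) (use Bd(1) in auto)
  \<comment> \<open>A sum in place of a maximum also covers the empty \<open>C\<close> that arises
    for \<open>T < 0\<close>; the added 1 makes \<open>M\<close> positive.\<close>
  define M where "M = (\<Sum>c\<in>C. \<bar>B c\<bar>) + 1"
  have "msupport (f t) \<subseteq> cball 0 M" if t: "t \<in> {0..T}" for t
  proof -
    obtain c where c: "c \<in> C" "dist c t < d c" using C(3) t by auto
    have "c \<in> {0..T}" using C(1) c(1) by blast
    then have "msupport (f t) \<subseteq> cball 0 (B c)"
      using Bd(2)[OF \<open>c \<in> {0..T}\<close>, of t] c t by (simp add: dist_real_def abs_minus_commute)
    moreover have "B c \<le> M"
      using member_le_sum[OF c(1), of "\<lambda>c. \<bar>B c\<bar>"] C(2) by (auto simp: M_def)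
    ultimately show ?thesis by (meson order_trans subset_cball)
  qed
  moreover have "M > 0" unfolding M_def by (simp add: sum_nonneg add_nonneg_pos)
  ultimately show ?thesis using that by blast
qed

text \<open>Both integrals are pulled back to a coupling of \<open>f s\<close> and
  \<open>f t\<close> with small displacement. There the integrands differ by at most the modulus of
  continuity of \<open>G\<close> on a compact set that contains the supports at all times up to
  \<open>t + 1\<close>. Joint continuity in parameter and time is what makes the force field
  continuous in space-time.\<close>

lemma continuous_path_integral:
  fixes G :: "'c::heine_borel \<Rightarrow> 'b \<Rightarrow> 'd::euclidean_space"
  assumes G: "continuous_on UNIV (\<lambda>(x, z). G x z)"
  shows "continuous_on (UNIV \<times> {0..}) (\<lambda>(x, t). \<integral>z. G x z \<partial>(f t))"
  unfolding continuous_on_iff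
proof (intro ballI allI impI)
  fix p :: "'c \<times> real" and e :: real
  assume p: "p \<in> UNIV \<times> {0..}" and e: "e > 0"
  obtain x t where xt: "p = (x, t)" and t: "t \<ge> 0" using p by (cases p) auto
  have cz: "continuous_on UNIV (G y)" for y
  proof -
    have "continuous_on UNIV (\<lambda>z. (y, z))"
      by (intro continuous_on_Pair continuous_on_const continuous_on_id)
    from continuous_on_compose2[OF G this] show ?thesis by simp
  qed
  obtain M where M: "M > 0" "\<And>s. s \<in> {0..t + 1} \<Longrightarrow> msupport (f s) \<subseteq> cball 0 M"
    using uniform_support[of "t + 1"] by blast
  have "uniformly_continuous_on (cball x 1 \<times> cball 0 M) (\<lambda>(x, z). G x z)"
    using G by (intro compact_uniformly_continuous compact_Times) (auto intro: continuous_on_subset)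
  then obtain d where d: "d > 0" and
    *: "\<And>p q. p \<in> cball x 1 \<times> cball 0 M \<Longrightarrow> q \<in> cball x 1 \<times> cball 0 M \<Longrightarrow> dist q p < d \<Longrightarrow>
      dist ((\<lambda>(x, z). G x z) q) ((\<lambda>(x, z). G x z) p) < e / 2"
    unfolding uniformly_continuous_on_def using e by (meson half_gt_zero)
  have d2: "d / 2 > 0" using d by simp
  obtain \<eta> where \<eta>: "\<eta> > 0"
    "\<And>s. s \<ge> 0 \<Longrightarrow> \<bar>s - t\<bar> < \<eta> \<Longrightarrow> \<exists>\<pi>\<in>couplings (f s) (f t). AE z in \<pi>. norm (fst z - snd z) < d / 2"
    using near_coupling[OF t d2] by blast
  show "\<exists>d>0. \<forall>q\<in>UNIV \<times> {0..}. dist q p < d \<longrightarrow>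
    dist (case q of (x, t) \<Rightarrow> \<integral>z. G x z \<partial>f t) (case p of (x, t) \<Rightarrow> \<integral>z. G x z \<partial>f t) < e"
  proof (intro exI[of _ "min \<eta> (min (d / 2) 1)"] conjI ballI impI)
    fix q :: "'c \<times> real" assume q: "q \<in> UNIV \<times> {0..}" "dist q p < min \<eta> (min (d / 2) 1)"
    obtain y s where ys: "q = (y, s)" and s: "s \<ge> 0" using q by (cases q) auto
    have dys: "dist y x < d / 2" "dist y x < 1" "\<bar>s - t\<bar> < \<eta>" "\<bar>s - t\<bar> < 1"
      using q(2) xt ys dist_fst_le[of q p] dist_snd_le[of q p] by (auto simp: dist_real_def)
    obtain \<pi> where \<pi>: "\<pi> \<in> couplings (f s) (f t)" "AE z in \<pi>. norm (fst z - snd z) < d / 2"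
      using \<eta>(2)[OF s dys(3)] by blast
    note c = couplingD[OF \<pi>(1)]
    interpret \<pi>: prob_space \<pi> by (rule c(1))
    interpret s: compact_prob "f s" "msupport (f s)" by (rule f_compact_prob[OF s])
    interpret t: compact_prob "f t" "msupport (f t)" by (rule f_compact_prob[OF t])
    have G1: "integrable \<pi> (\<lambda>z. G y (fst z))" "(\<integral>z. G y z \<partial>f s) = (\<integral>z. G y (fst z) \<partial>\<pi>)"
      using s.integrable_continuous[OF cz[of y]] unfolding c(5)
      by (auto simp: integrable_distr[OF c(3)] integral_distr[OF c(3)] borel_measurable_continuous_onI[OF cz])
    have G2: "integrable \<pi> (\<lambda>z. G x (snd z))" "(\<integral>z. G x z \<partial>f t) = (\<integral>z. G x (snd z) \<partial>\<pi>)"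
      using t.integrable_continuous[OF cz[of x]] unfolding c(6)
      by (auto simp: integrable_distr[OF c(4)] integral_distr[OF c(4)] borel_measurable_continuous_onI[OF cz])
    have "AE z in f s. norm z \<le> M" using s.AE_K
    proof eventually_elim
      case (elim z)
      have "s \<in> {0..t + 1}" using s dys(4) by auto
      from subsetD[OF M(2)[OF this] elim] show ?case by simp
    qed
    then have a1: "AE z in \<pi>. norm (fst z) \<le> M"
      unfolding c(5) by (subst (asm) AE_distr_iff[OF c(3)]) auto
    have "AE z in f t. norm z \<le> M" using t.AE_K
    proof eventually_elim
      case (elim z)
      have "t \<in> {0..t + 1}" using t by auto
      from subsetD[OF M(2)[OF this] elim] show ?case by simp
    qed
    then have a2: "AE z in \<pi>. norm (snd z) \<le> M"
      unfolding c(6) by (subst (asm) AE_distr_iff[OF c(4)]) auto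
    have AE: "AE z in \<pi>. norm (G y (fst z) - G x (snd z)) \<le> e / 2"
      using a1 a2 \<pi>(2)
    proof eventually_elim
      case (elim z)
      have "dist (y, fst z) (x, snd z) \<le> dist y x + dist (fst z) (snd z)"
        by (simp add: dist_Pair_Pair sqrt_sum_squares_le_sum)
      also have "\<dots> < d" using elim(3) dys(1) by (simp add: dist_norm)
      finally show ?case
        using *[of "(x, snd z)" "(y, fst z)"] elim dys(2) by (simp add: dist_commute dist_norm[symmetric] less_imp_le)
    qed
    have "norm ((\<integral>z. G y z \<partial>f s) - (\<integral>z. G x z \<partial>f t)) = norm (\<integral>z. G y (fst z) - G x (snd z) \<partial>\<pi>)"
      using G1 G2 by simp
    also have "\<dots> \<le> (\<integral>z. norm (G y (fst z) - G x (snd z)) \<partial>\<pi>)" by simp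
    also have "\<dots> \<le> (\<integral>z. e / 2 \<partial>\<pi>)"
      using G1 G2 AE by (intro integral_mono_AE) auto
    finally have "norm ((\<integral>z. G y z \<partial>f s) - (\<integral>z. G x z \<partial>f t)) \<le> e / 2"
      using \<pi>.prob_space by simp
    then show "dist (case q of (x, t) \<Rightarrow> \<integral>z. G x z \<partial>f t) (case p of (x, t) \<Rightarrow> \<integral>z. G x z \<partial>f t) < e"
      using e by (simp add: xt ys dist_norm)
  qed (use \<eta> d e in auto)
qed

end

lemma continuous_on_Pair_const: "continuous_on S (Pair c)"
  using continuous_on_Pair[OF continuous_on_const continuous_on_id, of S c] by simp

lemma continuous_on_section:
  assumes "continuous_on (S \<times> UNIV) (\<lambda>(t, z). g t z)" "t \<in> S"
  shows "continuous_on UNIV (g t)"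
proof -
  have "range (Pair t) \<subseteq> S \<times> UNIV" using assms(2) by blast
  from continuous_on_compose2[OF assms(1) continuous_on_Pair_const this] show ?thesis by simp
qed

section \<open>From the weak formulation to a pointwise evolution equation\<close>

text \<open>For \<open>A\<close>, the expected value of \<open>m\<close>, the identity with the time
  cutoff is exact by the fundamental theorem of calculus. Subtraction leaves \<integral> \<eta>' (m
  - A) = 0, while - \<eta>' is a probability density concentrated between \<open>t0\<close> and
  \<open>t0 + 2 / n\<close>, where m - A is nearly constant; hence m - A vanishes at
  \<open>t0\<close>.\<close>

lemma integral_eq_of_weak_form:
  fixes m a :: "real \<Rightarrow> real"
  assumes m: "continuous_on {0..} m" and a: "continuous_on {0..} a"
    and weak: "\<And>t0 n. t0 \<ge> 0 \<Longrightarrow> n > 0 \<Longrightarrow>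
      integral {0..t0 + 2 / n} (\<lambda>t. n * plateau' (n * (t - t0)) * m t + plateau (n * (t - t0)) * a t) = - m0"
    and t0: "t0 \<ge> 0"
  shows "m t0 = m0 + integral {0..t0} a"
proof (rule ccontr)
  define A where "A t = m0 + integral {0..t} a" for t
  define D where "D t = m t - A t" for t
  assume "m t0 \<noteq> m0 + integral {0..t0} a"
  then have c: "\<bar>D t0\<bar> > 0" by (simp add: D_def A_def)
  have aT: "continuous_on {0..T} a" for T using a by (auto intro: continuous_on_subset)
  have A': "(A has_real_derivative a t) (at t within {0..T})" if "t \<in> {0..T}" for t T
    unfolding A_def using integral_has_real_derivative[OF aT that] by (auto intro!: derivative_eq_intros)
  have mT: "continuous_on {0..T} m" for T using m by (auto intro: continuous_on_subset)
  have AT: "continuous_on {0..T} A" for T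
    using A' by (meson DERIV_continuous_on)
  have DT: "continuous_on {0..T} D" for T
    unfolding D_def by (intro continuous_intros mT AT)
  \<comment> \<open>Freezing the argument at 0 extends \<open>D\<close> to negative times, so that
    continuity at \<open>t0 = 0\<close> is an ordinary two-sided statement.\<close>
  have "isCont (\<lambda>t. D (max 0 t)) t0"
  proof -
    have "continuous_on UNIV (\<lambda>t. D (max 0 (min t (t0 + 1))))"
      by (rule continuous_on_compose2[OF DT[of "t0 + 1"]]) (use t0 in \<open>auto intro!: continuous_intros\<close>)
    then have "isCont (\<lambda>t. D (max 0 (min t (t0 + 1)))) t0"
      by (simp add: continuous_on_eq_continuous_at)
    moreover have "\<forall>\<^sub>F t in nhds t0. D (max 0 (min t (t0 + 1))) = D (max 0 t)"
      using eventually_nhds_in_open[of "{..<t0 + 1}" t0] by (auto elim!: eventually_mono)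
    ultimately show ?thesis by (simp add: isCont_cong)
  qed
  then obtain \<delta> where \<delta>: "\<delta> > 0" "\<And>t. \<bar>t - t0\<bar> < \<delta> \<Longrightarrow> \<bar>D (max 0 t) - D (max 0 t0)\<bar> < \<bar>D t0\<bar> / 2"
    unfolding continuous_at_eps_delta dist_real_def using c by (meson half_gt_zero)
  \<comment> \<open>Then \<open>2 / n\<close> is half of \<open>\<delta>\<close>: the whole
    transition of the cutoff lies where \<open>D\<close> is within half of its modulus at
    \<open>t0\<close>.\<close>
  define n where "n = 4 / \<delta>"
  have n: "n > 0" "2 / n < \<delta>" using \<delta>(1) by (auto simp: n_def)
  define T where "T = t0 + 2 / n"
  have T: "T \<ge> 0" "t0 \<le> T" using t0 n by (auto simp: T_def)
  define \<eta> where "\<eta> t = plateau (n * (t - t0))" for t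
  define \<eta>' where "\<eta>' t = n * plateau' (n * (t - t0))" for t
  have \<eta>: "(\<eta> has_real_derivative \<eta>' t) (at t within S)" for t S
    unfolding \<eta>_def \<eta>'_def
    by (rule DERIV_cong[OF DERIV_chain2[OF plateau_DERIV]]) (auto intro!: derivative_eq_intros)
  have c\<eta>: "continuous_on S \<eta>" for S using \<eta> by (meson DERIV_continuous_on)
  have c\<eta>': "continuous_on S \<eta>'" for S unfolding \<eta>'_def
    by (intro continuous_intros continuous_on_compose2[OF continuous_on_plateau'[of UNIV]]) auto
  have \<eta>0: "\<eta> 0 = 1" using t0 n by (simp add: \<eta>_def plateau_eq_1)
  have \<eta>T: "\<eta> T = 0" using n by (simp add: \<eta>_def T_def plateau_eq_0)
  have "((\<lambda>t. \<eta>' t * A t + \<eta> t * a t) has_integral (\<eta> T * A T - \<eta> 0 * A 0)) {0..T}"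
    using T(1) by (intro fundamental_theorem_of_calculus)
      (auto simp flip: has_real_derivative_iff_has_vector_derivative
        intro!: derivative_eq_intros \<eta> A')
  then have 1: "((\<lambda>t. \<eta>' t * A t + \<eta> t * a t) has_integral (- m0)) {0..T}"
    by (simp add: \<eta>0 \<eta>T A_def)
  have "(\<lambda>t. \<eta>' t * m t + \<eta> t * a t) integrable_on {0..T}"
    by (intro integrable_continuous_interval continuous_intros c\<eta> c\<eta>' mT aT)
  then have 2: "((\<lambda>t. \<eta>' t * m t + \<eta> t * a t) has_integral (- m0)) {0..T}"
    using weak[OF t0 n(1)] unfolding \<eta>_def \<eta>'_def T_def
    by (metis (no_types, lifting) has_integral_integrable_integral)
  have 3: "((\<lambda>t. \<eta>' t * D t) has_integral 0) {0..T}"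
    using has_integral_diff[OF 2 1] by (simp add: D_def algebra_simps)
  have "(\<eta>' has_integral (\<eta> T - \<eta> 0)) {0..T}"
    using T(1) by (intro fundamental_theorem_of_calculus)
      (auto simp flip: has_real_derivative_iff_has_vector_derivative intro!: \<eta>)
  then have 4: "(\<eta>' has_integral (- 1)) {0..T}" by (simp add: \<eta>0 \<eta>T)
  \<comment> \<open>As \<eta>' has integral -1, subtracting the constant \<open>D t0\<close> from
    \<open>D\<close> isolates \<open>D t0\<close>, which the estimate below bounds by half of
    itself.\<close>
  have 5: "((\<lambda>t. \<eta>' t * (D t - D t0)) has_integral (D t0)) {0..T}"
    using has_integral_diff[OF 3 has_integral_mult_left[OF 4, of "D t0"]] by (simp add: algebra_simps)
  have 6: "((\<lambda>t. - \<eta>' t * (\<bar>D t0\<bar> / 2)) has_integral (1 * (\<bar>D t0\<bar> / 2))) {0..T}"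
    using has_integral_mult_left[OF has_integral_neg[OF 4], of "\<bar>D t0\<bar> / 2"] by simp
  have "norm (D t0) \<le> 1 * (\<bar>D t0\<bar> / 2)"
  proof (rule order_trans)
    have "norm (integral {0..T} (\<lambda>t. \<eta>' t * (D t - D t0))) \<le> integral {0..T} (\<lambda>t. - \<eta>' t * (\<bar>D t0\<bar> / 2))"
    proof (rule integral_norm_bound_integral)
      fix t assume t: "t \<in> {0..T}"
      show "norm (\<eta>' t * (D t - D t0)) \<le> - \<eta>' t * (\<bar>D t0\<bar> / 2)"
      proof (cases "t \<le> t0")
        case True
        then have "\<eta>' t = 0" using n by (simp add: \<eta>'_def plateau'_eq_0' mult_nonneg_nonpos)
        then show ?thesis by simp
      next
        case False
        have "\<eta>' t \<le> 0" using n plateau'_nonpos by (simp add: \<eta>'_def mult_nonneg_nonpos)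
        moreover have "\<bar>D t - D t0\<bar> \<le> \<bar>D t0\<bar> / 2"
          using \<delta>(2)[of t] t False n t0 by (auto simp: T_def)
        ultimately have "\<bar>\<eta>' t\<bar> * \<bar>D t - D t0\<bar> \<le> \<bar>\<eta>' t\<bar> * (\<bar>D t0\<bar> / 2)"
          by (intro mult_left_mono) auto
        then show ?thesis using \<open>\<eta>' t \<le> 0\<close> by (simp add: abs_mult)
      qed
    qed (use 5 6 in blast)+
    then show "norm (D t0) \<le> integral {0..T} (\<lambda>t. - \<eta>' t * (\<bar>D t0\<bar> / 2))"
      using 5 by (simp add: integral_unique)
    show "integral {0..T} (\<lambda>t. - \<eta>' t * (\<bar>D t0\<bar> / 2)) \<le> 1 * (\<bar>D t0\<bar> / 2)"
      using 6 by (metis integral_unique order_refl)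
  qed
  then show False using c by simp
qed

locale mean_field =
  fixes V :: "'a::euclidean_space \<Rightarrow> real" and \<psi> :: "real \<Rightarrow> real"
    and f0 :: "('a \<times> 'a) measure" and f :: "real \<Rightarrow> ('a \<times> 'a) measure"
  assumes gradV_uc: "uniformly_continuous_on UNIV (grad V)"
    and \<psi>_cont: "continuous_on {0..} \<psi>"
    and f0_Pc: "f0 \<in> Pc"
    and solution: "mean_field_solution V \<psi> f0 f"
begin

sublocale Pc_path f
  using solution by unfold_locales (simp add: mean_field_solution_def)

definition pair_force :: "'a \<times> 'a \<Rightarrow> 'a \<times> 'a \<Rightarrow> 'a" where
  "pair_force z z' = \<psi> (norm (fst z - fst z')) *\<^sub>R (snd z - snd z') - grad V (fst z' - fst z)"

definition force :: "real \<Rightarrow> 'a \<times> 'a \<Rightarrow> 'a" where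
  "force t z = (\<integral>z'. pair_force z z' \<partial>(f t))"

text \<open>The sign comes from the weak form, where the force term stands alone on the right-hand
  side; moved to the left, it transports velocities by \<open>- force\<close>.\<close>

definition field :: "real \<Rightarrow> 'a \<times> 'a \<Rightarrow> 'a \<times> 'a" where
  "field t z = (snd z - mean_velocity f0, - force t z)"

lemma gradV_cont: "continuous_on S (grad V)"
  using uniformly_continuous_imp_continuous[OF gradV_uc] continuous_on_subset by blast

lemma continuous_pair_force: "continuous_on UNIV (\<lambda>(z, z'). pair_force z z')"
  unfolding pair_force_def case_prod_beta
  by (intro continuous_intros continuous_on_compose2[OF \<psi>_cont] continuous_on_compose2[OF gradV_cont[of UNIV]]) auto

lemma continuous_force: "continuous_on ({0..} \<times> UNIV) (\<lambda>(t, z). force t z)"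
proof -
  have "continuous_on (UNIV \<times> {0..}) (\<lambda>(z, t). force t z)"
    unfolding force_def by (rule continuous_path_integral[OF continuous_pair_force])
  then have "continuous_on ({0..} \<times> UNIV) (\<lambda>p. (\<lambda>(z, t). force t z) (snd p, fst p))"
    by (rule continuous_on_compose2) (auto intro!: continuous_intros)
  then show ?thesis by (simp add: case_prod_beta)
qed

lemma continuous_field: "continuous_on ({0..} \<times> UNIV) (\<lambda>(t, z). field t z)"
  using continuous_force unfolding field_def case_prod_beta by (auto intro!: continuous_intros)

lemma continuous_force_at: "t \<ge> 0 \<Longrightarrow> continuous_on UNIV (force t)"
  by (rule continuous_on_section[OF continuous_force]) simp

lemma continuous_field_at: "t \<ge> 0 \<Longrightarrow> continuous_on UNIV (field t)"
  by (rule continuous_on_section[OF continuous_field]) simp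

text \<open>Integrand and measure move together, so the joint continuity of
  \<open>continuous_path_integral\<close> is restricted to the diagonal. That lemma wants an
  integrand continuous for all real parameters, hence the detour through
  \<open>max 0 s\<close>.\<close>

lemma continuous_integral_time:
  fixes G :: "real \<Rightarrow> 'a \<times> 'a \<Rightarrow> real"
  assumes "continuous_on ({0..} \<times> UNIV) (\<lambda>(t, z). G t z)"
  shows "continuous_on {0..} (\<lambda>t. \<integral>z. G t z \<partial>(f t))"
proof -
  have "continuous_on UNIV (\<lambda>p. (\<lambda>(t, z). G t z) (max 0 (fst p), snd p))"
    by (rule continuous_on_compose2[OF assms]) (auto intro!: continuous_intros)
  then have "continuous_on UNIV (\<lambda>(s, z). G (max 0 s) z)" by (simp add: case_prod_beta)
  from continuous_path_integral[OF this]
  have "continuous_on {0..} (\<lambda>t. (\<lambda>(s, t). \<integral>z. G (max 0 s) z \<partial>(f t)) (t, t))"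
    by (rule continuous_on_compose2) (auto intro!: continuous_intros)
  then show ?thesis by (rule continuous_on_eq) auto
qed

text \<open>The test function is a time cutoff times \<open>\<phi>\<close>. The cutoff vanishes
  after \<open>t0 + 2 / n\<close>, so the Lebesgue integrals over the half-line become integrals of
  continuous functions over a compact interval; it equals 1 at time 0, so the initial term survives
  unchanged.\<close>

lemma weak_form_product:
  fixes \<phi> :: "'a \<times> 'a \<Rightarrow> real"
  assumes smooth: "\<And>k. Ck_on k UNIV \<phi>"
    and \<phi>': "\<And>z. (\<phi> has_derivative (\<lambda>y. \<phi>' z \<bullet> y)) (at z)" and c\<phi>': "continuous_on UNIV \<phi>'"
    and supp: "bounded {z. \<phi> z \<noteq> 0}"
    and t0: "t0 \<ge> 0" and n: "n > 0"
  shows "integral {0..t0 + 2 / n} (\<lambda>t. n * plateau' (n * (t - t0)) * (\<integral>z. \<phi> z \<partial>(f t))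
      + plateau (n * (t - t0)) * (\<integral>z. field t z \<bullet> \<phi>' z \<partial>(f t))) = - (\<integral>z. \<phi> z \<partial>f0)"
proof -
  define T where "T = t0 + 2 / n"
  define \<eta> where "\<eta> t = plateau (n * (t - t0))" for t
  define \<eta>' where "\<eta>' t = n * plateau' (n * (t - t0))" for t
  have \<eta>: "(\<eta> has_real_derivative \<eta>' t) (at t within S)" for t S
    unfolding \<eta>_def \<eta>'_def
    by (rule DERIV_cong[OF DERIV_chain2[OF plateau_DERIV]]) (auto intro!: derivative_eq_intros)
  have c\<eta>: "continuous_on S \<eta>" for S using \<eta> by (meson DERIV_continuous_on)
  have c\<eta>': "continuous_on S \<eta>'" for S unfolding \<eta>'_def
    by (intro continuous_intros continuous_on_compose2[OF continuous_on_plateau'[of UNIV]]) auto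
  have \<eta>T: "\<eta> t = 0" "\<eta>' t = 0" if "t > T" for t
  proof -
    have "n * (t - t0) \<ge> 2" using that n by (simp add: T_def field_simps)
    then show "\<eta> t = 0" "\<eta>' t = 0" by (auto simp: \<eta>_def \<eta>'_def plateau_eq_0 plateau'_eq_0)
  qed
  define h :: "real \<times> 'a \<times> 'a \<Rightarrow> real" where "h p = \<eta> (fst p) * \<phi> (snd p)" for p
  have c\<phi>: "continuous_on UNIV \<phi>" using smooth[of 0] by simp
  have "h \<in> test_functions"
    unfolding test_functions_def mem_Collect_eq smooth_on_def
  proof (intro conjI allI)
    fix k
    have "Ck_on k UNIV (\<lambda>p::real \<times> 'a \<times> 'a. plateau (n * (p \<bullet> (1, 0) + - t0)) * \<phi> (snd p))"
      by (intro Ck_on_mult Ck_on_add Ck_on_plateau Ck_on_const Ck_on_inner Ck_on_compose_snd smooth)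
    moreover have "h = (\<lambda>p. plateau (n * (p \<bullet> (1, 0) + - t0)) * \<phi> (snd p))"
      by (auto simp: h_def \<eta>_def inner_prod_def)
    ultimately show "Ck_on k ({0..} \<times> UNIV \<times> UNIV) h"
      using Ck_on_subset by (metis subset_UNIV)
  next
    have "support_on ({0..} \<times> UNIV \<times> UNIV) h \<subseteq> {0..T} \<times> {z. \<phi> z \<noteq> 0}"
    proof
      fix p assume "p \<in> support_on ({0..} \<times> UNIV \<times> UNIV) h"
      then have "fst p \<ge> 0" "\<eta> (fst p) \<noteq> 0" "\<phi> (snd p) \<noteq> 0"
        by (auto simp: support_on_def h_def)
      then show "p \<in> {0..T} \<times> {z. \<phi> z \<noteq> 0}"
        using \<eta>T(1)[of "fst p"] by (cases p) force
    qed
    moreover have "bounded ({0..T} \<times> {z. \<phi> z \<noteq> 0})" using supp by (intro bounded_Times) auto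
    ultimately show "compact (closure (support_on ({0..} \<times> UNIV \<times> UNIV) h))"
      using bounded_subset by auto
  qed
  then have weak: "(LINT t:{0..}|lborel.
           (\<integral>z. d_t h t z + (snd z - mean_velocity f0) \<bullet> grad_r h t z \<partial>(f t)))
        + (\<integral>z. h (0, z) \<partial>f0)
      = (LINT t:{0..}|lborel. (\<integral>z. force t z \<bullet> grad_v h t z \<partial>(f t)))"
    using solution unfolding mean_field_solution_def force_def pair_force_def by blast
  have dt: "d_t h t z = \<eta>' t * \<phi> z" if "t \<ge> 0" for t z
    unfolding d_t_def
  proof (rule vector_derivative_within)
    show "at t within {0..} \<noteq> bot"
    proof -
      have "t islimpt {0..}"
        using that islimpt_greaterThanLessThan1[of t "t + 1"] by (auto intro: islimpt_subset)
      then show ?thesis by (simp add: trivial_limit_within)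
    qed
    show "((\<lambda>s. h (s, z)) has_vector_derivative \<eta>' t * \<phi> z) (at t within {0..})"
      unfolding h_def has_real_derivative_iff_has_vector_derivative[symmetric]
      by (auto intro!: derivative_eq_intros \<eta>)
  qed
  have gr: "grad_r h t z = \<eta> t *\<^sub>R fst (\<phi>' z)" for t z
    unfolding grad_r_def
  proof (rule grad_eq)
    have "((\<lambda>r. (r, snd z)) has_derivative (\<lambda>y. (y, 0))) (at (fst z))"
      by (auto intro!: derivative_eq_intros)
    from has_derivative_compose[OF this, of \<phi> "\<lambda>y. \<phi>' z \<bullet> y"] \<phi>'[of z]
    have "((\<lambda>r. \<phi> (r, snd z)) has_derivative (\<lambda>y. \<phi>' z \<bullet> (y, 0))) (at (fst z))" by simp
    from has_derivative_mult_right[OF this, of "\<eta> t"]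
    show "((\<lambda>r. h (t, r, snd z)) has_derivative (\<lambda>y. (\<eta> t *\<^sub>R fst (\<phi>' z)) \<bullet> y)) (at (fst z))"
      by (simp add: h_def inner_prod_def)
  qed
  have gv: "grad_v h t z = \<eta> t *\<^sub>R snd (\<phi>' z)" for t z
    unfolding grad_v_def
  proof (rule grad_eq)
    have "((\<lambda>r. (fst z, r)) has_derivative (\<lambda>y. (0, y))) (at (snd z))"
      by (auto intro!: derivative_eq_intros)
    from has_derivative_compose[OF this, of \<phi> "\<lambda>y. \<phi>' z \<bullet> y"] \<phi>'[of z]
    have "((\<lambda>r. \<phi> (fst z, r)) has_derivative (\<lambda>y. \<phi>' z \<bullet> (0, y))) (at (snd z))" by simp
    from has_derivative_mult_right[OF this, of "\<eta> t"]
    show "((\<lambda>r. h (t, fst z, r)) has_derivative (\<lambda>y. (\<eta> t *\<^sub>R snd (\<phi>' z)) \<bullet> y)) (at (snd z))"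
      by (simp add: h_def inner_prod_def)
  qed
  define a1 where "a1 t = (\<integral>z. (snd z - mean_velocity f0) \<bullet> fst (\<phi>' z) \<partial>(f t))" for t
  define a2 where "a2 t = (\<integral>z. force t z \<bullet> snd (\<phi>' z) \<partial>(f t))" for t
  define m where "m t = (\<integral>z. \<phi> z \<partial>(f t))" for t
  have comp: "continuous_on S (\<lambda>p. \<phi> (snd p))" "continuous_on S (\<lambda>p. \<phi>' (snd p))" for S :: "(real \<times> 'a \<times> 'a) set"
    using c\<phi> c\<phi>' by (auto intro!: continuous_on_compose2[of UNIV \<phi>] continuous_on_compose2[of UNIV \<phi>'] continuous_intros)
  have ca1: "continuous_on {0..} a1" unfolding a1_def
    by (rule continuous_integral_time) (auto simp: case_prod_beta intro!: continuous_intros comp)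
  have ca2: "continuous_on {0..} a2" unfolding a2_def
    by (rule continuous_integral_time)
      (use continuous_force in \<open>auto simp: case_prod_beta intro!: continuous_intros comp\<close>)
  have cm: "continuous_on {0..} m" unfolding m_def
    by (rule continuous_integral_time) (auto simp: case_prod_beta intro!: continuous_intros comp)
  have int: "integrable (f t) \<phi>" "integrable (f t) (\<lambda>z. (snd z - mean_velocity f0) \<bullet> fst (\<phi>' z))"
    "integrable (f t) (\<lambda>z. force t z \<bullet> snd (\<phi>' z))" if "t \<ge> 0" for t
    by (intro compact_prob.integrable_continuous[OF f_compact_prob[OF that]] continuous_intros c\<phi> c\<phi>'
        continuous_force_at that)+
  have L: "(\<integral>z. d_t h t z + (snd z - mean_velocity f0) \<bullet> grad_r h t z \<partial>(f t)) = \<eta>' t * m t + \<eta> t * a1 t"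
    if "t \<ge> 0" for t
    using int[OF that] by (simp add: dt that gr m_def a1_def)
  have R: "(\<integral>z. force t z \<bullet> grad_v h t z \<partial>(f t)) = \<eta> t * a2 t" for t
    by (simp add: gv a2_def)
  \<comment> \<open>Passes from the set integral over the half-line to the integral over
    \<open>{0..T}\<close>, for an integrand known only at nonnegative times and zero after
    \<open>T\<close>.\<close>
  have set_int: "(LINT t:{0..}|lborel. u t) = integral {0..T} g"
    if "\<And>t. t \<ge> 0 \<Longrightarrow> u t = g t" "\<And>t. t > T \<Longrightarrow> g t = 0" "continuous_on {0..} g" for u g :: "real \<Rightarrow> real"
  proof -
    have "(LINT t:{0..}|lborel. u t) = (LINT t:{0..T}|lborel. g t)"
      unfolding set_lebesgue_integral_def
      by (rule Bochner_Integration.integral_cong) (use that in \<open>auto simp: indicator_def\<close>)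
    also have "\<dots> = integral {0..T} g"
      by (intro set_borel_integral_eq_integral borel_integrable_atLeastAtMost')
        (use that(3) in \<open>auto intro: continuous_on_subset\<close>)
    finally show ?thesis .
  qed
  have WL: "(LINT t:{0..}|lborel. (\<integral>z. d_t h t z + (snd z - mean_velocity f0) \<bullet> grad_r h t z \<partial>(f t)))
      = integral {0..T} (\<lambda>t. \<eta>' t * m t + \<eta> t * a1 t)"
    by (rule set_int[OF L]) (auto simp: \<eta>T intro!: continuous_intros c\<eta> c\<eta>' cm ca1)
  have WR: "(LINT t:{0..}|lborel. (\<integral>z. force t z \<bullet> grad_v h t z \<partial>(f t)))
      = integral {0..T} (\<lambda>t. \<eta> t * a2 t)"
    by (rule set_int[OF R]) (auto simp: \<eta>T intro!: continuous_intros c\<eta> ca2)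
  have "integral {0..T} (\<lambda>t. \<eta>' t * m t + \<eta> t * a1 t) + \<eta> 0 * (\<integral>z. \<phi> z \<partial>f0) = integral {0..T} (\<lambda>t. \<eta> t * a2 t)"
    using weak unfolding WL WR by (simp add: h_def)
  moreover have "\<eta> 0 = 1" using t0 n by (simp add: \<eta>_def plateau_eq_1)
  moreover have "integral {0..T} (\<lambda>t. \<eta>' t * m t + \<eta> t * (a1 t - a2 t))
      = integral {0..T} (\<lambda>t. (\<eta>' t * m t + \<eta> t * a1 t) - \<eta> t * a2 t)"
    by (simp add: algebra_simps)
  moreover have "\<dots> = integral {0..T} (\<lambda>t. \<eta>' t * m t + \<eta> t * a1 t) - integral {0..T} (\<lambda>t. \<eta> t * a2 t)"
    by (intro integral_diff integrable_continuous_interval continuous_intros c\<eta> c\<eta>'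
        continuous_on_subset[OF cm] continuous_on_subset[OF ca1] continuous_on_subset[OF ca2]) auto
  ultimately have *: "integral {0..T} (\<lambda>t. \<eta>' t * m t + \<eta> t * (a1 t - a2 t)) = - (\<integral>z. \<phi> z \<partial>f0)"
    by simp
  have "integral {0..T} (\<lambda>t. \<eta>' t * m t + \<eta> t * (\<integral>z. field t z \<bullet> \<phi>' z \<partial>(f t)))
      = integral {0..T} (\<lambda>t. \<eta>' t * m t + \<eta> t * (a1 t - a2 t))"
  proof (rule integral_cong)
    fix t assume "t \<in> {0..T}"
    then have "(\<integral>z. field t z \<bullet> \<phi>' z \<partial>(f t)) = a1 t - a2 t"
      using int[of t] unfolding a1_def a2_def
      by (subst Bochner_Integration.integral_diff[symmetric]) (auto simp: field_def inner_prod_def)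
    then show "\<eta>' t * m t + \<eta> t * (\<integral>z. field t z \<bullet> \<phi>' z \<partial>(f t)) = \<eta>' t * m t + \<eta> t * (a1 t - a2 t)"
      by simp
  qed
  with * show ?thesis by (simp add: \<eta>_def \<eta>'_def m_def T_def)
qed

text \<open>Once the time cutoff is removed, the identity at time 0 yields the initial condition,
  which the notion of solution contains only in weak form.\<close>

lemma
  fixes \<phi> :: "'a \<times> 'a \<Rightarrow> real"
  assumes smooth: "\<And>k. Ck_on k UNIV \<phi>"
    and \<phi>': "\<And>z. (\<phi> has_derivative (\<lambda>y. \<phi>' z \<bullet> y)) (at z)" and c\<phi>': "continuous_on UNIV \<phi>'"
    and supp: "bounded {z. \<phi> z \<noteq> 0}"
  shows weak_derivative: "t \<in> {0..T} \<Longrightarrow>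
      ((\<lambda>s. \<integral>z. \<phi> z \<partial>(f s)) has_real_derivative (\<integral>z. field t z \<bullet> \<phi>' z \<partial>(f t))) (at t within {0..T})"
    and weak_initial: "(\<integral>z. \<phi> z \<partial>(f 0)) = (\<integral>z. \<phi> z \<partial>f0)"
proof -
  define a where "a t = (\<integral>z. field t z \<bullet> \<phi>' z \<partial>(f t))" for t
  have c\<phi>: "continuous_on UNIV \<phi>" using smooth[of 0] by simp
  have comp: "continuous_on S (\<lambda>p. \<phi> (snd p))" "continuous_on S (\<lambda>p. \<phi>' (snd p))" for S :: "(real \<times> 'a \<times> 'a) set"
    using c\<phi> c\<phi>' by (auto intro!: continuous_on_compose2[of UNIV \<phi>] continuous_on_compose2[of UNIV \<phi>'] continuous_intros)
  have ca: "continuous_on {0..} a" unfolding a_def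
    by (rule continuous_integral_time)
      (use continuous_field in \<open>auto simp: case_prod_beta intro!: continuous_intros comp\<close>)
  have cm: "continuous_on {0..} (\<lambda>t. \<integral>z. \<phi> z \<partial>(f t))"
    by (rule continuous_integral_time) (auto simp: case_prod_beta intro!: continuous_intros comp)
  have eq: "(\<integral>z. \<phi> z \<partial>(f t)) = (\<integral>z. \<phi> z \<partial>f0) + integral {0..t} a" if "t \<ge> 0" for t
    using weak_form_product[OF assms] by (intro integral_eq_of_weak_form cm ca that) (simp add: a_def)
  from eq[of 0] show "(\<integral>z. \<phi> z \<partial>(f 0)) = (\<integral>z. \<phi> z \<partial>f0)" by simp
  assume t: "t \<in> {0..T}"
  have "continuous_on {0..T} a" using ca by (auto intro: continuous_on_subset)
  from integral_has_real_derivative[OF this t]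
  have "((\<lambda>t. (\<integral>z. \<phi> z \<partial>f0) + integral {0..t} a) has_real_derivative a t) (at t within {0..T})"
    by (auto intro!: derivative_eq_intros)
  then show "((\<lambda>s. \<integral>z. \<phi> z \<partial>(f s)) has_real_derivative (\<integral>z. field t z \<bullet> \<phi>' z \<partial>(f t))) (at t within {0..T})"
    unfolding a_def[symmetric] by (rule has_field_derivative_transform_within[OF _ zero_less_one]) (use t eq in auto)
qed

end

section \<open>Transport along the flow\<close>

lemma flat0_mono: "x \<le> y \<Longrightarrow> flat_exp 0 x \<le> flat_exp 0 y"
  by (auto simp: flat0 frac_le)

lemma plateau_le_1: "plateau x \<le> 1"
  using flat0_mono[of "1 / 2 - flat_exp 0 x" "1 / 2"] flat_half_pos flat0_nonneg[of x]
  by (simp add: plateau_def)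

text \<open>The limit by which products of smooth supersolutions turn into indicators of open
  sets.\<close>

lemma flat0_scaled_tendsto: "(\<lambda>n. flat_exp 0 (real (Suc n) * u)) \<longlonglongrightarrow> (if u > 0 then 1 else 0)"
proof (cases "u > 0")
  case True
  have "(\<lambda>n. exp (- (inverse (real (Suc n)) * (1 / u)))) \<longlonglongrightarrow> exp (- (0 * (1 / u)))"
    by (intro tendsto_intros LIMSEQ_inverse_real_of_nat)
  then show ?thesis using True
    by (simp add: flat0 zero_less_mult_iff inverse_eq_divide divide_divide_eq_left)
next
  case False
  have "\<not> 0 < real (Suc n) * u" for n
    using False by (simp add: zero_less_mult_iff)
  then have "(\<lambda>n. flat_exp 0 (real (Suc n) * u)) = (\<lambda>_. 0)" by (simp only: flat0 if_False)
  then show ?thesis using False by simp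
qed

context mean_field
begin

text \<open>A product rule, as both the function and the measure depend on time. Write
  \<open>h s\<close> as \<open>h t\<close> plus the difference \<open>h s - h t\<close>. For the
  first, the weak derivative applies to a fixed function; the second is integrated against
  \<open>f s\<close>, its quotient is uniformly close to \<open>ht t\<close>, and continuity in time
  of the integral of \<open>ht t\<close> replaces \<open>f s\<close> by \<open>f t\<close>.\<close>

lemma transport_derivative:
  fixes h ht :: "real \<Rightarrow> 'a \<times> 'a \<Rightarrow> real"
  assumes smooth: "\<And>t k. t \<in> {0..T} \<Longrightarrow> Ck_on k UNIV (h t)"
    and h': "\<And>t z. t \<in> {0..T} \<Longrightarrow> (h t has_derivative (\<lambda>y. h' t z \<bullet> y)) (at z)"
    and ch': "\<And>t. t \<in> {0..T} \<Longrightarrow> continuous_on UNIV (h' t)"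
    and supp: "\<And>t. t \<in> {0..T} \<Longrightarrow> bounded {z. h t z \<noteq> 0}"
    and ht: "\<And>t z. t \<in> {0..T} \<Longrightarrow> ((\<lambda>s. h s z) has_real_derivative ht t z) (at t within {0..T})"
    and cht: "continuous_on ({0..T} \<times> UNIV) (\<lambda>(t, z). ht t z)"
    and t: "t \<in> {0..T}"
  shows "((\<lambda>s. \<integral>z. h s z \<partial>(f s)) has_real_derivative
      (\<integral>z. ht t z + field t z \<bullet> h' t z \<partial>(f t))) (at t within {0..T})"
proof -
  obtain M where M: "M > 0" "\<And>t. t \<in> {0..T} \<Longrightarrow> msupport (f t) \<subseteq> cball 0 M"
    using uniform_support[of T] by blast
  have t0: "t \<ge> 0" using t by simp
  have ch: "continuous_on UNIV (h s)" if "s \<in> {0..T}" for s using smooth[OF that, of 0] by simp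
  have chts: "continuous_on UNIV (ht s)" if "s \<in> {0..T}" for s
    using continuous_on_section[OF cht that] .
  have int: "integrable (f s) g" if "s \<in> {0..T}" "continuous_on UNIV g" for s and g :: "'a \<times> 'a \<Rightarrow> real"
    using compact_prob.integrable_continuous[OF f_compact_prob that(2)] that(1) by simp
  have 1: "((\<lambda>s. \<integral>z. h t z \<partial>(f s)) has_real_derivative (\<integral>z. field t z \<bullet> h' t z \<partial>(f t))) (at t within {0..T})"
    by (rule weak_derivative[OF smooth h' ch' supp t]) (use t in auto)
  have 2: "((\<lambda>s. \<integral>z. h s z - h t z \<partial>(f s)) has_real_derivative (\<integral>z. ht t z \<partial>(f t))) (at t within {0..T})"
    unfolding has_field_derivative_def has_derivative_within_alt
  proof (intro conjI allI impI)
    show "bounded_linear ((*) (\<integral>z. ht t z \<partial>(f t)))" by (rule bounded_linear_mult_right)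
    fix e :: real assume e: "e > 0"
    then have e2: "e / 2 > 0" by simp
    have cK: "continuous_on ({0..T} \<times> cball 0 M) (\<lambda>(t, z). ht t z)"
      using cht by (rule continuous_on_subset) auto
    have htK: "((\<lambda>s. h s z) has_real_derivative ht t z) (at t within {0..T})"
      if "t \<in> {0..T}" "z \<in> cball 0 M" for t z using ht that by blast
    obtain d1 where d1: "d1 > 0" and pt: "\<And>s z. s \<in> {0..T} \<Longrightarrow> \<bar>s - t\<bar> < d1 \<Longrightarrow> z \<in> cball 0 M \<Longrightarrow>
      \<bar>h s z - h t z - ht t z * (s - t)\<bar> \<le> e / 2 * \<bar>s - t\<bar>"
      by (rule uniform_difference_quotient[OF compact_cball cK htK t e2]) blast+
    have "continuous_on {0..} (\<lambda>s. \<integral>z. ht t z \<partial>(f s))"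
      by (rule continuous_integral_time)
        (auto simp: case_prod_beta intro!: continuous_on_compose2[OF chts[OF t]] continuous_intros)
    then obtain d2 where d2: "d2 > 0" "\<And>s. s \<ge> 0 \<Longrightarrow> dist s t < d2 \<Longrightarrow>
      dist (\<integral>z. ht t z \<partial>(f s)) (\<integral>z. ht t z \<partial>(f t)) < e / 2"
      unfolding continuous_on_iff using t0 e2 by (metis atLeast_iff)
    show "\<exists>d>0. \<forall>s\<in>{0..T}. norm (s - t) < d \<longrightarrow>
      norm ((\<integral>z. h s z - h t z \<partial>(f s)) - (\<integral>z. h t z - h t z \<partial>(f t)) - (\<integral>z. ht t z \<partial>(f t)) * (s - t))
        \<le> e * norm (s - t)"
    proof (intro exI[of _ "min d1 d2"] conjI ballI impI)
      fix s assume s: "s \<in> {0..T}" "norm (s - t) < min d1 d2"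
      then have s0: "s \<ge> 0" by simp
      interpret s: compact_prob "f s" "msupport (f s)" by (rule f_compact_prob[OF s0])
      note ints = int[OF s(1) ch[OF s(1)]] int[OF s(1) ch[OF t]] int[OF s(1) chts[OF t]]
      have "\<bar>\<integral>z. h s z - h t z - ht t z * (s - t) \<partial>(f s)\<bar> \<le> e / 2 * \<bar>s - t\<bar>"
        unfolding real_norm_def[symmetric]
      proof (rule s.norm_integral_le)
        fix z assume "z \<in> msupport (f s)"
        then have "z \<in> cball 0 M" using M(2)[OF s(1)] by blast
        then show "norm (h s z - h t z - ht t z * (s - t)) \<le> e / 2 * norm (s - t)"
          using pt[OF s(1)] s(2) by simp
      qed (use ints in auto)
      then have A: "\<bar>(\<integral>z. h s z - h t z \<partial>(f s)) - (\<integral>z. ht t z \<partial>(f s)) * (s - t)\<bar> \<le> e / 2 * \<bar>s - t\<bar>"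
        using ints by simp
      have "\<bar>(\<integral>z. ht t z \<partial>(f s)) - (\<integral>z. ht t z \<partial>(f t))\<bar> \<le> e / 2"
        using d2(2)[OF s0] s(2) by (simp add: dist_real_def)
      then have B: "\<bar>((\<integral>z. ht t z \<partial>(f s)) - (\<integral>z. ht t z \<partial>(f t))) * (s - t)\<bar> \<le> e / 2 * \<bar>s - t\<bar>"
        unfolding abs_mult by (rule mult_right_mono) simp
      show "norm ((\<integral>z. h s z - h t z \<partial>(f s)) - (\<integral>z. h t z - h t z \<partial>(f t)) - (\<integral>z. ht t z \<partial>(f t)) * (s - t))
        \<le> e * norm (s - t)"
      proof -
        have *: "\<bar>X - Z * r\<bar> \<le> e * \<bar>r\<bar>" if "\<bar>X - Y * r\<bar> \<le> e / 2 * \<bar>r\<bar>" "\<bar>(Y - Z) * r\<bar> \<le> e / 2 * \<bar>r\<bar>"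
          for X Y Z r :: real
        proof -
          have "X - Z * r = (X - Y * r) + (Y - Z) * r" "e / 2 * \<bar>r\<bar> + e / 2 * \<bar>r\<bar> = e * \<bar>r\<bar>"
            by (simp_all add: algebra_simps)
          then show ?thesis using that by linarith
        qed
        from *[OF A B] show ?thesis by simp
      qed
    qed (use d1 d2 in auto)
  qed
  have "((\<lambda>s. (\<integral>z. h s z - h t z \<partial>(f s)) + (\<integral>z. h t z \<partial>(f s))) has_real_derivative
      ((\<integral>z. ht t z \<partial>(f t)) + (\<integral>z. field t z \<bullet> h' t z \<partial>(f t)))) (at t within {0..T})"
    by (rule DERIV_add[OF 2 1])
  moreover have "(\<integral>z. ht t z \<partial>(f t)) + (\<integral>z. field t z \<bullet> h' t z \<partial>(f t))
      = (\<integral>z. ht t z + field t z \<bullet> h' t z \<partial>(f t))"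
    by (intro Bochner_Integration.integral_add[symmetric] int t chts continuous_intros continuous_field_at ch' t0)
  ultimately have "((\<lambda>s. (\<integral>z. h s z - h t z \<partial>(f s)) + (\<integral>z. h t z \<partial>(f s))) has_real_derivative
      (\<integral>z. ht t z + field t z \<bullet> h' t z \<partial>(f t))) (at t within {0..T})" by simp
  then show ?thesis
  proof (rule has_field_derivative_transform_within[OF _ zero_less_one t])
    fix s assume "s \<in> {0..T}"
    then show "(\<integral>z. h s z - h t z \<partial>(f s)) + (\<integral>z. h t z \<partial>(f s)) = (\<integral>z. h s z \<partial>(f s))"
      using int[OF _ ch] int[OF _ ch[OF t]] by simp
  qed
qed

text \<open>Nonnegative smooth functions that do not increase along characteristics in the ball.\<close>

definition supersolution :: "real \<Rightarrow> real \<Rightarrow> (real \<Rightarrow> 'a \<times> 'a \<Rightarrow> real) \<Rightarrow> bool" where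
  "supersolution T M h \<longleftrightarrow> (\<exists>h' ht.
     (\<forall>t\<in>{0..T}. (\<forall>k. Ck_on k UNIV (h t)) \<and> (\<forall>z. h t z \<ge> 0) \<and>
        (\<forall>z. (h t has_derivative (\<lambda>y. h' t z \<bullet> y)) (at z)) \<and> continuous_on UNIV (h' t) \<and>
        (\<forall>z. ((\<lambda>s. h s z) has_real_derivative ht t z) (at t within {0..T})) \<and>
        (\<forall>z\<in>cball 0 M. ht t z + field t z \<bullet> h' t z \<le> 0)) \<and>
     continuous_on ({0..T} \<times> UNIV) (\<lambda>(t, z). ht t z) \<and>
     continuous_on ({0..T} \<times> UNIV) (\<lambda>(t, z). h t z))"

text \<open>The transport derivative of the product is \<open>g\<close> times that of
  \<open>h\<close> plus \<open>h\<close> times that of \<open>g\<close>; nonnegativity was built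
  into the notion to keep both terms nonpositive.\<close>

lemma supersolution_mult:
  assumes "supersolution T M g" "supersolution T M h"
  shows "supersolution T M (\<lambda>t z. g t z * h t z)"
proof -
  from assms(1) obtain g' gt where g:
    "\<And>t k. t \<in> {0..T} \<Longrightarrow> Ck_on k UNIV (g t)" "\<And>t z. t \<in> {0..T} \<Longrightarrow> g t z \<ge> 0"
    "\<And>t z. t \<in> {0..T} \<Longrightarrow> (g t has_derivative (\<lambda>y. g' t z \<bullet> y)) (at z)"
    "\<And>t. t \<in> {0..T} \<Longrightarrow> continuous_on UNIV (g' t)"
    "\<And>t z. t \<in> {0..T} \<Longrightarrow> ((\<lambda>s. g s z) has_real_derivative gt t z) (at t within {0..T})"
    "\<And>t z. t \<in> {0..T} \<Longrightarrow> z \<in> cball 0 M \<Longrightarrow> gt t z + field t z \<bullet> g' t z \<le> 0"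
    "continuous_on ({0..T} \<times> UNIV) (\<lambda>(t, z). gt t z)" "continuous_on ({0..T} \<times> UNIV) (\<lambda>(t, z). g t z)"
    unfolding supersolution_def by blast
  from assms(2) obtain h' ht where h:
    "\<And>t k. t \<in> {0..T} \<Longrightarrow> Ck_on k UNIV (h t)" "\<And>t z. t \<in> {0..T} \<Longrightarrow> h t z \<ge> 0"
    "\<And>t z. t \<in> {0..T} \<Longrightarrow> (h t has_derivative (\<lambda>y. h' t z \<bullet> y)) (at z)"
    "\<And>t. t \<in> {0..T} \<Longrightarrow> continuous_on UNIV (h' t)"
    "\<And>t z. t \<in> {0..T} \<Longrightarrow> ((\<lambda>s. h s z) has_real_derivative ht t z) (at t within {0..T})"
    "\<And>t z. t \<in> {0..T} \<Longrightarrow> z \<in> cball 0 M \<Longrightarrow> ht t z + field t z \<bullet> h' t z \<le> 0"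
    "continuous_on ({0..T} \<times> UNIV) (\<lambda>(t, z). ht t z)" "continuous_on ({0..T} \<times> UNIV) (\<lambda>(t, z). h t z)"
    unfolding supersolution_def by blast
  show ?thesis
    unfolding supersolution_def
  proof (intro exI[of _ "\<lambda>t z. g t z *\<^sub>R h' t z + h t z *\<^sub>R g' t z"]
      exI[of _ "\<lambda>t z. g t z * ht t z + h t z * gt t z"] conjI ballI allI)
    fix t assume t: "t \<in> {0..T}"
    show "Ck_on k UNIV (\<lambda>z. g t z * h t z)" for k by (intro Ck_on_mult g h t)
    show "0 \<le> g t z * h t z" for z using g(2) h(2) t by simp
    show "((\<lambda>z. g t z * h t z) has_derivative (\<lambda>y. (g t z *\<^sub>R h' t z + h t z *\<^sub>R g' t z) \<bullet> y)) (at z)" for z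
      using has_derivative_mult[OF g(3)[OF t] h(3)[OF t], of z]
      by (simp add: inner_add_left mult.commute)
    show "continuous_on UNIV (\<lambda>z. g t z *\<^sub>R h' t z + h t z *\<^sub>R g' t z)"
      using g(1)[OF t, of 0] h(1)[OF t, of 0] g(4)[OF t] h(4)[OF t] by (auto intro!: continuous_intros)
    show "((\<lambda>s. g s z * h s z) has_real_derivative g t z * ht t z + h t z * gt t z) (at t within {0..T})" for z
      using DERIV_mult[OF g(5)[OF t] h(5)[OF t], of z] by (simp add: mult.commute add.commute)
    show "g t z * ht t z + h t z * gt t z + field t z \<bullet> (g t z *\<^sub>R h' t z + h t z *\<^sub>R g' t z) \<le> 0"
      if z: "z \<in> cball 0 M" for z
    proof -
      have "g t z * (ht t z + field t z \<bullet> h' t z) \<le> 0" "h t z * (gt t z + field t z \<bullet> g' t z) \<le> 0"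
        by (rule mult_nonneg_nonpos[OF g(2)[OF t] h(6)[OF t z]] mult_nonneg_nonpos[OF h(2)[OF t] g(6)[OF t z]])+
      then show ?thesis by (simp add: inner_add_right algebra_simps)
    qed
  qed (use g(7,8) h(7,8) in \<open>auto simp: case_prod_beta intro!: continuous_intros\<close>)
qed

lemma supersolution_const:
  assumes "c \<ge> 0"
  shows "supersolution T M (\<lambda>t z. c)"
proof -
  have "(\<bullet>) (0 :: 'a \<times> 'a) = (\<lambda>_. 0)" by (rule ext) simp
  then have "((\<lambda>_. c) has_derivative (\<bullet>) 0) (at z)" for z :: "'a \<times> 'a" by simp
  then show ?thesis
    unfolding supersolution_def using assms
    by (intro exI[of _ "\<lambda>_ _. 0"]) (auto simp: Ck_on_const)
qed

lemma supersolution_prod: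
  "finite I \<Longrightarrow> (\<And>i. i \<in> I \<Longrightarrow> supersolution T M (h i)) \<Longrightarrow> supersolution T M (\<lambda>t z. \<Prod>i\<in>I. h i t z)"
  by (induction I rule: finite_induct) (auto intro: supersolution_const supersolution_mult)

text \<open>On the ball of radius \<open>M\<close> the function is constantly 1 and its gradient
  vanishes. As a factor it supplies the bounded support that test functions require and changes
  nothing where the measures live.\<close>

lemma supersolution_cutoff:
  assumes "M \<ge> 0"
  shows "supersolution T M (\<lambda>t z. plateau ((norm z)\<^sup>2 - M\<^sup>2))"
  unfolding supersolution_def
proof (intro exI[of _ "\<lambda>t z. plateau' ((norm z)\<^sup>2 - M\<^sup>2) *\<^sub>R (2 *\<^sub>R z)"] exI[of _ "\<lambda>t z. 0"] conjI ballI allI)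
  fix t assume t: "t \<in> {0..T}"
  show "Ck_on k UNIV (\<lambda>z::'a \<times> 'a. plateau ((norm z)\<^sup>2 - M\<^sup>2))" for k
    using Ck_on_plateau[OF Ck_on_add[OF Ck_on_norm_sq[of k UNIV 0] Ck_on_const[of k UNIV "- M\<^sup>2"]]] by simp
  show "((\<lambda>z. plateau ((norm z)\<^sup>2 - M\<^sup>2)) has_derivative
      (\<lambda>y. (plateau' ((norm z)\<^sup>2 - M\<^sup>2) *\<^sub>R (2 *\<^sub>R z)) \<bullet> y)) (at z)" for z :: "'a \<times> 'a"
  proof -
    have 1: "((\<lambda>z. (norm z)\<^sup>2 - M\<^sup>2) has_derivative (\<lambda>y. 2 * (z \<bullet> y))) (at z)"
      unfolding power2_norm_eq_inner by (auto intro!: derivative_eq_intros simp: inner_commute)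
    have 2: "(plateau has_derivative (*) (plateau' ((norm z)\<^sup>2 - M\<^sup>2))) (at ((norm z)\<^sup>2 - M\<^sup>2))"
      using plateau_DERIV by (simp add: has_field_derivative_def)
    from has_derivative_compose[OF 1 2] show ?thesis by (simp add: mult.assoc)
  qed
  show "continuous_on UNIV (\<lambda>z::'a \<times> 'a. plateau' ((norm z)\<^sup>2 - M\<^sup>2) *\<^sub>R (2 *\<^sub>R z))"
    by (intro continuous_intros continuous_on_compose2[OF continuous_on_plateau'[of UNIV]]) auto
  show "0 + field t z \<bullet> (plateau' ((norm z)\<^sup>2 - M\<^sup>2) *\<^sub>R (2 *\<^sub>R z)) \<le> 0" if "z \<in> cball 0 M" for z
  proof -
    have "plateau' ((norm z)\<^sup>2 - M\<^sup>2) = 0"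
      using that assms by (intro plateau'_eq_0') (simp add: power_mono)
    then show ?thesis by simp
  qed
next
  show "continuous_on ({0..T} \<times> UNIV) (\<lambda>(t, z::'a \<times> 'a). plateau ((norm z)\<^sup>2 - M\<^sup>2))"
    by (auto simp: case_prod_beta intro!: continuous_intros continuous_on_compose2[OF continuous_on_plateau[of UNIV]])
qed (auto simp: plateau_nonneg case_prod_beta)

text \<open>The inequality along characteristics is available only on the ball, which is enough
  because the ball carries every \<open>f t\<close>; the integral then has nonpositive derivative in
  time.\<close>

lemma supersolution_integral_le:
  assumes h: "supersolution T M h" and T: "T \<ge> 0"
    and supp: "\<And>t. t \<in> {0..T} \<Longrightarrow> bounded {z. h t z \<noteq> 0}"
    and M: "\<And>t. t \<in> {0..T} \<Longrightarrow> msupport (f t) \<subseteq> cball 0 M"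
  shows "(\<integral>z. h T z \<partial>(f T)) \<le> (\<integral>z. h 0 z \<partial>f0)"
proof -
  from h obtain h' ht where h:
    "\<And>t k. t \<in> {0..T} \<Longrightarrow> Ck_on k UNIV (h t)" "\<And>t z. t \<in> {0..T} \<Longrightarrow> h t z \<ge> 0"
    "\<And>t z. t \<in> {0..T} \<Longrightarrow> (h t has_derivative (\<lambda>y. h' t z \<bullet> y)) (at z)"
    "\<And>t. t \<in> {0..T} \<Longrightarrow> continuous_on UNIV (h' t)"
    "\<And>t z. t \<in> {0..T} \<Longrightarrow> ((\<lambda>s. h s z) has_real_derivative ht t z) (at t within {0..T})"
    "\<And>t z. t \<in> {0..T} \<Longrightarrow> z \<in> cball 0 M \<Longrightarrow> ht t z + field t z \<bullet> h' t z \<le> 0"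
    "continuous_on ({0..T} \<times> UNIV) (\<lambda>(t, z). ht t z)" "continuous_on ({0..T} \<times> UNIV) (\<lambda>(t, z). h t z)"
    unfolding supersolution_def by blast
  have "\<exists>t\<in>{0..T}. (\<integral>z. h T z \<partial>(f T)) - (\<integral>z. h 0 z \<partial>(f 0))
      = (\<integral>z. ht t z + field t z \<bullet> h' t z \<partial>(f t)) * (T - 0)"
    by (rule mvt_within[OF T transport_derivative[OF h(1) h(3) h(4) supp h(5) h(7)]])
  then obtain t where t: "t \<in> {0..T}" "(\<integral>z. h T z \<partial>(f T)) - (\<integral>z. h 0 z \<partial>(f 0))
      = (\<integral>z. ht t z + field t z \<bullet> h' t z \<partial>(f t)) * T" by auto
  then have t0: "t \<ge> 0" by simp
  interpret t: compact_prob "f t" "msupport (f t)" by (rule f_compact_prob[OF t0])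
  have chts: "continuous_on UNIV (ht t)"
    using continuous_on_section[OF h(7) t(1)] .
  have "(\<integral>z. ht t z + field t z \<bullet> h' t z \<partial>(f t)) \<le> (\<integral>z. 0 \<partial>(f t))"
  proof (rule t.integral_mono_K)
    show "integrable (f t) (\<lambda>z. ht t z + field t z \<bullet> h' t z)"
      by (intro t.integrable_continuous continuous_intros chts continuous_field_at t0 h(4) t(1))
    fix z assume "z \<in> msupport (f t)"
    then show "ht t z + field t z \<bullet> h' t z \<le> 0" using M[OF t(1)] h(6)[OF t(1)] by blast
  qed simp
  then have "(\<integral>z. ht t z + field t z \<bullet> h' t z \<partial>(f t)) * T \<le> 0"
    using T by (simp add: mult_nonpos_nonneg)
  then have "(\<integral>z. h T z \<partial>(f T)) \<le> (\<integral>z. h 0 z \<partial>(f 0))"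
    using t(2) by linarith
  also have "(\<integral>z. h 0 z \<partial>(f 0)) = (\<integral>z. h 0 z \<partial>f0)"
    using T by (intro weak_initial[OF h(1) h(3) h(4) supp]) auto
  finally show ?thesis .
qed

text \<open>Gronwall's inequality in differential form: along a characteristic the squared distance
  to \<open>x\<close> grows at rate at most 2 L, so the exponential weight makes it nonincreasing,
  and a nondecreasing function of it remains so. The path \<open>x\<close> may leave the ball, for
  its velocity is taken at the projection; projection is nonexpansive and fixes \<open>z\<close>, so
  the Lipschitz bound still holds.\<close>

lemma supersolution_distance:
  fixes x :: "real \<Rightarrow> 'a \<times> 'a"
  assumes M: "M > 0" and L: "L \<ge> 0" and m: "m > 0"
    and lip: "\<And>t z z'. t \<in> {0..T} \<Longrightarrow> z \<in> cball 0 M \<Longrightarrow> z' \<in> cball 0 M \<Longrightarrow>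
      norm (field t z - field t z') \<le> L * norm (z - z')"
    and x: "\<And>t. t \<in> {0..T} \<Longrightarrow>
      (x has_vector_derivative field t (closest_point (cball 0 M) (x t))) (at t within {0..T})"
  shows "supersolution T M (\<lambda>t z. flat_exp 0 (m * (exp (- 2 * L * t) * (norm (z - x t))\<^sup>2 - c)))"
proof -
  define x' where "x' t = field t (closest_point (cball 0 M) (x t))" for t
  define u where "u t z = m * (exp (- 2 * L * t) * (norm (z - x t))\<^sup>2 - c)" for t z
  define h' where "h' t z = (flat_exp (Suc 0) (u t z) * (m * exp (- 2 * L * t))) *\<^sub>R (2 *\<^sub>R (z - x t))" for t z
  define ht where "ht t z = flat_exp (Suc 0) (u t z) * (m * exp (- 2 * L * t)) *
    (- 2 * L * (norm (z - x t))\<^sup>2 - 2 * ((z - x t) \<bullet> x' t))" for t z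
  have cx: "continuous_on {0..T} x"
    by (rule continuous_on_vector_derivative[OF x])
  have Mne: "convex (cball (0::'a \<times> 'a) M)" "closed (cball (0::'a \<times> 'a) M)" "cball (0::'a \<times> 'a) M \<noteq> {}" using M by auto
  have cx': "continuous_on {0..T} x'"
  proof -
    have "continuous_on {0..T} (\<lambda>t. (\<lambda>(t, z). field t z) (t, closest_point (cball 0 M) (x t)))"
      by (rule continuous_on_compose2[OF continuous_field])
        (auto intro!: continuous_intros cx continuous_on_compose2[OF continuous_on_closest_point[OF Mne, of UNIV]])
    then show ?thesis by (simp add: x'_def)
  qed
  have cfst: "continuous_on ({0..T} \<times> S) (\<lambda>p. x (fst p))" "continuous_on ({0..T} \<times> S) (\<lambda>p. x' (fst p))"
    for S :: "('a \<times> 'a) set"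
    by (auto intro!: continuous_on_compose2[OF cx] continuous_on_compose2[OF cx'] continuous_intros)
  have cu: "continuous_on ({0..T} \<times> UNIV) (\<lambda>p. u (fst p) (snd p))"
    unfolding u_def by (intro continuous_intros cfst)
  show ?thesis
    unfolding supersolution_def u_def[symmetric]
  proof (intro exI[of _ h'] exI[of _ ht] conjI ballI allI)
    fix t assume t: "t \<in> {0..T}"
    show "Ck_on k UNIV (\<lambda>z. flat_exp 0 (u t z))" for k
    proof -
      have "Ck_on k UNIV (\<lambda>z. flat_exp 0 (m * (exp (- 2 * L * t) * (norm (z - x t))\<^sup>2 + - c)))"
        by (intro Ck_on_flat Ck_on_mult Ck_on_add Ck_on_const Ck_on_norm_sq)
      then show ?thesis by (simp add: u_def)
    qed
    show "0 \<le> flat_exp 0 (u t z)" for z by (rule flat0_nonneg)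
    show "((\<lambda>z. flat_exp 0 (u t z)) has_derivative (\<lambda>y. h' t z \<bullet> y)) (at z)" for z
    proof -
      have 1: "(u t has_derivative (\<lambda>y. m * (exp (- 2 * L * t) * (2 * ((z - x t) \<bullet> y))))) (at z)"
      proof -
        have "((\<lambda>z. (norm (z - x t))\<^sup>2) has_derivative (\<lambda>y. 2 * ((z - x t) \<bullet> y))) (at z)"
          unfolding power2_norm_eq_inner by (auto intro!: derivative_eq_intros simp: inner_commute)
        from has_derivative_mult_right[OF has_derivative_diff[OF has_derivative_mult_right[OF this] has_derivative_const]]
        show ?thesis unfolding u_def by simp
      qed
      have 2: "(flat_exp 0 has_derivative (*) (flat_exp (Suc 0) (u t z))) (at (u t z))"
        using flat_DERIV by (simp add: has_field_derivative_def)
      from has_derivative_compose[OF 1 2] show ?thesis by (simp add: h'_def algebra_simps)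
    qed
    show "continuous_on UNIV (h' t)"
      unfolding h'_def u_def
      by (intro continuous_intros continuous_on_compose2[OF continuous_on_flat[of UNIV]]) auto
    show "((\<lambda>s. flat_exp 0 (u s z)) has_real_derivative ht t z) (at t within {0..T})" for z
    proof -
      have 0: "((\<lambda>s. z - x s) has_vector_derivative - x' t) (at t within {0..T})"
        using has_vector_derivative_diff[OF has_vector_derivative_const x[OF t], of z] by (simp add: x'_def)
      have "((\<lambda>s. (norm (z - x s))\<^sup>2) has_real_derivative - 2 * ((z - x t) \<bullet> x' t)) (at t within {0..T})"
        using has_derivative_inner[OF 0[unfolded has_vector_derivative_def] 0[unfolded has_vector_derivative_def]]
        unfolding has_field_derivative_def power2_norm_eq_inner
        by (rule has_derivative_eq_rhs) (auto simp: inner_commute[of "x' t"])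
      then have 1: "((\<lambda>s. u s z) has_real_derivative m * (exp (- 2 * L * t) *
          (- 2 * L * (norm (z - x t))\<^sup>2 - 2 * ((z - x t) \<bullet> x' t)))) (at t within {0..T})"
      proof -
        assume N: "((\<lambda>s. (norm (z - x s))\<^sup>2) has_real_derivative - 2 * ((z - x t) \<bullet> x' t)) (at t within {0..T})"
        have "((\<lambda>s. exp (- 2 * L * s)) has_real_derivative exp (- 2 * L * t) * (- 2 * L)) (at t within {0..T})"
          by (auto intro!: derivative_eq_intros)
        from DERIV_cmult[OF DERIV_diff[OF DERIV_mult[OF this N] DERIV_const]]
        show ?thesis unfolding u_def by (rule DERIV_cong) (simp add: algebra_simps)
      qed
      show ?thesis using DERIV_chain2[OF flat_DERIV 1] by (simp add: ht_def mult.assoc)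
    qed
    show "ht t z + field t z \<bullet> h' t z \<le> 0" if z: "z \<in> cball 0 M" for z
    proof -
      let ?P = "closest_point (cball 0 M)"
      have Px: "?P (x t) \<in> cball 0 M" using Mne by (intro closest_point_in_set) auto
      have "norm (field t z - x' t) \<le> L * norm (z - ?P (x t))"
        unfolding x'_def by (rule lip[OF t z Px])
      also have "norm (z - ?P (x t)) \<le> norm (z - x t)"
        using closest_point_lipschitz[OF Mne, of z "x t"] closest_point_self[OF z] by (simp add: dist_norm)
      finally have "norm (field t z - x' t) \<le> L * norm (z - x t)" using L by (simp add: mult_left_mono)
      then have "norm (z - x t) * norm (field t z - x' t) \<le> norm (z - x t) * (L * norm (z - x t))"
        by (intro mult_left_mono) auto
      then have "(z - x t) \<bullet> (field t z - x' t) \<le> norm (z - x t) * (L * norm (z - x t))"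
        by (rule order_trans[OF norm_cauchy_schwarz])
      then have *: "(z - x t) \<bullet> (field t z - x' t) - L * (norm (z - x t))\<^sup>2 \<le> 0"
        by (simp add: power2_eq_square mult.left_commute)
      have "ht t z + field t z \<bullet> h' t z = flat_exp (Suc 0) (u t z) * (m * exp (- 2 * L * t)) * 2 *
          ((z - x t) \<bullet> (field t z - x' t) - L * (norm (z - x t))\<^sup>2)"
      proof -
        define d where "d = z - x t"
        show ?thesis
          unfolding ht_def h'_def d_def[symmetric] inner_diff_right
          by (simp add: inner_commute[of "field t z"] right_diff_distrib)
      qed
      also have "\<dots> \<le> 0"
        using * flat1_nonneg m by (intro mult_nonneg_nonpos mult_nonneg_nonneg) auto
      finally show ?thesis .
    qed
  next
    show "continuous_on ({0..T} \<times> UNIV) (\<lambda>(t, z). ht t z)"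
      unfolding case_prod_beta ht_def
      by (intro continuous_intros cfst continuous_on_compose2[OF continuous_on_flat[of UNIV] cu]) auto
    show "continuous_on ({0..T} \<times> UNIV) (\<lambda>(t, z). flat_exp 0 (u t z))"
      unfolding case_prod_beta
      by (intro continuous_on_compose2[OF continuous_on_flat[of UNIV] cu]) auto
  qed
qed

end

section \<open>Flows of Lipschitz fields\<close>

text \<open>The compactness theorem used here is about time-dependent maps, so \<open>g\<close> is
  viewed as a map over the single time 0.\<close>

lemma locally_lipschitz_compact:
  fixes g :: "'b::metric_space \<Rightarrow> 'c::metric_space"
  assumes g: "locally_lipschitz_on S g" and K: "K \<subseteq> S" "compact K"
  obtains L where "L-lipschitz_on K g"
proof -
  have "local_lipschitz {0::real} K (\<lambda>_. g)"
    unfolding local_lipschitz_def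
  proof (intro ballI)
    fix x t assume x: "x \<in> K" and t: "t \<in> {0::real}"
    then obtain u L where u: "u > 0" "L-lipschitz_on (cball x u \<inter> S) g"
      using g K(1) unfolding locally_lipschitz_on_def by blast
    then have "L-lipschitz_on (cball x u \<inter> K) g"
      by (rule_tac lipschitz_on_subset) (use K(1) in auto)
    with u(1) show "\<exists>u>0. \<exists>L. \<forall>t\<in>cball t u \<inter> {0}. L-lipschitz_on (cball x u \<inter> K) g" by blast
  qed
  from local_lipschitz_compact_implies_lipschitz[OF this K(2) compact_sing] that
  show ?thesis by auto
qed

text \<open>Picard iteration for the trajectory multiplied by \<open>exp (- \<lambda> t)\<close>, for which the integral
  operator is a contraction on the whole time interval once \<open>\<lambda> \<ge> 2 * L\<close>.\<close>

lemma picard_flow: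
  fixes F :: "real \<Rightarrow> 'b::euclidean_space \<Rightarrow> 'b"
  assumes cont: "continuous_on UNIV (\<lambda>(t, x). F t x)"
    and bdd: "\<And>t x. norm (F t x) \<le> B"
    and lip: "\<And>t x y. norm (F t x - F t y) \<le> L * norm (x - y)"
    and L: "L \<ge> 0" and T: "T \<ge> 0"
  obtains \<Phi> C where "\<And>z. \<Phi> 0 z = z"
    "\<And>t z. t \<in> {0..T} \<Longrightarrow> ((\<lambda>s. \<Phi> s z) has_vector_derivative F t (\<Phi> t z)) (at t within {0..T})"
    "\<And>t z w. t \<in> {0..T} \<Longrightarrow> norm (\<Phi> t z - \<Phi> t w) \<le> C * norm (z - w)"
proof -
  \<comment> \<open>The summand 1 keeps \<open>l\<close> positive when \<open>L = 0\<close>.\<close>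
  define l where "l = 2 * L + 1"
  have l: "l > 0" "L / l \<le> 1 / 2" using L by (auto simp: l_def field_simps)
  \<comment> \<open>The fixed point is sought among bounded continuous functions on the whole real
    line, so times outside the interval are moved to its nearest endpoint.\<close>
  define c where "c t = max 0 (min t T)" for t
  have c: "c t \<in> {0..T}" for t using T by (auto simp: c_def)
  have ct: "c t = t" if "t \<in> {0..T}" for t using that by (auto simp: c_def)
  have cc: "continuous_on S c" for S unfolding c_def by (intro continuous_intros)
  define J where "J y t = integral {0..t} (\<lambda>s. F s (exp (l * s) *\<^sub>R y s))" for y :: "real \<Rightarrow> 'b" and t
  define op where "op z y t = exp (- l * c t) *\<^sub>R (z + J y (c t))" for z and y :: "real \<Rightarrow> 'b" and t
  have cF: "continuous_on S (\<lambda>s. F s (exp (l * s) *\<^sub>R y s))" if "continuous_on S y" for S y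
  proof -
    have "continuous_on S (\<lambda>s. (\<lambda>(t, x). F t x) (s, exp (l * s) *\<^sub>R y s))"
      by (rule continuous_on_compose2[OF cont]) (auto intro!: continuous_intros that)
    then show ?thesis by simp
  qed
  have int: "(\<lambda>s. F s (exp (l * s) *\<^sub>R y s)) integrable_on {0..t}" if "continuous_on UNIV y" for y t
    by (intro integrable_continuous_interval cF continuous_on_subset[OF that]) auto
  have J: "continuous_on {0..T} (J y)" if "continuous_on UNIV y" for y
    unfolding J_def by (rule indefinite_integral_continuous_1[OF int[OF that]])
  have Jb: "norm (J y t) \<le> B * t" if "continuous_on UNIV y" "t \<in> {0..T}" for y t
    using integral_bound[of 0 t "\<lambda>s. F s (exp (l * s) *\<^sub>R y s)" B] that bdd
    unfolding J_def by (simp add: cF[OF continuous_on_subset[OF that(1)]])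
  have B: "B \<ge> 0" using bdd norm_ge_zero order_trans by blast
  have op: "op z y \<in> bcontfun" if y: "continuous_on UNIV y" for z y
    unfolding bcontfun_def
  proof safe
    show "continuous_on UNIV (op z y)"
      unfolding op_def using c by (intro continuous_intros cc continuous_on_compose2[OF J[OF y] cc]) auto
    have "norm (op z y t) \<le> norm z + B * T" for t
    proof -
      have "norm (op z y t) \<le> 1 * norm (z + J y (c t))"
        unfolding op_def norm_scaleR using l c[of t] by (intro mult_right_mono) auto
      also have "\<dots> \<le> norm z + norm (J y (c t))" using norm_triangle_ineq by simp
      also have "norm (J y (c t)) \<le> B * c t" by (rule Jb[OF y c])
      also have "\<dots> \<le> B * T" using c[of t] B by (intro mult_left_mono) auto
      finally show ?thesis by simp
    qed
    then show "bounded (range (op z y))" by (auto simp: bounded_iff)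
  qed
  define Q where "Q z (y :: real \<Rightarrow>\<^sub>C 'b) = Bcontfun (op z (apply_bcontfun y))" for z y
  have Q: "apply_bcontfun (Q z y) = op z (apply_bcontfun y)" for z y
    unfolding Q_def by (rule Bcontfun_inverse[OF op]) simp
  have contr: "dist (Q z y) (Q z x) \<le> 1 / 2 * dist y x" for z x y
  proof (rule dist_bound)
    fix t
    let ?t = "c t"
    have E: "((\<lambda>s. L * dist y x * exp (l * s)) has_integral (L * dist y x * (exp (l * ?t) / l) - L * dist y x * (exp (l * 0) / l))) {0..?t}"
      using l(1) c[of t] by (intro fundamental_theorem_of_calculus)
        (auto simp flip: has_real_derivative_iff_has_vector_derivative intro!: derivative_eq_intros)
    have d: "J y ?t - J x ?t = integral {0..?t} (\<lambda>s. F s (exp (l * s) *\<^sub>R y s) - F s (exp (l * s) *\<^sub>R x s))"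
      unfolding J_def by (intro integral_diff[symmetric] int) auto
    have "norm (J y ?t - J x ?t) \<le> integral {0..?t} (\<lambda>s. L * dist y x * exp (l * s))"
      unfolding d
    proof (rule integral_norm_bound_integral)
      fix s
      have "norm (F s (exp (l * s) *\<^sub>R y s) - F s (exp (l * s) *\<^sub>R x s)) \<le> L * norm (exp (l * s) *\<^sub>R y s - exp (l * s) *\<^sub>R x s)"
        by (rule lip)
      also have "norm (exp (l * s) *\<^sub>R y s - exp (l * s) *\<^sub>R x s) = exp (l * s) * dist (y s) (x s)"
        by (simp add: scaleR_diff_right[symmetric] dist_norm)
      also have "L * \<dots> \<le> L * (exp (l * s) * dist y x)"
        using L dist_bounded[of y s x] by (intro mult_left_mono) auto
      finally show "norm (F s (exp (l * s) *\<^sub>R y s) - F s (exp (l * s) *\<^sub>R x s)) \<le> L * dist y x * exp (l * s)"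
        by (simp add: algebra_simps)
    qed (use E in \<open>auto intro!: integrable_diff int\<close>)
    also have "\<dots> = L * dist y x * (exp (l * ?t) - 1) / l"
      by (subst integral_unique[OF E]) (simp add: diff_divide_distrib right_diff_distrib)
    also have "\<dots> \<le> L * dist y x * exp (l * ?t) / l"
      using L l(1) by (intro divide_right_mono mult_left_mono) auto
    finally have *: "norm (J y ?t - J x ?t) \<le> L / l * dist y x * exp (l * ?t)" by simp
    have "dist (Q z y t) (Q z x t) = exp (- l * ?t) * norm (J y ?t - J x ?t)"
      unfolding Q op_def by (simp add: dist_norm scaleR_diff_right[symmetric])
    also have "\<dots> \<le> exp (- l * ?t) * (L / l * dist y x * exp (l * ?t))"
      using * by (intro mult_left_mono) auto
    also have "\<dots> = L / l * dist y x"
      by (simp add: exp_minus field_simps)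
    also have "\<dots> \<le> 1 / 2 * dist y x" using l(2) by (intro mult_right_mono) auto
    finally show "dist (Q z y t) (Q z x t) \<le> 1 / 2 * dist y x" .
  qed
  have "\<exists>!y. Q z y = y" for z
    by (rule banach_fix_type[of "1 / 2"]) (use contr in auto)
  then obtain Y where Y: "\<And>z. Q z (Y z) = Y z" by metis
  \<comment> \<open>Fixed points depend on the initial value in a Lipschitz way: changing
    \<open>z\<close> to \<open>w\<close> moves the operator by at most the distance of
    \<open>z\<close> and \<open>w\<close>, and a contraction factor 1/2 doubles this.\<close>
  have YL: "dist (Y z) (Y w) \<le> 2 * norm (z - w)" for z w
  proof -
    have "dist (Q z (Y z)) (Q w (Y z)) \<le> norm (z - w)"
    proof (rule dist_bound)
      fix t
      have "dist (Q z (Y z) t) (Q w (Y z) t) = exp (- l * c t) * norm (z - w)"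
        unfolding Q op_def by (simp add: dist_norm scaleR_diff_right[symmetric])
      also have "\<dots> \<le> 1 * norm (z - w)" using l c[of t] by (intro mult_right_mono) auto
      finally show "dist (Q z (Y z) t) (Q w (Y z) t) \<le> norm (z - w)" by simp
    qed
    then show ?thesis
      using contr[of w "Y z" "Y w"] dist_triangle[of "Y z" "Y w" "Q w (Y z)"] Y[of z] Y[of w] by simp
  qed
  define \<Phi> where "\<Phi> t z = exp (l * t) *\<^sub>R Y z t" for t z
  have eq: "\<Phi> t z = z + integral {0..t} (\<lambda>s. F s (\<Phi> s z))" if "t \<in> {0..T}" for t z
  proof -
    have "apply_bcontfun (Y z) t = op z (apply_bcontfun (Y z)) t" using Q[of z "Y z"] Y[of z] by simp
    then show ?thesis
      unfolding \<Phi>_def op_def J_def ct[OF that]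
      by (metis (no_types, lifting) exp_minus_inverse mult_minus_left scaleR_one scaleR_scaleR)
  qed
  show ?thesis
  proof (rule that[of \<Phi> "exp (l * T) * 2"])
    show "\<Phi> 0 z = z" for z using eq[of 0 z] T by simp
    show "((\<lambda>s. \<Phi> s z) has_vector_derivative F t (\<Phi> t z)) (at t within {0..T})" if t: "t \<in> {0..T}" for t z
    proof -
      have "continuous_on {0..T} (\<lambda>s. F s (\<Phi> s z))" unfolding \<Phi>_def by (rule cF) simp
      from integral_has_vector_derivative[OF this t]
      have "((\<lambda>u. z + integral {0..u} (\<lambda>s. F s (\<Phi> s z))) has_vector_derivative F t (\<Phi> t z)) (at t within {0..T})"
        by (auto intro!: derivative_eq_intros)
      then show ?thesis
        by (rule has_vector_derivative_transform[OF t, rotated]) (use eq in auto)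
    qed
    show "norm (\<Phi> t z - \<Phi> t w) \<le> exp (l * T) * 2 * norm (z - w)" if t: "t \<in> {0..T}" for t z w
    proof -
      have "norm (\<Phi> t z - \<Phi> t w) = exp (l * t) * dist (Y z t) (Y w t)"
        unfolding \<Phi>_def by (simp add: dist_norm scaleR_diff_right[symmetric])
      also have "\<dots> \<le> exp (l * T) * (2 * norm (z - w))"
        using YL[of z w] dist_bounded[of "Y z" t "Y w"] t l by (intro mult_mono) auto
      finally show ?thesis by simp
    qed
  qed
qed

locale mean_field_lipschitz = mean_field +
  assumes gradV_lip: "locally_lipschitz_on UNIV (grad V)"
    and \<psi>_lip: "locally_lipschitz_on {0..} \<psi>"
begin

lemma pair_force_lipschitz:
  assumes M: "M > 0"
  obtains L where "L \<ge> 0"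
    "\<And>z1 z2 z. z1 \<in> cball 0 M \<Longrightarrow> z2 \<in> cball 0 M \<Longrightarrow> z \<in> cball 0 M \<Longrightarrow>
      norm (pair_force z1 z - pair_force z2 z) \<le> L * norm (z1 - z2)"
proof -
  obtain L1 where L1: "L1-lipschitz_on {0..2 * M} \<psi>"
    using locally_lipschitz_compact[OF \<psi>_lip, of "{0..2 * M}"] by auto
  obtain L2 where L2: "L2-lipschitz_on (cball 0 (2 * M)) (grad V)"
    using locally_lipschitz_compact[OF gradV_lip, of "cball 0 (2 * M)"] by auto
  note L12 = lipschitz_on_nonneg[OF L1] lipschitz_on_nonneg[OF L2]
  have "compact (\<psi> ` {0..2 * M})"
    by (intro compact_continuous_image continuous_on_subset[OF \<psi>_cont]) auto
  then have "bounded (\<psi> ` {0..2 * M})" by (rule compact_imp_bounded)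
  then obtain B where "\<forall>y\<in>\<psi> ` {0..2 * M}. norm y \<le> B" unfolding bounded_iff by blast
  then have B: "\<bar>\<psi> x\<bar> \<le> B" if "x \<in> {0..2 * M}" for x using that by simp
  have B0: "B \<ge> 0" using B[of 0] M by auto
  have "norm (pair_force z1 z - pair_force z2 z) \<le> (B + L1 * (2 * M) + L2) * norm (z1 - z2)"
    if z: "z1 \<in> cball 0 M" "z2 \<in> cball 0 M" "z \<in> cball 0 M" for z1 z2 z
  proof -
    have n: "norm (fst z) \<le> M" "norm (fst z1) \<le> M" "norm (fst z2) \<le> M" "norm (snd z) \<le> M" "norm (snd z1) \<le> M" "norm (snd z2) \<le> M"
      using z norm_fst_le[of "fst z" "snd z"] norm_fst_le[of "fst z1" "snd z1"] norm_fst_le[of "fst z2" "snd z2"]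
        norm_snd_le[of "snd z" "fst z"] norm_snd_le[of "snd z1" "fst z1"] norm_snd_le[of "snd z2" "fst z2"] by auto
    have r: "norm (fst z1 - fst z) \<le> 2 * M" "norm (fst z2 - fst z) \<le> 2 * M" "norm (snd z2 - snd z) \<le> 2 * M"
      using n norm_triangle_ineq4[of "fst z1" "fst z"] norm_triangle_ineq4[of "fst z2" "fst z"]
        norm_triangle_ineq4[of "snd z2" "snd z"] by auto
    have d: "norm (fst z1 - fst z2) \<le> norm (z1 - z2)" "norm (snd z1 - snd z2) \<le> norm (z1 - z2)"
      using norm_fst_le[of "fst (z1 - z2)" "snd (z1 - z2)"] norm_snd_le[of "snd (z1 - z2)" "fst (z1 - z2)"] by (simp_all add: minus_prod_def)
    define p1 p2 where "p1 = \<psi> (norm (fst z1 - fst z))" and "p2 = \<psi> (norm (fst z2 - fst z))"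
    \<comment> \<open>The change of velocity, of the friction coefficient and of the potential force
      are separated; they account for the summands \<open>B\<close>, \<open>L1 * (2 * M)\<close> and
      \<open>L2\<close> of the constant.\<close>
    have "pair_force z1 z - pair_force z2 z = p1 *\<^sub>R (snd z1 - snd z2) + (p1 - p2) *\<^sub>R (snd z2 - snd z)
      - (grad V (fst z - fst z1) - grad V (fst z - fst z2))"
      by (simp add: pair_force_def p1_def p2_def algebra_simps)
    also have "norm \<dots> \<le> norm (p1 *\<^sub>R (snd z1 - snd z2)) + norm ((p1 - p2) *\<^sub>R (snd z2 - snd z))
      + norm (grad V (fst z - fst z1) - grad V (fst z - fst z2))"
      by (meson norm_triangle_ineq4 norm_triangle_ineq order_trans add_right_mono)
    also have "norm (p1 *\<^sub>R (snd z1 - snd z2)) \<le> B * norm (z1 - z2)"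
      using B[of "norm (fst z1 - fst z)"] r d B0 by (auto simp: p1_def intro!: mult_mono)
    also have "norm ((p1 - p2) *\<^sub>R (snd z2 - snd z)) \<le> (L1 * norm (z1 - z2)) * (2 * M)"
    proof -
      have "\<bar>p1 - p2\<bar> \<le> L1 * dist (norm (fst z1 - fst z)) (norm (fst z2 - fst z))"
        using lipschitz_onD[OF L1, of "norm (fst z1 - fst z)" "norm (fst z2 - fst z)"] r
        by (simp add: p1_def p2_def dist_real_def)
      also have "\<dots> \<le> L1 * norm (z1 - z2)"
      proof (rule mult_left_mono[OF _ L12(1)])
        have "\<bar>norm (fst z1 - fst z) - norm (fst z2 - fst z)\<bar> \<le> norm (fst z1 - fst z2)"
          using norm_triangle_ineq3[of "fst z1 - fst z" "fst z2 - fst z"] by simp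
        then show "dist (norm (fst z1 - fst z)) (norm (fst z2 - fst z)) \<le> norm (z1 - z2)"
          using d by (simp add: dist_real_def)
      qed
      finally show ?thesis using r L12 by (auto intro!: mult_mono)
    qed
    also have "norm (grad V (fst z - fst z1) - grad V (fst z - fst z2)) \<le> L2 * norm (z1 - z2)"
    proof -
      have "dist (grad V (fst z - fst z1)) (grad V (fst z - fst z2)) \<le> L2 * dist (fst z - fst z1) (fst z - fst z2)"
        using r by (intro lipschitz_onD[OF L2]) (auto simp: norm_minus_commute)
      also have "\<dots> \<le> L2 * norm (z1 - z2)"
        using d L12 by (intro mult_left_mono) (auto simp: dist_norm norm_minus_commute)
      finally show ?thesis by (simp add: dist_norm)
    qed
    finally show ?thesis by (simp add: algebra_simps)
  qed
  then show ?thesis using that[of "B + L1 * (2 * M) + L2"] B0 L12 M by simp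
qed

text \<open>The constant does not depend on \<open>t\<close> because all the measures
  \<open>f t\<close> live in one ball; its summand 1 comes from the position component of the field,
  which is the velocity.\<close>

lemma field_lipschitz:
  assumes M: "M > 0" "\<And>t. t \<in> {0..T} \<Longrightarrow> msupport (f t) \<subseteq> cball 0 M"
  obtains L where "L \<ge> 0"
    "\<And>t z z'. t \<in> {0..T} \<Longrightarrow> z \<in> cball 0 M \<Longrightarrow> z' \<in> cball 0 M \<Longrightarrow>
      norm (field t z - field t z') \<le> L * norm (z - z')"
proof -
  obtain L where L: "L \<ge> 0"
    "\<And>z1 z2 z. z1 \<in> cball 0 M \<Longrightarrow> z2 \<in> cball 0 M \<Longrightarrow> z \<in> cball 0 M \<Longrightarrow>
      norm (pair_force z1 z - pair_force z2 z) \<le> L * norm (z1 - z2)"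
    using pair_force_lipschitz[OF M(1)] by blast
  have "norm (field t z - field t z') \<le> (1 + L) * norm (z - z')"
    if t: "t \<in> {0..T}" and z: "z \<in> cball 0 M" "z' \<in> cball 0 M" for t z z'
  proof -
    have t0: "t \<ge> 0" using t by simp
    interpret t: compact_prob "f t" "msupport (f t)" by (rule f_compact_prob[OF t0])
    have i: "integrable (f t) (pair_force y)" for y
      using continuous_on_compose2[OF continuous_pair_force continuous_on_Pair_const[of UNIV y]]
      by (intro t.integrable_continuous) auto
    have "norm (force t z - force t z') = norm (\<integral>y. pair_force z y - pair_force z' y \<partial>(f t))"
      unfolding force_def using i by simp
    also have "\<dots> \<le> L * norm (z - z')"
      using L(2)[OF z] M(2)[OF t] i by (intro t.norm_integral_le) auto
    finally have *: "norm (force t z - force t z') \<le> L * norm (z - z')" .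
    have "norm (field t z - field t z') \<le> norm (snd z - snd z') + norm (force t z - force t z')"
      using norm_Pair_le[of "snd z - snd z'" "force t z' - force t z"]
      by (simp add: field_def norm_minus_commute)
    also have "norm (snd z - snd z') \<le> norm (z - z')"
      using norm_snd_le[of "snd (z - z')" "fst (z - z')"] by (simp add: minus_prod_def)
    finally show ?thesis using * by (simp add: algebra_simps)
  qed
  then show ?thesis using that[of "1 + L"] L(1) by simp
qed

end

section \<open>The solution is transported by the flow\<close>

lemma open_all_norm_greater:
  fixes y :: "'i \<Rightarrow> 'b::real_normed_vector"
  assumes "finite I"
  shows "open {z. \<forall>i\<in>I. norm (z - y i) > r}"
proof -
  have "open {z. norm (z - y i) > r}" for i
    by (intro open_Collect_less continuous_intros)
  then have "open (\<Inter>i\<in>I. {z. norm (z - y i) > r})" by (intro open_INT assms ballI)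
  moreover have "(\<Inter>i\<in>I. {z. norm (z - y i) > r}) = {z. \<forall>i\<in>I. norm (z - y i) > r}" by auto
  ultimately show ?thesis by simp
qed

text \<open>Read backwards in time: two characteristics separate at most by the factor exp (L T), so
  whoever is farther than \<open>\<delta> * exp (L * T)\<close> from all chosen trajectories at time
  \<open>T\<close> started farther than \<open>\<delta>\<close> from their initial points. The
  smooth functions \<open>h n\<close> tend to the indicator of the first event and lie below that of
  the second at time 0.\<close>

lemma (in mean_field) ball_transport:
  fixes \<Phi> :: "real \<Rightarrow> 'a \<times> 'a \<Rightarrow> 'a \<times> 'a"
  assumes M: "M > 0" "\<And>t. t \<in> {0..T} \<Longrightarrow> msupport (f t) \<subseteq> cball 0 M" and T: "T \<ge> 0"
    and L: "L \<ge> 0"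
    and lip: "\<And>t z z'. t \<in> {0..T} \<Longrightarrow> z \<in> cball 0 M \<Longrightarrow> z' \<in> cball 0 M \<Longrightarrow>
      norm (field t z - field t z') \<le> L * norm (z - z')"
    and \<Phi>0: "\<And>z. \<Phi> 0 z = z"
    and \<Phi>: "\<And>t z. t \<in> {0..T} \<Longrightarrow>
      ((\<lambda>s. \<Phi> s z) has_vector_derivative field t (closest_point (cball 0 M) (\<Phi> t z))) (at t within {0..T})"
    and I: "finite I" and \<delta>: "\<delta> > 0"
  shows "measure (f T) {z. \<forall>i\<in>I. norm (z - \<Phi> T i) > \<delta> * exp (L * T)} \<le> measure f0 {z. \<forall>i\<in>I. norm (z - i) > \<delta>}"
proof -
  interpret T: compact_prob "f T" "msupport (f T)" by (rule f_compact_prob[OF T])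
  interpret f0: compact_prob f0 "msupport f0" by (rule compact_prob_Pc[OF f0_Pc])
  define S where "S = {z. \<forall>i\<in>I. norm (z - \<Phi> T i) > \<delta> * exp (L * T)}"
  define S0 where "S0 = {z. \<forall>i\<in>I. norm (z - i) > \<delta>}"
  have "open S" "open S0"
    unfolding S_def S0_def by (rule open_all_norm_greater[OF I])+
  then have S: "S \<in> sets (f T)" "S0 \<in> sets f0" by (auto simp: T.sets_M f0.sets_M)
  define u where "u t z i = exp (- 2 * L * t) * (norm (z - \<Phi> t i))\<^sup>2 - \<delta>\<^sup>2" for t z i
  define h where "h n t z = plateau ((norm z)\<^sup>2 - M\<^sup>2) * (\<Prod>i\<in>I. flat_exp 0 (real (Suc n) * u t z i))" for n t z
  have u_pos: "u t z i > 0 \<longleftrightarrow> norm (z - \<Phi> t i) > \<delta> * exp (L * t)" for t z i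
  proof -
    have "u t z i > 0 \<longleftrightarrow> (norm (z - \<Phi> t i))\<^sup>2 > (\<delta> * exp (L * t))\<^sup>2"
      by (simp add: u_def power_mult_distrib exp_minus field_simps flip: exp_double)
    also have "\<dots> \<longleftrightarrow> norm (z - \<Phi> t i) > \<delta> * exp (L * t)"
      using \<delta> by (intro iffI power_strict_mono) (auto dest: power_less_imp_less_base)
    finally show ?thesis .
  qed
  have sup: "supersolution T M (h n)" for n
    unfolding h_def u_def
    using M(1) L by (intro supersolution_mult supersolution_cutoff supersolution_prod I
        supersolution_distance lip \<Phi>) auto
  have prod01: "0 \<le> (\<Prod>i\<in>I. flat_exp 0 (x i))" "(\<Prod>i\<in>I. flat_exp 0 (x i)) \<le> 1" for x :: "'a \<times> 'a \<Rightarrow> real"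
    by (auto intro!: prod_nonneg prod_le_1 simp: flat0_nonneg flat0_le_1)
  have h01: "0 \<le> h n t z" "h n t z \<le> 1" for n t z
    unfolding h_def using prod01 plateau_nonneg plateau_le_1
    by (auto intro!: mult_nonneg_nonneg mult_le_one)
  have supp: "bounded {z. h n t z \<noteq> 0}" for n t
  proof (rule bounded_subset[of "cball 0 (M + 2)"])
    show "{z. h n t z \<noteq> 0} \<subseteq> cball 0 (M + 2)"
    proof (safe, rule ccontr)
      fix z assume z: "h n t z \<noteq> 0" "z \<notin> cball 0 (M + 2)"
      then have "(M + 2)\<^sup>2 \<le> (norm z)\<^sup>2" using M(1) by (intro power_mono) auto
      then have "(norm z)\<^sup>2 - M\<^sup>2 \<ge> 2" using M(1) by (simp add: power2_sum)
      then show False using z(1) by (simp add: h_def plateau_eq_0)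
    qed
  qed simp
  have ch: "continuous_on UNIV (h n t)" if "t \<in> {0..T}" for n t
    using sup[of n] that Ck_on.simps(1) unfolding supersolution_def by blast
  have le: "(\<integral>z. h n T z \<partial>(f T)) \<le> measure f0 S0" for n
  proof -
    have "(\<integral>z. h n T z \<partial>(f T)) \<le> (\<integral>z. h n 0 z \<partial>f0)"
      by (rule supersolution_integral_le[OF sup T supp M(2)])
    also have "\<dots> \<le> (\<integral>z. indicator S0 z \<partial>f0)"
    proof (rule integral_mono)
      show "integrable f0 (h n 0)" using T by (intro f0.integrable_continuous ch) simp
      show "integrable f0 (indicator S0 :: _ \<Rightarrow> real)" using S(2) by (simp add: f0.emeasure_eq_measure)
      show "h n 0 z \<le> indicator S0 z" for z
      proof (cases "z \<in> S0")
        case False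
        then obtain i where i: "i \<in> I" "\<not> u 0 z i > 0" using u_pos[of 0 z] by (auto simp: S0_def \<Phi>0)
        then have "flat_exp 0 (real (Suc n) * u 0 z i) = 0"
          by (simp only: flat0) (simp add: zero_less_mult_iff)
        then have "h n 0 z = 0" using i(1) I by (auto simp: h_def intro!: prod_zero)
        then show ?thesis by simp
      qed (use h01 in auto)
    qed
    also have "\<dots> = measure f0 S0" using S(2) by simp
    finally show ?thesis .
  qed
  \<comment> \<open>The cutoff factor is 1 on the support of \<open>f T\<close>, so the limit there
    is decided by the distance factors alone.\<close>
  have "(\<lambda>n. \<integral>z. h n T z \<partial>(f T)) \<longlonglongrightarrow> (\<integral>z. indicator S z \<partial>(f T))"
  proof (rule integral_dominated_convergence[where w="\<lambda>_. 1"])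
    show "h n T \<in> borel_measurable (f T)" for n
      using T by (intro borel_measurable_integrable T.integrable_continuous ch) simp
    show "AE z in f T. (\<lambda>n. h n T z) \<longlonglongrightarrow> indicator S z"
      using T.AE_K
    proof eventually_elim
      case (elim z)
      then have "z \<in> cball 0 M" using M(2)[of T] T by auto
      then have 1: "plateau ((norm z)\<^sup>2 - M\<^sup>2) = 1" using M(1) by (intro plateau_eq_1) (simp add: power_mono)
      have "(\<lambda>n. h n T z) \<longlonglongrightarrow> 1 * (\<Prod>i\<in>I. if u T z i > 0 then 1 else 0)"
        unfolding h_def 1 by (intro tendsto_intros tendsto_prod flat0_scaled_tendsto)
      also have "1 * (\<Prod>i\<in>I. if u T z i > 0 then 1 else 0) = (indicator S z :: real)"
      proof (cases "z \<in> S")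
        case True
        then have "u T z i > 0" if "i \<in> I" for i using that by (simp add: u_pos S_def)
        then show ?thesis using True by simp
      next
        case False
        then obtain i where "i \<in> I" "\<not> u T z i > 0" by (auto simp: u_pos S_def)
        then have "(\<Prod>i\<in>I. if u T z i > 0 then 1 else 0 :: real) = 0"
          by (intro prod_zero I) auto
        then show ?thesis using False by simp
      qed
      finally show ?case .
    qed
    show "AE z in f T. norm (h n T z) \<le> 1" for n using h01 by simp
  qed (use S in auto)
  then have "(\<integral>z. indicator S z \<partial>(f T)) \<le> measure f0 S0"
    by (rule LIMSEQ_le_const2) (use le in auto)
  then show ?thesis using S(1) by (simp add: S_def S0_def)
qed

lemma compact_finite_cover:
  fixes A :: "'b::metric_space set"
  assumes "compact A" "e > 0"
  obtains I where "finite I" "I \<subseteq> A" "A \<subseteq> (\<Union>i\<in>I. cball i e)"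
proof -
  have "A \<subseteq> (\<Union>c\<in>A. ball c e)" using assms(2) centre_in_ball by blast
  then obtain I where "I \<subseteq> A" "finite I" "A \<subseteq> (\<Union>c\<in>I. ball c e)"
    by (rule compactE_image[OF assms(1) open_ball])
  note this(3)
  also have "(\<Union>c\<in>I. ball c e) \<subseteq> (\<Union>i\<in>I. cball i e)"
    by (rule UN_mono[OF order_refl ball_subset_cball])
  finally have "A \<subseteq> (\<Union>i\<in>I. cball i e)" .
  then show ?thesis by (rule that[OF \<open>finite I\<close> \<open>I \<subseteq> A\<close>])
qed

text \<open>Inner regularity extends the inequality from compact to Borel sets; applied to a set and
  to its complement, it becomes an equality because both total masses are 1.\<close>

lemma borel_prob_eqI:
  fixes \<mu> \<nu> :: "'b::euclidean_space measure"
  assumes \<mu>: "\<mu> \<in> borel_prob" and \<nu>: "\<nu> \<in> borel_prob"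
    and le: "\<And>B. compact B \<Longrightarrow> measure \<mu> B \<le> measure \<nu> B"
  shows "\<mu> = \<nu>"
proof -
  have s: "sets \<mu> = sets borel" "sets \<nu> = sets borel" using assms by (auto simp: borel_prob_def)
  interpret \<mu>: prob_space \<mu> using \<mu> by (simp add: borel_prob_def)
  interpret \<nu>: prob_space \<nu> using \<nu> by (simp add: borel_prob_def)
  have le': "emeasure \<mu> X \<le> emeasure \<nu> X" if X: "X \<in> sets borel" for X
  proof -
    have "emeasure \<mu> X = (SUP K\<in>{K. K \<subseteq> X \<and> compact K}. emeasure \<mu> K)"
      using s X by (intro inner_regular) auto
    also have "\<dots> \<le> emeasure \<nu> X"
    proof (rule SUP_least)
      fix K assume K: "K \<in> {K. K \<subseteq> X \<and> compact K}"
      then have "emeasure \<mu> K \<le> emeasure \<nu> K"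
        using le by (simp add: \<mu>.emeasure_eq_measure \<nu>.emeasure_eq_measure)
      also have "\<dots> \<le> emeasure \<nu> X" using K X s by (intro emeasure_mono) auto
      finally show "emeasure \<mu> K \<le> emeasure \<nu> X" .
    qed
    finally show ?thesis .
  qed
  have m: "measure \<mu> X \<le> measure \<nu> X" if "X \<in> sets borel" for X
    using le'[OF that] by (simp add: \<mu>.emeasure_eq_measure \<nu>.emeasure_eq_measure)
  show ?thesis
  proof (rule measure_eqI)
    fix X assume "X \<in> sets \<mu>"
    then have X: "X \<in> sets borel" using s by simp
    have "measure \<mu> (UNIV - X) = 1 - measure \<mu> X" "measure \<nu> (UNIV - X) = 1 - measure \<nu> X"
      using X s \<mu>.prob_compl[of X] \<nu>.prob_compl[of X] sets_eq_imp_space_eq[OF s(1)] sets_eq_imp_space_eq[OF s(2)]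
      by auto
    then have "measure \<mu> X = measure \<nu> X" using m[OF X] m[of "UNIV - X"] X by auto
    then show "emeasure \<mu> X = emeasure \<nu> X" by (simp add: \<mu>.emeasure_eq_measure \<nu>.emeasure_eq_measure)
  qed (simp add: s)
qed

context mean_field_lipschitz
begin

text \<open>\<open>ball_transport\<close> acts on complements: a compact \<open>A\<close> is covered
  by balls of radius 1/(n+1) about finitely many of its points, so the points at distance more than
  \<open>\<epsilon> n\<close> from the image of \<open>A\<close> have \<open>f T\<close>-mass at
  most the \<open>f0\<close>-mass of the complement of \<open>A\<close>. As \<open>n\<close> grows,
  these points exhaust the complement of the image, which is closed.\<close>

lemma pushforward:
  fixes \<Phi> :: "real \<Rightarrow> 'a \<times> 'a \<Rightarrow> 'a \<times> 'a"
  assumes M: "M > 0" "\<And>t. t \<in> {0..T} \<Longrightarrow> msupport (f t) \<subseteq> cball 0 M" and T: "T \<ge> 0"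
    and \<Phi>0: "\<And>z. \<Phi> 0 z = z"
    and \<Phi>: "\<And>t z. t \<in> {0..T} \<Longrightarrow>
      ((\<lambda>s. \<Phi> s z) has_vector_derivative field t (closest_point (cball 0 M) (\<Phi> t z))) (at t within {0..T})"
    and c\<Phi>: "continuous_on UNIV (\<Phi> T)"
  shows "f T = distr f0 borel (\<Phi> T)"
proof -
  interpret T: compact_prob "f T" "msupport (f T)" by (rule f_compact_prob[OF T])
  interpret f0: compact_prob f0 "msupport f0" by (rule compact_prob_Pc[OF f0_Pc])
  obtain L where L: "L \<ge> 0"
    "\<And>t z z'. t \<in> {0..T} \<Longrightarrow> z \<in> cball 0 M \<Longrightarrow> z' \<in> cball 0 M \<Longrightarrow>
      norm (field t z - field t z') \<le> L * norm (z - z')"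
    using field_lipschitz[OF M] by blast
  have m\<Phi>: "\<Phi> T \<in> borel_measurable f0"
    by (intro f0.measurable_M borel_measurable_continuous_onI c\<Phi>)
  have image: "measure f0 A \<le> measure (f T) (\<Phi> T ` A)" if A: "compact A" for A
  proof (cases "A = {}")
    case False
    define C where "C = \<Phi> T ` A"
    have C: "compact C" "C \<noteq> {}"
      unfolding C_def using A False by (auto intro!: compact_continuous_image continuous_on_subset[OF c\<Phi>])
    define \<epsilon> where "\<epsilon> n = inverse (real (Suc n)) * exp (L * T)" for n
    define U where "U n = {z. infdist z C > \<epsilon> n}" for n
    have oU: "open (U n)" for n unfolding U_def by (intro open_Collect_less continuous_intros)
    have U_le: "measure (f T) (U n) \<le> measure f0 (- A)" for n
    proof -
      have d: "inverse (real (Suc n)) > 0" by simp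
      obtain I where I: "finite I" "I \<subseteq> A" "A \<subseteq> (\<Union>i\<in>I. cball i (inverse (real (Suc n))))"
        by (rule compact_finite_cover[OF A d])
      have o: "{z. \<forall>i\<in>I. norm (z - y i) > r} \<in> sets borel" for y and r :: real
        by (intro borel_open open_all_norm_greater I(1))
      have "U n \<subseteq> {z. \<forall>i\<in>I. norm (z - \<Phi> T i) > inverse (real (Suc n)) * exp (L * T)}"
      proof safe
        fix z i assume z: "z \<in> U n" and i: "i \<in> I"
        have "infdist z C \<le> dist z (\<Phi> T i)" using i I(2) by (intro infdist_le) (auto simp: C_def)
        then show "inverse (real (Suc n)) * exp (L * T) < norm (z - \<Phi> T i)"
          using z by (simp add: U_def \<epsilon>_def dist_norm)
      qed
      then have "measure (f T) (U n) \<le> measure (f T) {z. \<forall>i\<in>I. norm (z - \<Phi> T i) > inverse (real (Suc n)) * exp (L * T)}"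
        by (intro T.finite_measure_mono) (simp_all only: T.sets_M o)
      also have "\<dots> \<le> measure f0 {z. \<forall>i\<in>I. norm (z - i) > inverse (real (Suc n))}"
        by (rule ball_transport[OF M T L \<Phi>0 \<Phi> I(1) d])
      also have "\<dots> \<le> measure f0 (- A)"
      proof (rule f0.finite_measure_mono)
        show "{z. \<forall>i\<in>I. norm (z - i) > inverse (real (Suc n))} \<subseteq> - A"
        proof safe
          fix z assume z: "\<forall>i\<in>I. norm (z - i) > inverse (real (Suc n))" "z \<in> A"
          then obtain i where "i \<in> I" "z \<in> cball i (inverse (real (Suc n)))" using I(3) by blast
          then show False using z(1) by (force simp: dist_norm norm_minus_commute)
        qed
        show "- A \<in> sets f0" using A by (auto simp: f0.sets_M borel_compact intro!: borel_comp)
      qed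
      finally show ?thesis .
    qed
    have "incseq U"
    proof (rule incseq_SucI)
      fix n
      have "\<epsilon> (Suc n) \<le> \<epsilon> n" unfolding \<epsilon>_def by (intro mult_right_mono le_imp_inverse_le) auto
      then show "U n \<subseteq> U (Suc n)" by (auto simp: U_def)
    qed
    then have "(\<lambda>n. measure (f T) (U n)) \<longlonglongrightarrow> measure (f T) (\<Union>n. U n)"
      using oU by (intro T.finite_Lim_measure_incseq) (auto simp: T.sets_M)
    moreover have "(\<Union>n. U n) = - C"
    proof (intro set_eqI iffI)
      fix z assume "z \<in> - C"
      then have "infdist z C > 0"
        using C compact_imp_closed infdist_pos_not_in_closed by (metis ComplD)
      then have "infdist z C / exp (L * T) > 0" by simp
      from reals_Archimedean[OF this] obtain n where "inverse (real (Suc n)) < infdist z C / exp (L * T)" by blast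
      then have "\<epsilon> n < infdist z C" by (simp add: \<epsilon>_def pos_less_divide_eq)
      then show "z \<in> (\<Union>n. U n)" by (auto simp: U_def)
    next
      fix z assume "z \<in> (\<Union>n. U n)"
      then obtain n where n: "infdist z C > \<epsilon> n" by (auto simp: U_def)
      have "\<epsilon> n > 0" by (simp add: \<epsilon>_def)
      with n have "infdist z C \<noteq> 0" by simp
      then show "z \<in> - C" using infdist_zero by (metis ComplI)
    qed
    ultimately have "measure (f T) (- C) \<le> measure f0 (- A)"
      using LIMSEQ_le_const2 U_le by metis
    moreover have "measure (f T) (- C) = 1 - measure (f T) C"
      using T.prob_compl[of C] C by (simp add: T.sets_M T.space_M borel_compact Compl_eq_Diff_UNIV)
    moreover have "measure f0 (- A) = 1 - measure f0 A"
      using f0.prob_compl[of A] A by (simp add: f0.sets_M f0.space_M borel_compact Compl_eq_Diff_UNIV)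
    ultimately show ?thesis by (simp add: C_def)
  qed simp
  have "distr f0 borel (\<Phi> T) = f T"
  proof (rule borel_prob_eqI)
    show "distr f0 borel (\<Phi> T) \<in> borel_prob"
      using f0.prob_space_distr[OF m\<Phi>] by (simp add: borel_prob_def)
    show "f T \<in> borel_prob" using f_Pc[OF T] by (simp add: Pc_def)
    fix B :: "('a \<times> 'a) set" assume B: "compact B"
    \<comment> \<open>The preimage of a compact set is closed but perhaps unbounded; intersecting it
      with the compact support of \<open>f0\<close> loses no mass.\<close>
    define A where "A = \<Phi> T -` B \<inter> msupport f0"
    have "closed (\<Phi> T -` B)"
      by (rule closed_vimage[OF compact_imp_closed[OF B] c\<Phi>])
    then have A: "compact A" unfolding A_def by (intro closed_Int_compact f0.compact_K)
    have "measure (distr f0 borel (\<Phi> T)) B = measure f0 (\<Phi> T -` B \<inter> space f0)"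
      using B m\<Phi> by (intro measure_distr) (auto simp: borel_compact)
    also have "\<dots> = measure f0 A"
      using f0.AE_K \<open>closed (\<Phi> T -` B)\<close> A
      by (intro f0.finite_measure_eq_AE) (auto simp: A_def f0.space_M f0.sets_M borel_compact)
    also have "\<dots> \<le> measure (f T) (\<Phi> T ` A)" by (rule image[OF A])
    also have "\<dots> \<le> measure (f T) B"
      using B by (intro T.finite_measure_mono) (auto simp: A_def T.sets_M borel_compact)
    finally show "measure (distr f0 borel (\<Phi> T)) B \<le> measure (f T) B" .
  qed
  then show ?thesis by simp
qed

text \<open>The field is known to be Lipschitz only on a ball, so the flow is first built for a
  modified field. The push-forward formula holds already for that flow, and it closes the circle: a
  trajectory from the support of \<open>f0\<close> stays in the support of \<open>f t\<close>, hence
  in the ball, where the projection is the identity and the true equation holds.\<close>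

theorem flow_representation:
  assumes T: "T \<ge> 0"
  obtains \<Phi> where "continuous_on ({0..T} \<times> UNIV) (\<lambda>(t, z). \<Phi> t z)" "\<And>z. \<Phi> 0 z = z"
    "\<And>t. t \<in> {0..T} \<Longrightarrow> f t = distr f0 borel (\<Phi> t)"
    "\<And>t z. t \<in> {0..T} \<Longrightarrow> z \<in> msupport f0 \<Longrightarrow>
      ((\<lambda>s. \<Phi> s z) has_vector_derivative field t (\<Phi> t z)) (at t within {0..T})"
proof -
  obtain M where M: "M > 0" "\<And>t. t \<in> {0..T} \<Longrightarrow> msupport (f t) \<subseteq> cball 0 M"
    using uniform_support[of T] by blast
  obtain L where L: "L \<ge> 0"
    "\<And>t z z'. t \<in> {0..T} \<Longrightarrow> z \<in> cball 0 M \<Longrightarrow> z' \<in> cball 0 M \<Longrightarrow>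
      norm (field t z - field t z') \<le> L * norm (z - z')"
    using field_lipschitz[OF M] by blast
  let ?P = "closest_point (cball (0 :: 'a \<times> 'a) M)"
  have Mne: "convex (cball (0::'a \<times> 'a) M)" "closed (cball (0::'a \<times> 'a) M)" "cball (0::'a \<times> 'a) M \<noteq> {}" using M by auto
  have P: "?P z \<in> cball 0 M" for z using Mne by (intro closest_point_in_set) auto
  \<comment> \<open>Clamping time and projecting space makes the field globally bounded and
    Lipschitz, as \<open>picard_flow\<close> requires.\<close>
  define F where "F t z = field (max 0 (min t T)) (?P z)" for t z
  have cl: "max 0 (min t T) \<in> {0..T}" for t using T by auto
  have cF: "continuous_on UNIV (\<lambda>(t, z). F t z)"
  proof -
    have "continuous_on UNIV (\<lambda>p. (\<lambda>(t, z). field t z) (max 0 (min (fst p) T), ?P (snd p)))"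
      by (rule continuous_on_compose2[OF continuous_field])
        (auto intro!: continuous_intros continuous_on_compose2[OF continuous_on_closest_point[OF Mne, of UNIV]])
    then show ?thesis by (simp add: F_def case_prod_beta)
  qed
  have "compact ((\<lambda>(t, z). field t z) ` ({0..T} \<times> cball 0 M))"
    by (intro compact_continuous_image continuous_on_subset[OF continuous_field] compact_Times) auto
  then have "bounded ((\<lambda>(t, z). field t z) ` ({0..T} \<times> cball 0 M))" by (rule compact_imp_bounded)
  then obtain B where B': "\<And>y. y \<in> (\<lambda>(t, z). field t z) ` ({0..T} \<times> cball 0 M) \<Longrightarrow> norm y \<le> B"
    unfolding bounded_iff by blast
  have B: "norm (field t z) \<le> B" if "t \<in> {0..T}" "z \<in> cball 0 M" for t z
    using that by (intro B' image_eqI[of _ _ "(t, z)"]) simp_all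
  have bF: "norm (F t z) \<le> B" for t z unfolding F_def by (rule B[OF cl P])
  have lF: "norm (F t z - F t w) \<le> L * norm (z - w)" for t z w
  proof -
    have "norm (F t z - F t w) \<le> L * norm (?P z - ?P w)" unfolding F_def by (rule L(2)[OF cl P P])
    also have "norm (?P z - ?P w) \<le> norm (z - w)"
      using closest_point_lipschitz[OF Mne, of z w] by (simp add: dist_norm)
    finally show ?thesis using L(1) by (simp add: mult_left_mono)
  qed
  obtain \<Phi> C where \<Phi>: "\<And>z. \<Phi> 0 z = z"
    "\<And>t z. t \<in> {0..T} \<Longrightarrow> ((\<lambda>s. \<Phi> s z) has_vector_derivative F t (\<Phi> t z)) (at t within {0..T})"
    "\<And>t z w. t \<in> {0..T} \<Longrightarrow> norm (\<Phi> t z - \<Phi> t w) \<le> C * norm (z - w)"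
    using picard_flow[OF cF bF lF L(1) T] by blast
  have \<Phi>': "((\<lambda>s. \<Phi> s z) has_vector_derivative field t (?P (\<Phi> t z))) (at t within {0..T})" if "t \<in> {0..T}" for t z
    using \<Phi>(2)[OF that, of z] that by (simp add: F_def)
  have lipt: "norm (\<Phi> s z - \<Phi> t z) \<le> B * \<bar>s - t\<bar>" if st: "s \<in> {0..T}" "t \<in> {0..T}" for s t z
  proof -
    have "norm (\<Phi> s z - \<Phi> t z) \<le> B * norm (s - t)"
    proof (rule differentiable_bound[where S="{0..T}" and f'="\<lambda>u y. y *\<^sub>R F u (\<Phi> u z)"])
      show "((\<lambda>s. \<Phi> s z) has_derivative (\<lambda>y. y *\<^sub>R F u (\<Phi> u z))) (at u within {0..T})" if "u \<in> {0..T}" for u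
        using \<Phi>(2)[OF that] by (simp add: has_vector_derivative_def)
      show "onorm (\<lambda>y. y *\<^sub>R F u (\<Phi> u z)) \<le> B" if "u \<in> {0..T}" for u
      proof (rule onorm_le)
        fix y :: real
        have "\<bar>y\<bar> * norm (F u (\<Phi> u z)) \<le> \<bar>y\<bar> * B" by (intro mult_left_mono bF) simp
        then show "norm (y *\<^sub>R F u (\<Phi> u z)) \<le> B * norm y" by (simp add: mult.commute)
      qed
    qed (use st in auto)
    then show ?thesis by simp
  qed
  have cont: "continuous_on ({0..T} \<times> UNIV) (\<lambda>(t, z). \<Phi> t z)"
  proof -
    define D where "D = \<bar>B\<bar> + \<bar>C\<bar>"
    have "D-lipschitz_on ({0..T} \<times> UNIV) (\<lambda>(t, z). \<Phi> t z)"
    proof (rule lipschitz_onI)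
      fix p q :: "real \<times> 'a \<times> 'a"
      assume pq: "p \<in> {0..T} \<times> UNIV" "q \<in> {0..T} \<times> UNIV"
      obtain s z t w where e: "p = (s, z)" "q = (t, w)" by (cases p, cases q) auto
      have st: "s \<in> {0..T}" "t \<in> {0..T}" using pq e by auto
      have "dist (\<Phi> s z) (\<Phi> t w) \<le> dist (\<Phi> s z) (\<Phi> t z) + dist (\<Phi> t z) (\<Phi> t w)" by (rule dist_triangle)
      also have "\<dots> \<le> B * \<bar>s - t\<bar> + C * norm (z - w)"
        using lipt[OF st, of z] \<Phi>(3)[OF st(2), of z w] by (simp add: dist_norm)
      also have "\<dots> \<le> \<bar>B\<bar> * dist p q + \<bar>C\<bar> * dist p q"
      proof (intro add_mono mult_mono)
        show "\<bar>s - t\<bar> \<le> dist p q" using dist_fst_le[of p q] e by (simp add: dist_real_def)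
        show "norm (z - w) \<le> dist p q" using dist_snd_le[of p q] e by (simp add: dist_norm)
      qed auto
      finally show "dist (case p of (t, z) \<Rightarrow> \<Phi> t z) (case q of (t, z) \<Rightarrow> \<Phi> t z) \<le> D * dist p q"
        by (simp add: e D_def algebra_simps)
    qed (simp add: D_def)
    then show ?thesis by (rule lipschitz_on_continuous_on)
  qed
  have ct: "continuous_on UNIV (\<Phi> t)" if "t \<in> {0..T}" for t
    by (rule continuous_on_section[OF cont that])
  have push: "f t = distr f0 borel (\<Phi> t)" if t: "t \<in> {0..T}" for t
  proof (rule pushforward[OF M(1), where \<Phi>=\<Phi>])
    show "((\<lambda>s. \<Phi> s z) has_vector_derivative field u (?P (\<Phi> u z))) (at u within {0..t})" if "u \<in> {0..t}" for u z
      using \<Phi>'[of u z] that t by (auto intro: has_vector_derivative_within_subset)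
  qed (use t M(2) ct \<Phi>(1) in auto)
  interpret f0: compact_prob f0 "msupport f0" by (rule compact_prob_Pc[OF f0_Pc])
  have "\<Phi> t z \<in> msupport (f t)" if t: "t \<in> {0..T}" and z: "z \<in> msupport f0" for t z
    unfolding msupport_def
  proof safe
    fix U assume U: "open U" "\<Phi> t z \<in> U"
    have m: "\<Phi> t \<in> borel_measurable f0"
      by (intro f0.measurable_M borel_measurable_continuous_onI ct t)
    have "open (\<Phi> t -` U)" using U ct[OF t] by (simp add: open_vimage)
    then have "emeasure f0 (\<Phi> t -` U) > 0" using z U unfolding msupport_def by auto
    then show "emeasure (f t) U > 0"
      using U m unfolding push[OF t] by (simp add: emeasure_distr f0.space_M)
  qed
  then have "\<Phi> t z \<in> cball 0 M" if "t \<in> {0..T}" "z \<in> msupport f0" for t z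
    using M(2) that by blast
  then have "((\<lambda>s. \<Phi> s z) has_vector_derivative field t (\<Phi> t z)) (at t within {0..T})"
    if "t \<in> {0..T}" "z \<in> msupport f0" for t z
    using \<Phi>'[OF that(1), of z] that by (simp add: closest_point_self)
  with cont \<Phi>(1) push show ?thesis using that by blast
qed

end

section \<open>Dissipation along Lagrangian trajectories\<close>

lemma (in compact_prob)
  fixes F :: "'b \<times> 'b \<Rightarrow> 'd::euclidean_space"
  assumes F: "continuous_on UNIV F"
  shows fubini: "(\<integral>z. (\<integral>z'. F (z, z') \<partial>M) \<partial>M) = (\<integral>p. F p \<partial>(M \<Otimes>\<^sub>M M))"
    and swap: "(\<integral>p. F (snd p, fst p) \<partial>(M \<Otimes>\<^sub>M M)) = (\<integral>p. F p \<partial>(M \<Otimes>\<^sub>M M))"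
proof -
  interpret P: compact_prob "M \<Otimes>\<^sub>M M" "K \<times> K"
    by (rule compact_prob_pair[OF compact_prob_axioms compact_prob_axioms])
  interpret PP: pair_sigma_finite M M ..
  have i: "integrable (M \<Otimes>\<^sub>M M) F" by (rule P.integrable_continuous[OF F])
  show "(\<integral>z. (\<integral>z'. F (z, z') \<partial>M) \<partial>M) = (\<integral>p. F p \<partial>(M \<Otimes>\<^sub>M M))"
    by (rule PP.integral_fst'[OF i])
  show "(\<integral>p. F (snd p, fst p) \<partial>(M \<Otimes>\<^sub>M M)) = (\<integral>p. F p \<partial>(M \<Otimes>\<^sub>M M))"
    using PP.integral_product_swap[OF borel_measurable_integrable[OF i]] by (simp add: case_prod_unfold)
qed

locale pair_prob = compact_prob M K for M :: "'b::euclidean_space measure" and K +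
  fixes PM assumes PM_def: "PM = M \<Otimes>\<^sub>M M"
begin

sublocale P: compact_prob PM "K \<times> K"
  unfolding PM_def by (rule compact_prob_pair[OF compact_prob_axioms compact_prob_axioms])

lemma c_fst: "continuous_on UNIV g \<Longrightarrow> continuous_on UNIV (\<lambda>p::'b \<times> 'b. g (fst p))"
  by (auto intro!: continuous_on_compose2[of UNIV g] continuous_intros)

lemma c_snd: "continuous_on UNIV g \<Longrightarrow> continuous_on UNIV (\<lambda>p::'b \<times> 'b. g (snd p))"
  by (auto intro!: continuous_on_compose2[of UNIV g] continuous_intros)

lemma marginal:
  fixes g :: "'b \<Rightarrow> 'd::euclidean_space"
  assumes "continuous_on UNIV g"
  shows "(\<integral>p. g (fst p) \<partial>PM) = (\<integral>z. g z \<partial>M)" "(\<integral>p. g (snd p) \<partial>PM) = (\<integral>z. g z \<partial>M)"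
proof -
  show 1: "(\<integral>p. g (fst p) \<partial>PM) = (\<integral>z. g z \<partial>M)"
    using fubini[OF c_fst[OF assms]] by (simp add: PM_def prob_space)
  show "(\<integral>p. g (snd p) \<partial>PM) = (\<integral>z. g z \<partial>M)"
    using swap[OF c_fst[OF assms]] 1 by (simp add: PM_def)
qed

text \<open>Exchanging the two particles replaces the weight g(z) by - g(z'); averaging both forms
  gives the factor 1/2 and the difference of the weights.\<close>

lemma antisymmetric_integral:
  fixes F :: "'b \<times> 'b \<Rightarrow> 'd::euclidean_space" and g :: "'b \<Rightarrow> 'd"
  assumes F: "continuous_on UNIV F" and anti: "\<And>z z'. F (z', z) = - F (z, z')"
    and g: "continuous_on UNIV g"
  shows "(\<integral>z. g z \<bullet> (\<integral>z'. F (z, z') \<partial>M) \<partial>M) = 1 / 2 * (\<integral>p. F p \<bullet> (g (fst p) - g (snd p)) \<partial>PM)"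
proof -
  have Fz: "continuous_on UNIV (\<lambda>z'. F (z, z'))" for z
    using continuous_on_compose2[OF F continuous_on_Pair_const[of UNIV z]] by simp
  have cgF: "continuous_on UNIV (\<lambda>p. g (fst p) \<bullet> F p)" "continuous_on UNIV (\<lambda>p. g (snd p) \<bullet> F p)"
    by (intro continuous_intros c_fst c_snd g F)+
  have "(\<integral>z. g z \<bullet> (\<integral>z'. F (z, z') \<partial>M) \<partial>M) = (\<integral>z. (\<integral>z'. g z \<bullet> F (z, z') \<partial>M) \<partial>M)"
    using integrable_continuous[OF Fz] by simp
  also have "\<dots> = (\<integral>p. g (fst p) \<bullet> F p \<partial>PM)"
    using fubini[OF cgF(1)] by (simp add: PM_def)
  finally have 1: "(\<integral>z. g z \<bullet> (\<integral>z'. F (z, z') \<partial>M) \<partial>M) = (\<integral>p. g (fst p) \<bullet> F p \<partial>PM)" .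
  have "(\<integral>p. g (fst p) \<bullet> F p \<partial>PM) = (\<integral>p. g (snd p) \<bullet> F (snd p, fst p) \<partial>PM)"
    using swap[OF cgF(1)] by (simp add: PM_def)
  also have "\<dots> = (\<integral>p. - (g (snd p) \<bullet> F p) \<partial>PM)"
    using anti by (intro Bochner_Integration.integral_cong) (auto simp: inner_minus_right)
  finally have 2: "(\<integral>p. g (fst p) \<bullet> F p \<partial>PM) = - (\<integral>p. g (snd p) \<bullet> F p \<partial>PM)" by simp
  have "(\<integral>p. F p \<bullet> (g (fst p) - g (snd p)) \<partial>PM) = (\<integral>p. g (fst p) \<bullet> F p - g (snd p) \<bullet> F p \<partial>PM)"
    by (simp add: inner_diff_right inner_commute)
  also have "\<dots> = (\<integral>p. g (fst p) \<bullet> F p \<partial>PM) - (\<integral>p. g (snd p) \<bullet> F p \<partial>PM)"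
    by (intro Bochner_Integration.integral_diff P.integrable_continuous cgF)
  finally show ?thesis using 1 2 by simp
qed

text \<open>The cross term factors into a product of means and vanishes.\<close>

lemma variance_pair:
  fixes g :: "'b \<Rightarrow> 'd::euclidean_space"
  assumes g: "continuous_on UNIV g" and mean: "(\<integral>z. g z \<partial>M) = 0"
  shows "(\<integral>p. (norm (g (fst p) - g (snd p)))\<^sup>2 \<partial>PM) = 2 * (\<integral>z. (norm (g z))\<^sup>2 \<partial>M)"
proof -
  have c: "continuous_on UNIV (\<lambda>p::'b \<times> 'b. (norm (g (fst p)))\<^sup>2)" "continuous_on UNIV (\<lambda>p::'b \<times> 'b. (norm (g (snd p)))\<^sup>2)"
    "continuous_on UNIV (\<lambda>p::'b \<times> 'b. g (fst p) \<bullet> g (snd p))" "continuous_on UNIV (\<lambda>z. (norm (g z))\<^sup>2)"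
    by (intro continuous_intros c_fst c_snd g)+
  have "(\<integral>p. g (fst p) \<bullet> g (snd p) \<partial>PM) = (\<integral>z. (\<integral>z'. g z \<bullet> g z' \<partial>M) \<partial>M)"
    using fubini[OF c(3)] by (simp add: PM_def)
  also have "\<dots> = 0" using integrable_continuous[OF g] by (simp add: mean)
  finally have 0: "(\<integral>p. g (fst p) \<bullet> g (snd p) \<partial>PM) = 0" .
  have "(\<integral>p. (norm (g (fst p) - g (snd p)))\<^sup>2 \<partial>PM)
      = (\<integral>p. (norm (g (fst p)))\<^sup>2 + (norm (g (snd p)))\<^sup>2 - 2 * (g (fst p) \<bullet> g (snd p)) \<partial>PM)"
    by (intro Bochner_Integration.integral_cong)
      (auto simp: power2_norm_eq_inner inner_diff_left inner_diff_right inner_commute)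
  also have "\<dots> = (\<integral>z. (norm (g z))\<^sup>2 \<partial>M) + (\<integral>z. (norm (g z))\<^sup>2 \<partial>M) - 2 * 0"
    using P.integrable_continuous[OF c(1)] P.integrable_continuous[OF c(2)] P.integrable_continuous[OF c(3)]
    by (simp add: 0 marginal[OF c(4)])
  finally show ?thesis by simp
qed

text \<open>Without information on the mean, the cross term is estimated by the squares, at the
  price of a factor 2.\<close>

lemma pair_norm_sq_le:
  fixes g :: "'b \<Rightarrow> 'd::euclidean_space"
  assumes g: "continuous_on UNIV g"
  shows "(\<integral>p. (norm (g (fst p) - g (snd p)))\<^sup>2 \<partial>PM) \<le> 4 * (\<integral>z. (norm (g z))\<^sup>2 \<partial>M)"
proof -
  have c: "continuous_on UNIV (\<lambda>p::'b \<times> 'b. (norm (g (fst p)))\<^sup>2)" "continuous_on UNIV (\<lambda>p::'b \<times> 'b. (norm (g (snd p)))\<^sup>2)"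
    "continuous_on UNIV (\<lambda>p::'b \<times> 'b. (norm (g (fst p) - g (snd p)))\<^sup>2)" "continuous_on UNIV (\<lambda>z. (norm (g z))\<^sup>2)"
    by (intro continuous_intros c_fst c_snd g)+
  note i = P.integrable_continuous[OF c(1)] P.integrable_continuous[OF c(2)] P.integrable_continuous[OF c(3)]
  have "(\<integral>p. (norm (g (fst p) - g (snd p)))\<^sup>2 \<partial>PM) \<le> (\<integral>p. 2 * (norm (g (fst p)))\<^sup>2 + 2 * (norm (g (snd p)))\<^sup>2 \<partial>PM)"
  proof (rule integral_mono)
    fix p
    have "0 \<le> (norm (g (fst p) + g (snd p)))\<^sup>2" by simp
    then show "(norm (g (fst p) - g (snd p)))\<^sup>2 \<le> 2 * (norm (g (fst p)))\<^sup>2 + 2 * (norm (g (snd p)))\<^sup>2"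
      by (simp add: power2_norm_eq_inner inner_diff_left inner_diff_right inner_add_left inner_add_right inner_commute)
  qed (use i in auto)
  also have "\<dots> = 4 * (\<integral>z. (norm (g z))\<^sup>2 \<partial>M)"
    using i by (simp add: marginal[OF c(4)])
  finally show ?thesis .
qed

lemma cauchy_schwarz:
  fixes g h :: "'b \<Rightarrow> 'd::euclidean_space"
  assumes g: "continuous_on UNIV g" and h: "continuous_on UNIV h"
  shows "(\<integral>z. g z \<bullet> h z \<partial>M)\<^sup>2 \<le> (\<integral>z. (norm (g z))\<^sup>2 \<partial>M) * (\<integral>z. (norm (h z))\<^sup>2 \<partial>M)"
proof -
  define a b c where "a = (\<integral>z. (norm (g z))\<^sup>2 \<partial>M)" and "b = (\<integral>z. g z \<bullet> h z \<partial>M)" and "c = (\<integral>z. (norm (h z))\<^sup>2 \<partial>M)"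
  have i: "integrable M (\<lambda>z. (norm (g z))\<^sup>2)" "integrable M (\<lambda>z. g z \<bullet> h z)" "integrable M (\<lambda>z. (norm (h z))\<^sup>2)"
    by (intro integrable_continuous continuous_intros g h)+
  have quad: "0 \<le> x\<^sup>2 * a + 2 * x * y * b + y\<^sup>2 * c" for x y
  proof -
    have "0 \<le> (\<integral>z. (norm (x *\<^sub>R g z + y *\<^sub>R h z))\<^sup>2 \<partial>M)" by simp
    also have "\<dots> = (\<integral>z. x\<^sup>2 * (norm (g z))\<^sup>2 + 2 * x * y * (g z \<bullet> h z) + y\<^sup>2 * (norm (h z))\<^sup>2 \<partial>M)"
      unfolding power2_norm_eq_inner
      by (intro Bochner_Integration.integral_cong)
        (auto simp: inner_add_left inner_add_right inner_commute power2_eq_square algebra_simps)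
    also have "\<dots> = x\<^sup>2 * a + 2 * x * y * b + y\<^sup>2 * c" using i by (simp add: a_def b_def c_def)
    finally show ?thesis .
  qed
  have a0: "a \<ge> 0" by (simp add: a_def)
  show ?thesis
  proof (cases "a = 0")
    case True
    have "b = 0"
    proof (rule ccontr)
      assume b: "b \<noteq> 0"
      have q: "0 \<le> 2 * x * b + c" for x using quad[of x 1] True by simp
      \<comment> \<open>For \<open>a = 0\<close> the form is affine in \<open>x\<close>; this choice
        of \<open>x\<close> would give it the value -1.\<close>
      have "2 * (- (c + 1) / (2 * b)) * b = - (c + 1)" using b by (simp add: field_simps)
      then show False using q[of "- (c + 1) / (2 * b)"] by simp
    qed
    then show ?thesis using True by (simp add: a_def b_def c_def)
  next
    case False
    then have a: "a > 0" using a0 by simp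
    \<comment> \<open>For \<open>y = a\<close> the quadratic form is smallest at
      \<open>x = - b\<close>.\<close>
    have "0 \<le> a * (a * c - b\<^sup>2)" using quad[of "- b" a] by (simp add: power2_eq_square algebra_simps)
    then have "b\<^sup>2 \<le> a * c" using a by (simp add: zero_le_mult_iff)
    then show ?thesis by (simp add: a_def b_def c_def)
  qed
qed

lemma integral_norm_le:
  fixes g :: "'b \<Rightarrow> 'd::euclidean_space"
  assumes g: "continuous_on UNIV g" and k: "k \<ge> 0" "(\<integral>z. (norm (g z))\<^sup>2 \<partial>M) \<le> k\<^sup>2"
  shows "(\<integral>z. norm (g z) \<partial>M) \<le> k"
proof -
  have "(\<integral>z. norm (g z) * 1 \<partial>M)\<^sup>2 \<le> (\<integral>z. (norm (norm (g z)))\<^sup>2 \<partial>M) * (\<integral>z. (norm (1::real))\<^sup>2 \<partial>M)"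
    using cauchy_schwarz[of "\<lambda>z. norm (g z)" "\<lambda>_. 1::real"] g by (auto intro!: continuous_intros)
  then have "(\<integral>z. norm (g z) \<partial>M)\<^sup>2 \<le> k\<^sup>2" using k(2) by (simp add: prob_space)
  then show ?thesis using k(1) by (rule power2_le_imp_le)
qed

end

text \<open>\<open>q\<close> is the second moment, \<open>Q\<close> the friction potential,
  \<open>H\<close> the energy. At the maximum \<open>u\<close> of \<open>q\<close> the term
  \<open>p u\<close> is nonnegative, so the nonincreasing sum \<open>p + Q + H / m\<close> controls
  \<open>m / 2 * q u\<close>. At the last time \<open>s\<close> with \<open>q s\<close> at most
  \<open>N\<^sup>2\<close>, \<open>p\<close> is at most sqrt (2 E) N by Cauchy-Schwarz and
  \<open>Q\<close> at most half of \<Psi> N^2, while the energy difference between \<open>s\<close>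
  and \<open>u\<close> costs E / m. The factor \<open>2 / m\<close> turns these into the terms of
  the bound.\<close>

lemma moment_bound_real:
  fixes q p Q Kin H :: "real \<Rightarrow> real"
  assumes T: "T \<ge> 0" and m: "m > 0" "m \<le> \<Psi>" and Vm: "Vm \<le> 0" and r0: "r0 \<ge> 0"
    and q': "\<And>t. t \<in> {0..T} \<Longrightarrow> (q has_real_derivative 2 * p t) (at t within {0..T})"
    and D': "\<And>t. t \<in> {0..T} \<Longrightarrow>
      ((\<lambda>t. p t + Q t + H t / m) has_real_derivative d t) (at t within {0..T})"
    and d: "\<And>t. t \<in> {0..T} \<Longrightarrow> q t \<ge> r0\<^sup>2 \<Longrightarrow> d t \<le> 0"
    and H: "\<And>t. t \<in> {0..T} \<Longrightarrow> H t \<le> H 0" and HK: "\<And>t. t \<in> {0..T} \<Longrightarrow> Kin t / 2 + Vm / 2 \<le> H t"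
    and Kin: "\<And>t. t \<in> {0..T} \<Longrightarrow> Kin t \<ge> 0"
    and pq: "\<And>t. t \<in> {0..T} \<Longrightarrow> (p t)\<^sup>2 \<le> q t * Kin t"
    and Q: "\<And>t. t \<in> {0..T} \<Longrightarrow> m / 2 * q t \<le> Q t" "\<And>t. t \<in> {0..T} \<Longrightarrow> Q t \<le> \<Psi> / 2 * q t"
    and q0: "\<And>t. t \<in> {0..T} \<Longrightarrow> q t \<ge> 0"
  shows "q T \<le> 1 / m * (1 + 2 * sqrt 2 * sqrt (H 0 - Vm)) * max r0 (sqrt (q 0))
    + \<Psi> / m * max (r0\<^sup>2) (q 0) + 2 / m\<^sup>2 * (H 0 - Vm)"
proof -
  define N where "N = max r0 (sqrt (q 0))"
  have T0: "0 \<in> {0..T}" "T \<in> {0..T}" using T by auto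
  have N0: "N \<ge> 0" using r0 by (simp add: N_def)
  have N2: "max (r0\<^sup>2) (q 0) = N\<^sup>2"
  proof (cases "r0 \<le> sqrt (q 0)")
    case True
    then have "r0\<^sup>2 \<le> q 0" using r0 q0[OF T0(1)] by (metis power_mono real_sqrt_pow2)
    then show ?thesis using True q0[OF T0(1)] by (simp add: N_def)
  next
    case False
    then have "q 0 \<le> r0\<^sup>2" using q0[OF T0(1)] by (metis linear power_mono real_sqrt_ge_zero real_sqrt_pow2)
    then show ?thesis using False by (simp add: N_def)
  qed
  \<comment> \<open>The factor 1/2 in front of the interaction yields the lower bound
    \<open>Vm / 2\<close> of the energy. As \<open>Vm\<close> is nonpositive, \<open>Vm / 2\<close>
    is not below \<open>Vm\<close>, so \<open>E\<close> bounds both half the kinetic part and every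
    loss of energy.\<close>
  define E where "E = H 0 - Vm"
  have E: "Kin t \<le> 2 * E" if "t \<in> {0..T}" for t
    using H[OF that] HK[OF that] Vm by (simp add: E_def)
  then have E0: "E \<ge> 0" using Kin[OF T0(1)] E[OF T0(1)] by linarith
  define b where "b = 1 / m * (1 + 2 * sqrt 2 * sqrt E) * N + \<Psi> / m * N\<^sup>2 + 2 / m\<^sup>2 * E"
  have nn: "0 \<le> 1 / m * (1 + 2 * sqrt 2 * sqrt E) * N" "0 \<le> 2 / m\<^sup>2 * E"
    using m N0 E0 by auto
  have "q T \<le> b"
  proof (cases "q T \<le> N\<^sup>2")
    case True
    have "1 * N\<^sup>2 \<le> \<Psi> / m * N\<^sup>2" using m by (intro mult_right_mono) auto
    then show ?thesis using True nn by (simp add: b_def)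
  next
    case False
    have cq: "continuous_on {0..T} q" using q' by (meson DERIV_continuous_on)
    obtain u where u: "u \<in> {0..T}" "\<And>t. t \<in> {0..T} \<Longrightarrow> q t \<le> q u"
      using continuous_attains_sup[OF _ _ cq] T by auto
    have qu: "q u > N\<^sup>2" using u(2)[OF T0(2)] False by simp
    have "q 0 \<le> N\<^sup>2" using N2 by linarith
    define S where "S = {t\<in>{0..u}. q t \<le> N\<^sup>2}"
    have "compact S"
    proof -
      have "continuous_on {0..u} q" by (rule continuous_on_subset[OF cq]) (use u(1) in auto)
      then have "closed {t\<in>{0..u}. q t \<le> N\<^sup>2}"
        by (rule continuous_on_closed_Collect_le[OF _ continuous_on_const closed_atLeastAtMost])
      then show ?thesis unfolding S_def
        by (intro compact_eq_bounded_closed[THEN iffD2] conjI bounded_subset[OF bounded_closed_interval[of 0 u]]) auto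
    qed
    moreover have "0 \<in> S" using u(1) \<open>q 0 \<le> N\<^sup>2\<close> by (simp add: S_def)
    ultimately obtain s where s: "s \<in> S" "\<And>t. t \<in> S \<Longrightarrow> t \<le> s"
      using compact_attains_sup[of S] by blast
    have su: "s < u" "s \<in> {0..T}" using s(1) qu u(1) by (auto simp: S_def order.order_iff_strict)
    \<comment> \<open>\<open>q\<close> cannot be decreasing at its maximum; only times to the left
      are compared, since \<open>u\<close> may be the endpoint \<open>T\<close>.\<close>
    have pu: "p u \<ge> 0"
    proof (rule ccontr)
      assume "\<not> p u \<ge> 0"
      then have "2 * p u < 0" by simp
      from has_real_derivative_neg_dec_left[OF q'[OF u(1)] this]
      obtain e where e: "e > 0" "\<And>h. h > 0 \<Longrightarrow> u - h \<in> {0..T} \<Longrightarrow> h < e \<Longrightarrow> q u < q (u - h)" by blast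
      define h where "h = min (e / 2) (u - s)"
      have "h > 0" "u - h \<in> {0..T}" "h < e" using e(1) su u(1) by (auto simp: h_def)
      then show False using e(2)[of h] u(2)[of "u - h"] by simp
    qed
    have sub: "{s..u} \<subseteq> {0..T}" using su u(1) by auto
    \<comment> \<open>The intermediate point is strictly later than \<open>s\<close>, hence outside
      \<open>S\<close>: there \<open>q\<close> exceeds \<open>N\<^sup>2\<close>, thus also
      \<open>r0\<^sup>2\<close>, and \<open>d\<close> has the right sign.\<close>
    have "\<exists>x\<in>{s<..<u}. (p u + Q u + H u / m) - (p s + Q s + H s / m) = d x * (u - s)"
    proof (rule mvt_simple[OF su(1), of "\<lambda>t. p t + Q t + H t / m" "\<lambda>x. (*) (d x)"])
      fix x assume "s \<le> x" "x \<le> u"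
      then have "x \<in> {0..T}" using sub by auto
      from DERIV_subset[OF D'[OF this] sub]
      show "((\<lambda>t. p t + Q t + H t / m) has_derivative (*) (d x)) (at x within {s..u})"
        by (simp add: has_field_derivative_def)
    qed
    then obtain x where x: "x \<in> {s<..<u}" "(p u + Q u + H u / m) - (p s + Q s + H s / m) = d x * (u - s)" by blast
    have "\<not> q x \<le> N\<^sup>2" using s(2)[of x] x(1) su by (auto simp: S_def)
    moreover have "r0\<^sup>2 \<le> N\<^sup>2" using N2 by linarith
    ultimately have "d x \<le> 0" using d[of x] x(1) sub by force
    then have "d x * (u - s) \<le> 0" using su by (simp add: mult_nonpos_nonneg)
    then have 1: "p u + Q u + H u / m \<le> p s + Q s + H s / m" using x(2) by linarith
    have qs: "q s \<le> N\<^sup>2" using s(1) by (simp add: S_def)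
    have "(p s)\<^sup>2 \<le> N\<^sup>2 * (2 * E)"
      using pq[OF su(2)] mult_mono[OF qs E[OF su(2)]] Kin[OF su(2)] by (simp add: order_trans)
    also have "\<dots> = (sqrt 2 * sqrt E * N)\<^sup>2" using E0 by (simp add: power_mult_distrib)
    finally have ps: "p s \<le> sqrt 2 * sqrt E * N"
      by (rule power2_le_imp_le) (simp add: N0 E0)
    have Qs: "Q s \<le> \<Psi> / 2 * N\<^sup>2"
      using Q(2)[OF su(2)] mult_left_mono[OF qs, of "\<Psi> / 2"] m by linarith
    have "H s / m - H u / m \<le> E / m"
    proof -
      have "H s - H u \<le> E" using H[OF su(2)] HK[OF u(1)] Kin[OF u(1)] Vm by (simp add: E_def)
      then show ?thesis using m by (simp add: diff_divide_distrib[symmetric] divide_right_mono)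
    qed
    then have "m / 2 * q u \<le> sqrt 2 * sqrt E * N + \<Psi> / 2 * N\<^sup>2 + E / m"
      using 1 pu ps Qs Q(1)[OF u(1)] by linarith
    then have "2 / m * (m / 2 * q u) \<le> 2 / m * (sqrt 2 * sqrt E * N + \<Psi> / 2 * N\<^sup>2 + E / m)"
      using m by (intro mult_left_mono) auto
    then have "q u \<le> 1 / m * (2 * sqrt 2 * sqrt E) * N + \<Psi> / m * N\<^sup>2 + 2 / m\<^sup>2 * E"
      using m by (simp add: algebra_simps power2_eq_square)
    also have "\<dots> \<le> b" using m N0 by (simp add: b_def algebra_simps)
    finally show ?thesis using u(2)[OF T0(2)] by simp
  qed
  then show ?thesis by (simp add: b_def N2 E_def N_def)
qed

section \<open>Compactness of measures with bounded second moment\<close>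

text \<open>A point of a Euclidean space is encoded by the indicators of the countably many half-spaces
  with rational offset that contain it, and these binary digits are packed into one real number.
  Convergence of the codes forces each coordinate to converge in the extended reals, so that the
  one-dimensional theorems of Helly and Skorohod apply.\<close>

definition halfspace :: "nat \<Rightarrow> 'b::euclidean_space \<times> real" where
  "halfspace = from_nat_into (Basis \<times> \<rat>)"

definition below :: "'b::euclidean_space \<Rightarrow> nat \<Rightarrow> bool" where
  "below x j \<longleftrightarrow> (case halfspace j of (b, q) \<Rightarrow> x \<bullet> b \<le> q)"

definition halfspace_bit :: "nat \<Rightarrow> 'b::euclidean_space \<Rightarrow> real" where
  "halfspace_bit j x = (if below x j then 1 else 0)"

text \<open>Digits 0 and 1 in base 4 give a Cantor set, in which different digit sequences have
  different values; in base 2 they could coincide.\<close>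

definition code :: "'b::euclidean_space \<Rightarrow> real" where
  "code x = (\<Sum>j. halfspace_bit j x / 4 ^ Suc j)"

lemma halfspace_surj:
  assumes "b \<in> Basis" "q \<in> \<rat>"
  obtains j where "halfspace j = (b, q)"
proof -
  have "range (halfspace :: nat \<Rightarrow> 'a \<times> real) = Basis \<times> \<rat>"
    unfolding halfspace_def
    by (intro range_from_nat_into countable_SIGMA countable_rat) (use assms in \<open>auto intro: countable_finite\<close>)
  then have "(b, q) \<in> range (halfspace :: nat \<Rightarrow> 'a \<times> real)" using assms by auto
  then show ?thesis using that by (metis imageE)
qed

lemma summable_quarter: "summable (\<lambda>j. 1 / 4 ^ Suc (j + k) :: real)"
proof -
  have "summable (\<lambda>j. (1 / 4 ^ Suc k) * (1 / 4) ^ j :: real)"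
    by (intro summable_mult summable_geometric) simp
  then show ?thesis by (simp add: power_add power_one_over field_simps)
qed

lemma suminf_quarter: "(\<Sum>j. 1 / 4 ^ Suc (j + k) :: real) = (1 / 4 ^ k) / 3"
proof -
  have "(\<lambda>j. (1 / 4 ^ Suc k) * (1 / 4) ^ j :: real) sums ((1 / 4 ^ Suc k) * (1 / (1 - 1 / 4)))"
    by (intro sums_mult geometric_sums) simp
  then have "(\<lambda>j. 1 / 4 ^ Suc (j + k) :: real) sums ((1 / 4 ^ k) / 3)"
    by (simp add: power_add power_one_over field_simps)
  then show ?thesis by (rule sums_unique[symmetric])
qed

lemma halfspace_bit_01: "0 \<le> halfspace_bit j x" "halfspace_bit j x \<le> 1"
  by (auto simp: halfspace_bit_def)

lemma summable_code: "summable (\<lambda>j. halfspace_bit j x / 4 ^ Suc j)"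
proof (rule summable_comparison_test')
  show "summable (\<lambda>j. 1 / 4 ^ Suc j :: real)" using summable_quarter[of 0] by simp
  show "norm (halfspace_bit j x / 4 ^ Suc j) \<le> 1 / 4 ^ Suc j" for j
    using halfspace_bit_01[of j x] by (simp add: divide_right_mono)
qed

lemma code_bounds: "0 \<le> code x" "code x \<le> 1"
proof -
  show "0 \<le> code x" unfolding code_def by (intro suminf_nonneg summable_code) (simp add: halfspace_bit_01)
  have "code x \<le> (\<Sum>j. 1 / 4 ^ Suc (j + 0))" unfolding code_def
    using summable_quarter[of 0] by (intro suminf_le summable_code) (auto simp: halfspace_bit_01 divide_right_mono)
  then show "code x \<le> 1" by (simp only: suminf_quarter) simp
qed

text \<open>At the first differing digit, of index i, the codes differ by 4^-(i+1); all later digits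
  together can undo at most a third of that.\<close>

lemma code_separates:
  assumes "halfspace_bit j x \<noteq> halfspace_bit j y"
  shows "\<bar>code x - code y\<bar> \<ge> 2 / 3 / 4 ^ Suc j"
proof -
  define i where "i = (LEAST i. halfspace_bit i x \<noteq> halfspace_bit i y)"
  have i: "halfspace_bit i x \<noteq> halfspace_bit i y" "i \<le> j"
    unfolding i_def
    using LeastI[of "\<lambda>i. halfspace_bit i x \<noteq> halfspace_bit i y", OF assms]
      Least_le[of "\<lambda>i. halfspace_bit i x \<noteq> halfspace_bit i y", OF assms] by blast+
  have lt: "halfspace_bit k x = halfspace_bit k y" if "k < i" for k
    using not_less_Least that unfolding i_def by blast
  define a where "a k = (halfspace_bit k x - halfspace_bit k y) / 4 ^ Suc k" for k
  have sa: "summable a"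
    unfolding a_def diff_divide_distrib by (rule summable_diff[OF summable_code summable_code])
  have code: "code x - code y = suminf a"
    unfolding a_def diff_divide_distrib code_def by (rule suminf_diff[OF summable_code summable_code])
  have "suminf a = (\<Sum>k. a (k + Suc i)) + sum a {..<Suc i}"
    by (rule suminf_split_initial_segment[OF sa])
  also have "sum a {..<Suc i} = a i" using lt by (simp add: a_def)
  finally have s: "suminf a = (\<Sum>k. a (k + Suc i)) + a i" .
  have le: "\<bar>a (k + Suc i)\<bar> \<le> 1 / 4 ^ Suc (k + Suc i)" for k
    using halfspace_bit_01[of "k + Suc i" x] halfspace_bit_01[of "k + Suc i" y]
    by (simp add: a_def divide_right_mono)
  have "\<bar>\<Sum>k. a (k + Suc i)\<bar> \<le> (\<Sum>k. 1 / 4 ^ Suc (k + Suc i))"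
    by (rule norm_suminf_le[OF le[folded real_norm_def] summable_quarter, unfolded real_norm_def])
  also have "\<dots> = (1 / 4 ^ Suc i) / 3" by (rule suminf_quarter)
  finally have t: "\<bar>\<Sum>k. a (k + Suc i)\<bar> \<le> (1 / 4 ^ Suc i) / 3" .
  have "\<bar>a i\<bar> = 1 / 4 ^ Suc i" using i(1) by (auto simp: a_def halfspace_bit_def split: if_splits)
  moreover have "\<bar>a i\<bar> \<le> \<bar>suminf a\<bar> + \<bar>\<Sum>k. a (k + Suc i)\<bar>" unfolding s by linarith
  ultimately have "1 / 4 ^ Suc i - (1 / 4 ^ Suc i) / 3 \<le> \<bar>suminf a\<bar>" using t by linarith
  also have "1 / 4 ^ Suc i - (1 / 4 ^ Suc i) / 3 = (2 / 3 / 4 ^ Suc i :: real)" by simp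
  finally have "2 / 3 / 4 ^ Suc i \<le> \<bar>code x - code y\<bar>" using code by simp
  moreover have "(2 / 3 / 4 ^ Suc j :: real) \<le> 2 / 3 / 4 ^ Suc i"
    using i(2) by (intro divide_left_mono power_increasing mult_pos_pos) auto
  ultimately show ?thesis by linarith
qed

lemma measurable_code: "code \<in> borel_measurable borel"
proof -
  have "halfspace_bit j \<in> borel_measurable borel" for j :: nat
    unfolding halfspace_bit_def below_def case_prod_unfold by measurable
  then show ?thesis unfolding code_def by measurable
qed

text \<open>Taking the closure makes the set Borel without any knowledge of the range of
  \<open>code\<close>; the separation of codes ensures that it contains no code with the opposite
  digit. The \<open>itself\<close> argument fixes the space, which the result type does not
  mention.\<close>

definition bit_set :: "'b::euclidean_space itself \<Rightarrow> nat \<Rightarrow> real set" where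
  "bit_set _ j = closure (code ` {x :: 'b. below x j})"

text \<open>A Borel left inverse of \<open>code\<close>: each coordinate is the infimum of the
  rational offsets whose half-space contains the point. The infimum is taken in the extended reals,
  since a number that is not a code may belong to no set \<open>bit_set\<close> or to unboundedly
  many.\<close>

definition decode :: "real \<Rightarrow> 'b::euclidean_space" where
  "decode y = (\<Sum>b\<in>Basis. real_of_ereal (INF j\<in>{j. fst (halfspace j) = b}.
     if y \<in> bit_set TYPE('b) j then ereal (snd (halfspace j :: 'b \<times> real)) else \<infinity>) *\<^sub>R b)"

lemma code_in_bit_set:
  fixes x :: "'b::euclidean_space"
  shows "code x \<in> bit_set TYPE('b) j \<longleftrightarrow> below x j"
proof
  assume "below x j"
  then show "code x \<in> bit_set TYPE('b) j"
    unfolding bit_set_def by (intro subsetD[OF closure_subset]) auto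
next
  assume "code x \<in> bit_set TYPE('b) j"
  moreover have "(2 / 3 / 4 ^ Suc j :: real) > 0" by simp
  ultimately obtain z where z: "z \<in> code ` {x :: 'b. below x j}"
    "dist z (code x) < 2 / 3 / 4 ^ Suc j"
    unfolding bit_set_def closure_approachable by blast
  then obtain y :: 'b where y: "below y j" "z = code y" by blast
  have "halfspace_bit j x = halfspace_bit j y"
  proof (rule ccontr)
    assume "halfspace_bit j x \<noteq> halfspace_bit j y"
    then have "halfspace_bit j y \<noteq> halfspace_bit j x" by simp
    from code_separates[OF this] show False using z(2) y(2) by (simp add: dist_real_def)
  qed
  then show "below x j"
    using y(1) by (auto simp: halfspace_bit_def split: if_splits)
qed

lemma measurable_decode: "decode \<in> borel_measurable borel"
proof -
  have c: "(\<lambda>y. if y \<in> bit_set TYPE('b) j then ereal (snd (halfspace j :: 'b::euclidean_space \<times> real)) else \<infinity>) \<in> borel_measurable borel" for j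
  proof -
    have "bit_set TYPE('b) j \<in> sets borel" by (simp add: bit_set_def borel_closed)
    then show ?thesis by measurable
  qed
  show ?thesis
    unfolding decode_def
    by (intro borel_measurable_sum borel_measurable_scaleR borel_measurable_const
        borel_measurable_real_of_ereal borel_measurable_INF c) auto
qed

lemma decode_code:
  fixes x :: "'b::euclidean_space"
  shows "decode (code x) = x"
proof -
  have "(INF j\<in>{j. fst (halfspace j) = b}. if code x \<in> bit_set TYPE('b) j
      then ereal (snd (halfspace j :: 'b \<times> real)) else \<infinity>) = ereal (x \<bullet> b)" (is "?I = _")
    if b: "b \<in> Basis" for b
  proof (rule antisym)
    show "ereal (x \<bullet> b) \<le> ?I"
      by (rule INF_greatest) (auto simp: code_in_bit_set below_def case_prod_unfold)
    show "?I \<le> ereal (x \<bullet> b)"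
    proof (rule dense_ge)
      fix w assume "ereal (x \<bullet> b) < w"
      then obtain z where z: "x \<bullet> b < z" "ereal z < w" using ereal_dense2 by force
      obtain q where q: "q \<in> \<rat>" "x \<bullet> b < q" "q < z" using Rats_dense_in_real[OF z(1)] by blast
      obtain j where j: "halfspace j = (b, q)" using halfspace_surj[OF b q(1)] .
      have "?I \<le> (if code x \<in> bit_set TYPE('b) j then ereal (snd (halfspace j :: 'b \<times> real)) else \<infinity>)"
        by (rule INF_lower) (simp add: j)
      also have "\<dots> = ereal q" using q by (simp add: code_in_bit_set below_def j)
      also have "\<dots> \<le> w" using q(3) z(2) by (meson ereal_less_eq(3) less_imp_le order_trans)
      finally show "?I \<le> w" .
    qed
  qed
  then have "decode (code x) = (\<Sum>b\<in>Basis. (x \<bullet> b) *\<^sub>R b)" unfolding decode_def by simp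
  then show ?thesis by (simp add: euclidean_representation)
qed

text \<open>The eventual upper bounds in the rationals form a Dedekind cut, whose infimum is the
  limit. Being bounded infinitely often suffices to exclude that the cut is empty or unbounded
  below.\<close>

lemma convergent_of_rational_cuts:
  fixes x :: "nat \<Rightarrow> real"
  assumes cut: "\<And>q. q \<in> \<rat> \<Longrightarrow> (\<forall>\<^sub>F n in sequentially. x n \<le> q) \<or> (\<forall>\<^sub>F n in sequentially. x n > q)"
    and B: "\<exists>\<^sub>F n in sequentially. \<bar>x n\<bar> \<le> B"
  shows "convergent x"
proof -
  define S where "S = {q \<in> \<rat>. \<forall>\<^sub>F n in sequentially. x n \<le> q}"
  obtain q0 where q0: "q0 \<in> \<rat>" "q0 > B" using Rats_dense_in_real[of B "B + 1"] by auto
  have "\<not> (\<forall>\<^sub>F n in sequentially. x n > q0)"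
    using B q0(2) by (auto simp: frequently_def elim!: contrapos_nn eventually_mono)
  then have q0S: "q0 \<in> S" using cut[OF q0(1)] q0(1) by (simp add: S_def)
  have lb: "- B \<le> q" if "q \<in> S" for q
  proof (rule ccontr)
    assume "\<not> - B \<le> q"
    moreover have "\<forall>\<^sub>F n in sequentially. x n \<le> q" using that by (simp add: S_def)
    ultimately have "\<forall>\<^sub>F n in sequentially. \<not> \<bar>x n\<bar> \<le> B" by (auto elim!: eventually_mono)
    then show False using B by (simp add: frequently_def)
  qed
  then have bdd: "bdd_below S" by (auto simp: bdd_below_def)
  have "x \<longlonglongrightarrow> Inf S"
  proof (rule order_tendstoI)
    fix a assume "a < Inf S"
    then obtain q where q: "q \<in> \<rat>" "a < q" "q < Inf S" using Rats_dense_in_real by blast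
    then have "q \<notin> S" using cInf_lower[OF _ bdd] by force
    then have "\<forall>\<^sub>F n in sequentially. x n > q" using cut[OF q(1)] q(1) by (simp add: S_def)
    then show "\<forall>\<^sub>F n in sequentially. a < x n" using q(2) by (auto elim!: eventually_mono)
  next
    fix a assume "Inf S < a"
    then obtain q where "q \<in> S" "q < a" using cInf_lessD[of S a] q0S by blast
    then show "\<forall>\<^sub>F n in sequentially. x n < a" by (auto simp: S_def elim!: eventually_mono)
  qed
  then show ?thesis by (rule convergentI)
qed

text \<open>Once codes are closer than the separation bound for digit \<open>j\<close>, that digit
  no longer changes; thus every rational cut of every coordinate is eventually decided.\<close>

lemma convergent_of_code:
  fixes x :: "nat \<Rightarrow> 'b::euclidean_space"
  assumes code: "convergent (\<lambda>n. code (x n))" and B: "\<exists>\<^sub>F n in sequentially. norm (x n) \<le> B"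
  shows "convergent x"
proof -
  have "convergent (\<lambda>n. x n \<bullet> b)" if b: "b \<in> Basis" for b
  proof (rule convergent_of_rational_cuts)
    show "\<exists>\<^sub>F n in sequentially. \<bar>x n \<bullet> b\<bar> \<le> B"
      using B by (rule frequently_elim1) (use Basis_le_norm[OF b] order_trans in blast)
    fix q :: real assume q: "q \<in> \<rat>"
    obtain j where j: "halfspace j = (b, q)" using halfspace_surj[OF b q] .
    have "Cauchy (\<lambda>n. code (x n))" using code by (rule convergent_Cauchy)
    moreover have "(2 / 3 / 4 ^ Suc j :: real) > 0" by simp
    ultimately obtain N where N: "\<And>m n. m \<ge> N \<Longrightarrow> n \<ge> N \<Longrightarrow> dist (code (x m)) (code (x n)) < 2 / 3 / 4 ^ Suc j"
      unfolding Cauchy_def by blast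
    have same: "halfspace_bit j (x n) = halfspace_bit j (x N)" if "n \<ge> N" for n
      using code_separates[of j "x n" "x N"] N[of n N] that by (auto simp: dist_real_def)
    have iff: "x n \<bullet> b \<le> q \<longleftrightarrow> x N \<bullet> b \<le> q" if "n \<ge> N" for n
      using same[OF that] by (auto simp: halfspace_bit_def below_def j split: if_splits)
    show "(\<forall>\<^sub>F n in sequentially. x n \<bullet> b \<le> q) \<or> (\<forall>\<^sub>F n in sequentially. x n \<bullet> b > q)"
    proof (cases "x N \<bullet> b \<le> q")
      case True
      then have "\<forall>\<^sub>F n in sequentially. x n \<bullet> b \<le> q"
        unfolding eventually_sequentially using iff by blast
      then show ?thesis ..
    next
      case False
      then have "\<forall>\<^sub>F n in sequentially. x n \<bullet> b > q"
        unfolding eventually_sequentially using iff by (metis not_le)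
      then show ?thesis ..
    qed
  qed
  then obtain l where l: "\<And>b. b \<in> Basis \<Longrightarrow> (\<lambda>n. x n \<bullet> b) \<longlonglongrightarrow> l b"
    unfolding convergent_def by metis
  have "(\<lambda>n. \<Sum>b\<in>Basis. (x n \<bullet> b) *\<^sub>R b) \<longlonglongrightarrow> (\<Sum>b\<in>Basis. l b *\<^sub>R b)"
    by (intro tendsto_intros l)
  then show ?thesis unfolding euclidean_representation convergent_def by blast
qed

text \<open>Codes lie between 0 and 1, so tightness of their laws is automatic and the
  one-dimensional theorems apply. Convergence of codes alone still allows a sequence of points to
  run off to infinity, and this is what the moment bound has to prevent.\<close>

theorem skorohod_compactness:
  fixes \<mu> :: "nat \<Rightarrow> 'b::euclidean_space measure"
  assumes prob: "\<And>n. \<mu> n \<in> borel_prob"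
    and moment: "\<And>n. (\<integral>\<^sup>+z. ennreal ((norm z)\<^sup>2) \<partial>\<mu> n) \<le> ennreal C"
  obtains r :: "nat \<Rightarrow> nat" and \<Omega> :: "real measure" and X Y
  where "strict_mono r" "prob_space \<Omega>"
    "\<And>n. X n \<in> borel_measurable \<Omega>" "Y \<in> borel_measurable \<Omega>"
    "\<And>n. distr \<Omega> borel (X n) = \<mu> (r n)"
    "AE \<omega> in \<Omega>. (\<lambda>n. X n \<omega>) \<longlonglongrightarrow> (Y \<omega> :: 'b)"
proof -
  have s: "sets (\<mu> n) = sets borel" and p: "prob_space (\<mu> n)" for n
    using prob[of n] by (auto simp: borel_prob_def)
  have m_code: "code \<in> borel_measurable (\<mu> n)" for n
    using measurable_code measurable_cong_sets[OF s refl] by blast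
  define G where "G n = distr (\<mu> n) borel code" for n
  have G: "real_distribution (G n)" for n
    unfolding G_def real_distribution_def real_distribution_axioms_def
    by (simp add: prob_space.prob_space_distr[OF p m_code])
  have "tight G"
    unfolding tight_def
  proof (intro conjI allI impI G)
    fix \<epsilon> :: real assume \<epsilon>: "\<epsilon> > 0"
    have "measure (G n) {-1<..1} = 1" for n
    proof -
      interpret prob_space "\<mu> n" by (rule p)
      have "code -` {-1<..1} \<inter> space (\<mu> n) = space (\<mu> n)"
      proof -
        have "- 1 < code x" for x :: 'b using code_bounds(1)[of x] by linarith
        then show ?thesis using code_bounds(2) by auto
      qed
      then show ?thesis unfolding G_def by (subst measure_distr[OF m_code]) (auto simp: prob_space)
    qed
    then show "\<exists>a b. a < b \<and> (\<forall>n. 1 - \<epsilon> < measure (G n) {a<..b})"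
      using \<epsilon> by (intro exI[of _ "-1"] exI[of _ 1]) auto
  qed
  from tight_imp_convergent_subsubsequence[OF this strict_mono_id]
  obtain r M where r: "strict_mono r" and M: "real_distribution M" and w: "weak_conv_m (G \<circ> id \<circ> r) M"
    by blast
  have w': "weak_conv_m (\<lambda>n. G (r n)) M" using w by (simp add: comp_def)
  from Skorohod[OF G M w'] obtain \<Omega> :: "real measure" and Yn :: "nat \<Rightarrow> real \<Rightarrow> real" and Y0 where \<Omega>: "prob_space \<Omega>"
    and Yn: "\<And>n. Yn n \<in> borel_measurable \<Omega>" "\<And>n. distr \<Omega> borel (Yn n) = G (r n)"
    and lim: "\<And>\<omega>. \<omega> \<in> space \<Omega> \<Longrightarrow> (\<lambda>n. Yn n \<omega>) \<longlonglongrightarrow> Y0 \<omega>"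
    by blast
  define X where "X n \<omega> = (decode (Yn n \<omega>) :: 'b)" for n \<omega>
  have mX: "X n \<in> borel_measurable \<Omega>" for n
    unfolding X_def using measurable_compose[OF Yn(1) measurable_decode] .
  have distrX: "distr \<Omega> borel (X n) = \<mu> (r n)" for n
  proof -
    have "X n = decode \<circ> Yn n" by (auto simp: X_def)
    then have "distr \<Omega> borel (X n) = distr (distr \<Omega> borel (Yn n)) borel decode"
      by (simp add: distr_distr[OF measurable_decode Yn(1)])
    also have "\<dots> = distr (\<mu> (r n)) borel (decode \<circ> code)"
      unfolding Yn(2) G_def by (rule distr_distr[OF measurable_decode m_code])
    also have "\<dots> = distr (\<mu> (r n)) borel (\<lambda>x. x)" by (simp add: comp_def decode_code)
    also have "\<dots> = \<mu> (r n)" by (rule distr_id2) (simp add: s)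
    finally show ?thesis .
  qed
  \<comment> \<open>The law of \<open>Yn n\<close> is carried by genuine codes, and on these
    \<open>decode\<close> is inverted by \<open>code\<close>.\<close>
  have inv: "AE \<omega> in \<Omega>. code (X n \<omega>) = Yn n \<omega>" for n
  proof -
    have meas: "{y \<in> space borel. code (decode y :: 'b) = y} \<in> sets (borel :: real measure)"
      using measurable_compose[OF measurable_decode measurable_code] by measurable
    have "AE y in G (r n). code (decode y :: 'b) = y"
      unfolding G_def by (subst AE_distr_iff[OF m_code meas]) (simp add: decode_code)
    then show ?thesis
      unfolding Yn(2)[symmetric] X_def by (subst (asm) AE_distr_iff[OF Yn(1) meas])
  qed
  \<comment> \<open>By Fatou's lemma the lower limit of the squared norms is almost surely finite,
    so infinitely many of the points lie in one ball.\<close>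
  have "(\<integral>\<^sup>+\<omega>. liminf (\<lambda>n. ennreal ((norm (X n \<omega>))\<^sup>2)) \<partial>\<Omega>) \<le> liminf (\<lambda>n. \<integral>\<^sup>+\<omega>. ennreal ((norm (X n \<omega>))\<^sup>2) \<partial>\<Omega>)"
    using mX by (intro nn_integral_liminf) measurable
  also have "(\<lambda>n. \<integral>\<^sup>+\<omega>. ennreal ((norm (X n \<omega>))\<^sup>2) \<partial>\<Omega>) = (\<lambda>n. \<integral>\<^sup>+z. ennreal ((norm z)\<^sup>2) \<partial>\<mu> (r n))"
    unfolding distrX[symmetric] by (subst nn_integral_distr[OF mX]) auto
  also have "liminf \<dots> \<le> ennreal C"
    using Liminf_mono[of "\<lambda>n. \<integral>\<^sup>+z. ennreal ((norm z)\<^sup>2) \<partial>\<mu> (r n)" "\<lambda>_. ennreal C" sequentially] moment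
    by (simp add: Liminf_const)
  finally have "(\<integral>\<^sup>+\<omega>. liminf (\<lambda>n. ennreal ((norm (X n \<omega>))\<^sup>2)) \<partial>\<Omega>) \<noteq> \<infinity>"
    by (auto simp: top_unique)
  then have fin: "AE \<omega> in \<Omega>. liminf (\<lambda>n. ennreal ((norm (X n \<omega>))\<^sup>2)) \<noteq> \<infinity>"
    using mX by (intro nn_integral_noteq_infinite) measurable
  have inv': "AE \<omega> in \<Omega>. \<forall>n. code (X n \<omega>) = Yn n \<omega>"
    using inv by (simp add: AE_all_countable)
  have conv: "AE \<omega> in \<Omega>. convergent (\<lambda>n. X n \<omega>)"
    using fin inv' AE_space[of \<Omega>]
  proof eventually_elim
    case (elim \<omega>)
    have "liminf (\<lambda>n. ennreal ((norm (X n \<omega>))\<^sup>2)) < top" using elim(1) by (simp add: top.not_eq_extremum)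
    then obtain c :: real where c: "c \<ge> 0" "liminf (\<lambda>n. ennreal ((norm (X n \<omega>))\<^sup>2)) < ennreal c"
      using ennreal_Ex_less_of_nat ennreal_of_nat_eq_real_of_nat of_nat_0_le_iff by metis
    have "\<exists>\<^sub>F n in sequentially. norm (X n \<omega>) \<le> sqrt c"
    proof (rule ccontr)
      assume "\<not> (\<exists>\<^sub>F n in sequentially. norm (X n \<omega>) \<le> sqrt c)"
      then have "\<forall>\<^sub>F n in sequentially. sqrt c < norm (X n \<omega>)"
        by (simp add: not_frequently not_le)
      then have "\<forall>\<^sub>F n in sequentially. ennreal c \<le> ennreal ((norm (X n \<omega>))\<^sup>2)"
        by eventually_elim (intro ennreal_leI sqrt_le_D less_imp_le)
      then have "ennreal c \<le> liminf (\<lambda>n. ennreal ((norm (X n \<omega>))\<^sup>2))" by (rule Liminf_bounded)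
      then show False using c(2) by simp
    qed
    moreover have "convergent (\<lambda>n. code (X n \<omega>))" using lim[OF elim(3)] elim(2) by (auto simp: convergent_def)
    ultimately show ?case by (rule convergent_of_code[rotated])
  qed
  \<comment> \<open>The limit variable is the limit of the decoded points, not the decoded limit
    \<open>Y0\<close>: if points approach a half-space from outside, the limit of their codes is not
    the code of their limit.\<close>
  have mY: "(\<lambda>\<omega>. lim (\<lambda>n. X n \<omega>)) \<in> borel_measurable \<Omega>"
    using mX by (rule borel_measurable_lim_metric)
  have AE: "AE \<omega> in \<Omega>. (\<lambda>n. X n \<omega>) \<longlonglongrightarrow> lim (\<lambda>n. X n \<omega>)"
    using conv by eventually_elim (simp add: convergent_LIMSEQ_iff)
  show ?thesis by (rule that[OF r \<Omega> mX mY distrX AE])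
qed

section \<open>Energy and moments along the flow\<close>

lemma mvt_subinterval:
  fixes m m' :: "real \<Rightarrow> real"
  assumes "a \<le> s" "s \<le> t" "t \<le> b"
    and m: "\<And>x. x \<in> {a..b} \<Longrightarrow> (m has_real_derivative m' x) (at x within {a..b})"
  shows "\<exists>x\<in>{s..t}. m t - m s = m' x * (t - s)"
proof (rule mvt_within[OF assms(2)])
  fix x assume "x \<in> {s..t}"
  then have "x \<in> {a..b}" using assms by auto
  from DERIV_subset[OF m[OF this]] show "(m has_real_derivative m' x) (at x within {s..t})"
    using assms by auto
qed

lemma weighted_primitive:
  fixes \<psi> :: "real \<Rightarrow> real"
  assumes "continuous_on {0..} \<psi>"
  obtains \<Theta> where "\<Theta> 0 = 0" "\<And>u. u \<ge> 0 \<Longrightarrow> (\<Theta> has_real_derivative \<psi> (sqrt u) / 2) (at u)"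
proof -
  define g where "g u = \<psi> (sqrt (max 0 u)) / 2" for u
  have g: "continuous_on S g" for S
    unfolding g_def by (intro continuous_intros continuous_on_compose2[OF assms]) auto
  \<comment> \<open>Starting the integral at -1 makes 0 an interior point, so that the derivative
    there is two-sided and the chain rule applies also when two particles coincide.\<close>
  define \<Theta> where "\<Theta> u = integral {-1..u} g - integral {-1..0} g" for u
  show ?thesis
  proof (rule that[of \<Theta>])
    show "\<Theta> 0 = 0" by (simp add: \<Theta>_def)
    fix u :: real assume u: "u \<ge> 0"
    have "((\<lambda>u. integral {-1..u} g) has_real_derivative g u) (at u within {-1..u + 1})"
      using u by (intro integral_has_real_derivative g) auto
    moreover have "at u within {-1..u + 1} = at u"
      using u by (intro at_within_interior) (auto simp: interior_atLeastAtMost_real)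
    ultimately have "(\<Theta> has_real_derivative g u) (at u)"
      unfolding \<Theta>_def by (auto intro!: derivative_eq_intros)
    then show "(\<Theta> has_real_derivative \<psi> (sqrt u) / 2) (at u)" using u by (simp add: g_def)
  qed
qed

text \<open>The particle system in the abstract: \<open>z\<close> labels a particle,
  \<open>R\<close> is its position and \<open>W\<close> its velocity relative to the mean. The
  equations are required only for labels in \<open>K\<close>, continuity for all labels, which is
  the form in which trajectories are obtained; \<open>T\<close> is fixed because each time interval
  has its own flow.\<close>

locale lagrangian = pair_prob M K PM for M :: "'b::euclidean_space measure" and K PM +
  fixes T :: real and R W \<alpha> :: "real \<Rightarrow> 'b \<Rightarrow> 'a::euclidean_space"
    and V :: "'a \<Rightarrow> real" and G :: "'a \<Rightarrow> 'a" and \<psi> :: "real \<Rightarrow> real" and m :: real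
  assumes T: "0 \<le> T"
    and cR: "continuous_on ({0..T} \<times> UNIV) (\<lambda>(t, z). R t z)"
    and cW: "continuous_on ({0..T} \<times> UNIV) (\<lambda>(t, z). W t z)"
    and c\<alpha>: "continuous_on ({0..T} \<times> UNIV) (\<lambda>(t, z). \<alpha> t z)"
    and R': "\<And>t z. t \<in> {0..T} \<Longrightarrow> z \<in> K \<Longrightarrow> ((\<lambda>s. R s z) has_vector_derivative W t z) (at t within {0..T})"
    and W': "\<And>t z. t \<in> {0..T} \<Longrightarrow> z \<in> K \<Longrightarrow> ((\<lambda>s. W s z) has_vector_derivative \<alpha> t z) (at t within {0..T})"
    and \<alpha>: "\<And>t z. t \<in> {0..T} \<Longrightarrow> z \<in> K \<Longrightarrow>
      \<alpha> t z = - (\<integral>z'. \<psi> (norm (R t z - R t z')) *\<^sub>R (W t z - W t z') + G (R t z - R t z') \<partial>M)"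
    and G_odd: "\<And>x. G (- x) = - G x" and G_cont: "continuous_on UNIV G"
    and V': "\<And>x. (V has_derivative (\<lambda>y. G x \<bullet> y)) (at x)"
    and \<psi>_cont: "continuous_on {0..} \<psi>" and m: "m > 0" and \<psi>_ge: "\<And>x. x \<ge> 0 \<Longrightarrow> \<psi> x \<ge> m"
    and R0: "(\<integral>z. R 0 z \<partial>M) = 0" and W0: "(\<integral>z. W 0 z \<partial>M) = 0"
begin

definition r :: "real \<Rightarrow> 'b \<times> 'b \<Rightarrow> 'a" where "r t p = R t (fst p) - R t (snd p)"
definition w :: "real \<Rightarrow> 'b \<times> 'b \<Rightarrow> 'a" where "w t p = W t (fst p) - W t (snd p)"

definition kinetic :: "real \<Rightarrow> real" where "kinetic t = (\<integral>z. (norm (W t z))\<^sup>2 \<partial>M)"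
definition energy :: "real \<Rightarrow> real" where "energy t = kinetic t / 2 + (\<integral>p. V (r t p) \<partial>PM) / 2"
definition inertia :: "real \<Rightarrow> real" where "inertia t = (\<integral>z. (norm (R t z))\<^sup>2 \<partial>M)"

lemma section_cont:
  assumes "t \<in> {0..T}"
  shows "continuous_on UNIV (R t)" "continuous_on UNIV (W t)" "continuous_on UNIV (\<alpha> t)"
  using continuous_on_section[OF cR assms] continuous_on_section[OF cW assms]
    continuous_on_section[OF c\<alpha> assms] by auto

lemma cont_r: "t \<in> {0..T} \<Longrightarrow> continuous_on UNIV (r t)"
  and cont_w: "t \<in> {0..T} \<Longrightarrow> continuous_on UNIV (w t)"
  unfolding r_def w_def by (intro continuous_intros c_fst c_snd section_cont; assumption)+

lemma joint_cont:
  fixes S :: "'b set"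
  shows "continuous_on ({0..T} \<times> S) (\<lambda>p. R (fst p) (snd p))"
    "continuous_on ({0..T} \<times> S) (\<lambda>p. W (fst p) (snd p))"
    "continuous_on ({0..T} \<times> S) (\<lambda>p. \<alpha> (fst p) (snd p))"
  using continuous_on_subset[OF cR, of "{0..T} \<times> S"] continuous_on_subset[OF cW, of "{0..T} \<times> S"]
    continuous_on_subset[OF c\<alpha>, of "{0..T} \<times> S"] by (auto simp: case_prod_unfold)

lemma joint_cont_r:
  fixes S :: "('b \<times> 'b) set"
  shows "continuous_on ({0..T} \<times> S) (\<lambda>p. r (fst p) (snd p))"
  unfolding r_def
  by (intro continuous_on_diff continuous_on_compose2[OF joint_cont(1)[of UNIV], of _ "\<lambda>p. (fst p, fst (snd p))", simplified]
      continuous_on_compose2[OF joint_cont(1)[of UNIV], of _ "\<lambda>p. (fst p, snd (snd p))", simplified] continuous_intros) auto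

lemma joint_cont_w:
  fixes S :: "('b \<times> 'b) set"
  shows "continuous_on ({0..T} \<times> S) (\<lambda>p. w (fst p) (snd p))"
  unfolding w_def
  by (intro continuous_on_diff continuous_on_compose2[OF joint_cont(2)[of UNIV], of _ "\<lambda>p. (fst p, fst (snd p))", simplified]
      continuous_on_compose2[OF joint_cont(2)[of UNIV], of _ "\<lambda>p. (fst p, snd (snd p))", simplified] continuous_intros) auto

lemma V_cont: "continuous_on UNIV V"
  using V' by (meson continuous_at_imp_continuous_on has_derivative_continuous)

lemma G_comp: "continuous_on S u \<Longrightarrow> continuous_on S (\<lambda>x. G (u x))"
  by (rule continuous_on_compose2[OF G_cont]) auto

lemma V_comp: "continuous_on S u \<Longrightarrow> continuous_on S (\<lambda>x. V (u x))"
  by (rule continuous_on_compose2[OF V_cont]) auto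

lemma \<psi>_comp: "continuous_on S u \<Longrightarrow> continuous_on S (\<lambda>x. \<psi> (norm (u x)))"
  by (rule continuous_on_compose2[OF \<psi>_cont]) (auto intro: continuous_intros)

definition pair_acc :: "real \<Rightarrow> 'b \<times> 'b \<Rightarrow> 'a" where
  "pair_acc t p = \<psi> (norm (r t p)) *\<^sub>R w t p + G (r t p)"

lemma cont_pair_acc: "t \<in> {0..T} \<Longrightarrow> continuous_on UNIV (pair_acc t)"
  unfolding pair_acc_def by (intro continuous_intros \<psi>_comp G_comp cont_r cont_w)

lemma pair_acc_odd: "pair_acc t (z', z) = - pair_acc t (z, z')"
proof -
  have "r t (z', z) = - r t (z, z')" "w t (z', z) = - w t (z, z')" by (auto simp: r_def w_def)
  then show ?thesis by (simp add: pair_acc_def G_odd)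
qed

text \<open>All balance laws are instances: a constant \<open>g\<close> gives conservation of
  momentum, the velocity gives the energy balance, and the position gives the virial
  identity.\<close>

lemma acceleration_test:
  assumes t: "t \<in> {0..T}" and g: "continuous_on UNIV g"
  shows "(\<integral>z. g z \<bullet> \<alpha> t z \<partial>M) = - (1 / 2) * (\<integral>p. pair_acc t p \<bullet> (g (fst p) - g (snd p)) \<partial>PM)"
proof -
  have c: "continuous_on UNIV (\<lambda>z. \<integral>z'. pair_acc t (z, z') \<partial>M)"
    by (rule continuous_integral) (simp add: cont_pair_acc[OF t])
  have "(\<integral>z. g z \<bullet> \<alpha> t z \<partial>M) = (\<integral>z. - (g z \<bullet> (\<integral>z'. pair_acc t (z, z') \<partial>M)) \<partial>M)"
    by (intro integral_cong_K continuous_intros g section_cont t c)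
      (simp add: \<alpha>[OF t] pair_acc_def r_def w_def)
  also have "\<dots> = - (1 / 2) * (\<integral>p. pair_acc t p \<bullet> (g (fst p) - g (snd p)) \<partial>PM)"
    using antisymmetric_integral[OF cont_pair_acc[OF t] pair_acc_odd g] by simp
  finally show ?thesis .
qed

lemma DERIV_inner_const:
  assumes "(u has_vector_derivative u') (at t within S)"
  shows "((\<lambda>s. u s \<bullet> c) has_real_derivative u' \<bullet> c) (at t within S)"
  using has_derivative_inner_left[OF assms[unfolded has_vector_derivative_def], of c]
  unfolding has_field_derivative_def by (rule has_derivative_eq_rhs) auto

lemma DERIV_inner:
  assumes "(u has_vector_derivative u') (at t within S)" "(v has_vector_derivative v') (at t within S)"
  shows "((\<lambda>s. u s \<bullet> v s) has_real_derivative u t \<bullet> v' + u' \<bullet> v t) (at t within S)"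
  using has_derivative_inner[OF assms[unfolded has_vector_derivative_def]]
  unfolding has_field_derivative_def by (rule has_derivative_eq_rhs) (auto simp: algebra_simps)

lemma DERIV_norm_sq:
  assumes "(u has_vector_derivative u') (at t within S)"
  shows "((\<lambda>s. (norm (u s))\<^sup>2) has_real_derivative 2 * (u t \<bullet> u')) (at t within S)"
  using DERIV_inner[OF assms assms] unfolding power2_norm_eq_inner
  by (rule DERIV_cong) (simp add: inner_commute)

lemma mean_W:
  assumes t: "t \<in> {0..T}"
  shows "(\<integral>z. W t z \<partial>M) = 0"
proof -
  \<comment> \<open>Differentiation under the integral is available for real integrands, hence the
    passage to components along \<open>c\<close>.\<close>
  have "(\<integral>z. W t z \<bullet> c \<partial>M) = (\<integral>z. W 0 z \<bullet> c \<partial>M)" for c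
  proof -
    have "((\<lambda>t. \<integral>z. W t z \<bullet> c \<partial>M) has_real_derivative 0) (at s within {0..T})" if s: "s \<in> {0..T}" for s
    proof -
      have "((\<lambda>t. \<integral>z. W t z \<bullet> c \<partial>M) has_real_derivative (\<integral>z. \<alpha> s z \<bullet> c \<partial>M)) (at s within {0..T})"
        by (rule has_derivative_integral[OF _ _ _ _ s])
          (auto intro!: continuous_intros section_cont joint_cont DERIV_inner_const W' s simp: case_prod_unfold)
      moreover have "(\<integral>z. \<alpha> s z \<bullet> c \<partial>M) = 0"
        using acceleration_test[OF s, of "\<lambda>_. c"] by (simp add: inner_commute)
      ultimately show ?thesis by simp
    qed
    then have "\<exists>x\<in>{0..t}. (\<integral>z. W t z \<bullet> c \<partial>M) - (\<integral>z. W 0 z \<bullet> c \<partial>M) = 0 * (t - 0)"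
      by (rule mvt_subinterval[rotated 3]) (use t in auto)
    then show ?thesis by simp
  qed
  moreover have "integrable M (W s)" if "s \<in> {0..T}" for s by (intro integrable_continuous section_cont that)
  ultimately have "(\<integral>z. W t z \<partial>M) \<bullet> c = (\<integral>z. W 0 z \<partial>M) \<bullet> c" for c
    using t T by (simp flip: integral_inner_left)
  then show ?thesis using W0 vector_eq_rdot by (metis inner_zero_left inner_eq_zero_iff)
qed

lemma mean_R:
  assumes t: "t \<in> {0..T}"
  shows "(\<integral>z. R t z \<partial>M) = 0"
proof -
  have "(\<integral>z. R t z \<bullet> c \<partial>M) = (\<integral>z. R 0 z \<bullet> c \<partial>M)" for c
  proof -
    have "((\<lambda>t. \<integral>z. R t z \<bullet> c \<partial>M) has_real_derivative 0) (at s within {0..T})" if s: "s \<in> {0..T}" for s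
    proof -
      have "((\<lambda>t. \<integral>z. R t z \<bullet> c \<partial>M) has_real_derivative (\<integral>z. W s z \<bullet> c \<partial>M)) (at s within {0..T})"
        by (rule has_derivative_integral[OF _ _ _ _ s])
          (auto intro!: continuous_intros section_cont joint_cont DERIV_inner_const R' s simp: case_prod_unfold)
      moreover have "integrable M (W s)" by (intro integrable_continuous section_cont s)
      then have "(\<integral>z. W s z \<bullet> c \<partial>M) = 0" using mean_W[OF s] by simp
      ultimately show ?thesis by simp
    qed
    then have "\<exists>x\<in>{0..t}. (\<integral>z. R t z \<bullet> c \<partial>M) - (\<integral>z. R 0 z \<bullet> c \<partial>M) = 0 * (t - 0)"
      by (rule mvt_subinterval[rotated 3]) (use t in auto)
    then show ?thesis by simp
  qed
  moreover have "integrable M (R s)" if "s \<in> {0..T}" for s by (intro integrable_continuous section_cont that)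
  ultimately have "(\<integral>z. R t z \<partial>M) \<bullet> c = (\<integral>z. R 0 z \<partial>M) \<bullet> c" for c
    using t T by (simp flip: integral_inner_left)
  then show ?thesis using R0 vector_eq_rdot by (metis inner_zero_left inner_eq_zero_iff)
qed

section \<open>Energy balance and the bound on the second moment\<close>

definition dissipation :: "real \<Rightarrow> real" where
  "dissipation t = (\<integral>p. \<psi> (norm (r t p)) * (norm (w t p))\<^sup>2 \<partial>PM)"

definition power :: "real \<Rightarrow> real" where "power t = (\<integral>p. G (r t p) \<bullet> w t p \<partial>PM)"
definition virial :: "real \<Rightarrow> real" where "virial t = (\<integral>p. G (r t p) \<bullet> r t p \<partial>PM)"

lemma kinetic_deriv:
  assumes t: "t \<in> {0..T}"
  shows "(kinetic has_real_derivative - dissipation t - power t) (at t within {0..T})"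
proof -
  have "((\<lambda>t. \<integral>z. (norm (W t z))\<^sup>2 \<partial>M) has_real_derivative (\<integral>z. 2 * (W t z \<bullet> \<alpha> t z) \<partial>M)) (at t within {0..T})"
    by (rule has_derivative_integral[OF _ _ _ _ t])
      (auto intro!: continuous_intros section_cont joint_cont DERIV_norm_sq W' t simp: case_prod_unfold)
  moreover have "(\<integral>z. 2 * (W t z \<bullet> \<alpha> t z) \<partial>M) = - (\<integral>p. pair_acc t p \<bullet> w t p \<partial>PM)"
    using acceleration_test[OF t section_cont(2)[OF t]] by (simp add: w_def)
  moreover have "(\<integral>p. pair_acc t p \<bullet> w t p \<partial>PM)
      = (\<integral>p. \<psi> (norm (r t p)) * (norm (w t p))\<^sup>2 + G (r t p) \<bullet> w t p \<partial>PM)"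
    by (simp add: pair_acc_def inner_add_left power2_norm_eq_inner)
  moreover have "\<dots> = dissipation t + power t"
    unfolding dissipation_def power_def
    by (intro Bochner_Integration.integral_add P.integrable_continuous continuous_intros \<psi>_comp G_comp cont_r cont_w t)
  ultimately show ?thesis unfolding kinetic_def by simp
qed

lemma r_deriv: "t \<in> {0..T} \<Longrightarrow> p \<in> K \<times> K \<Longrightarrow> ((\<lambda>s. r s p) has_vector_derivative w t p) (at t within {0..T})"
  unfolding r_def w_def by (intro has_vector_derivative_diff R') auto

lemma potential_deriv:
  assumes t: "t \<in> {0..T}"
  shows "((\<lambda>t. \<integral>p. V (r t p) \<partial>PM) has_real_derivative power t) (at t within {0..T})"
  unfolding power_def
proof (rule P.has_derivative_integral[OF _ _ _ _ t])
  fix s p assume s: "s \<in> {0..T}" and p: "p \<in> K \<times> K"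
  have "((\<lambda>s. V (r s p)) has_derivative (\<lambda>y. G (r s p) \<bullet> (y *\<^sub>R w s p))) (at s within {0..T})"
    by (rule has_derivative_compose[OF r_deriv[OF s p, unfolded has_vector_derivative_def] V'])
  then show "((\<lambda>s. V (r s p)) has_real_derivative G (r s p) \<bullet> w s p) (at s within {0..T})"
    unfolding has_field_derivative_def by (rule has_derivative_eq_rhs) auto
qed (auto intro!: continuous_intros V_comp G_comp cont_r cont_w joint_cont_r joint_cont_w t simp: case_prod_unfold)

lemma energy_deriv:
  assumes t: "t \<in> {0..T}"
  shows "(energy has_real_derivative - dissipation t / 2) (at t within {0..T})"
proof -
  have "((\<lambda>t. kinetic t / 2 + (\<integral>p. V (r t p) \<partial>PM) / 2) has_real_derivative
      (- dissipation t - power t) / 2 + power t / 2) (at t within {0..T})"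
    by (intro DERIV_add DERIV_cdivide kinetic_deriv potential_deriv t)
  moreover have "(- dissipation t - power t) / 2 + power t / 2 = - dissipation t / 2"
    by (simp add: field_simps)
  ultimately show ?thesis unfolding energy_def by simp
qed

text \<open>Friction acts on relative velocities only. It controls the full kinetic part because the
  mean of \<open>W\<close> vanishes, so that the pair average of squared differences is twice the
  mean square.\<close>

lemma dissipation_ge:
  assumes t: "t \<in> {0..T}"
  shows "dissipation t \<ge> 2 * m * kinetic t"
proof -
  have "2 * m * kinetic t = (\<integral>p. m * (norm (w t p))\<^sup>2 \<partial>PM)"
    using variance_pair[OF section_cont(2)[OF t] mean_W[OF t]] by (simp add: kinetic_def w_def)
  also have "\<dots> \<le> dissipation t"
    unfolding dissipation_def
    by (intro integral_mono P.integrable_continuous continuous_intros \<psi>_comp cont_r cont_w t mult_right_mono \<psi>_ge) auto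
  finally show ?thesis .
qed

lemma inertia_deriv:
  assumes t: "t \<in> {0..T}"
  shows "(inertia has_real_derivative 2 * (\<integral>z. R t z \<bullet> W t z \<partial>M)) (at t within {0..T})"
proof -
  have "((\<lambda>t. \<integral>z. (norm (R t z))\<^sup>2 \<partial>M) has_real_derivative (\<integral>z. 2 * (R t z \<bullet> W t z) \<partial>M)) (at t within {0..T})"
    by (rule has_derivative_integral[OF _ _ _ _ t])
      (auto intro!: continuous_intros section_cont joint_cont DERIV_norm_sq R' t simp: case_prod_unfold)
  then show ?thesis unfolding inertia_def by simp
qed

text \<open>The friction term in the derivative of \<open>\<integral> R \<bullet> W\<close> is itself the derivative of
  the average of \<open>\<Theta> (|R - R'|\<^sup>2)\<close>, where \<open>\<Theta>\<close> is a primitive of \<open>\<psi> (sqrt u) / 2\<close>.\<close>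

lemma moment_bound:
  assumes \<Psi>: "\<And>x. x \<ge> 0 \<Longrightarrow> \<psi> x \<le> \<Psi>" and Vm: "Vm \<le> 0" "\<And>x. Vm \<le> V x" and r0: "r0 \<ge> 0"
    and vir: "\<And>t. t \<in> {0..T} \<Longrightarrow> inertia t \<ge> r0\<^sup>2 \<Longrightarrow> virial t \<ge> 0"
  shows "inertia T \<le> 1 / m * (1 + 2 * sqrt 2 * sqrt (energy 0 - Vm)) * max r0 (sqrt (inertia 0))
    + \<Psi> / m * max (r0\<^sup>2) (inertia 0) + 2 / m\<^sup>2 * (energy 0 - Vm)"
proof -
  obtain \<Theta> where \<Theta>: "\<Theta> 0 = 0" "\<And>u. u \<ge> 0 \<Longrightarrow> (\<Theta> has_real_derivative \<psi> (sqrt u) / 2) (at u)"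
    using weighted_primitive[OF \<psi>_cont] by blast
  have c\<Theta>: "continuous_on {0..} \<Theta>"
    using \<Theta>(2) by (meson DERIV_isCont atLeast_iff continuous_at_imp_continuous_on)
  have \<Theta>_bounds: "m / 2 * u \<le> \<Theta> u" "\<Theta> u \<le> \<Psi> / 2 * u" if u: "u \<ge> 0" for u
  proof -
    have "\<exists>x\<in>{0..u}. \<Theta> u - \<Theta> 0 = \<psi> (sqrt x) / 2 * (u - 0)"
      using u \<Theta>(2) by (intro mvt_within) (auto intro: has_field_derivative_at_within)
    then obtain x where x: "x \<ge> 0" "\<Theta> u = \<psi> (sqrt x) / 2 * u" using \<Theta>(1) by auto
    show "m / 2 * u \<le> \<Theta> u" "\<Theta> u \<le> \<Psi> / 2 * u"
      unfolding x(2) using \<psi>_ge[of "sqrt x"] \<Psi>[of "sqrt x"] x(1) u by (auto intro!: mult_right_mono)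
  qed
  have \<Theta>_comp: "continuous_on S (\<lambda>x. \<Theta> ((norm (u x))\<^sup>2))" if "continuous_on S u" for S and u :: "'x::topological_space \<Rightarrow> 'a"
    by (rule continuous_on_compose2[OF c\<Theta>]) (auto intro!: continuous_intros that)
  define p where "p t = (\<integral>z. R t z \<bullet> W t z \<partial>M)" for t
  define Q where "Q t = (\<integral>p. \<Theta> ((norm (r t p))\<^sup>2) \<partial>PM) / 2" for t
  define fr where "fr t = (\<integral>p. \<psi> (norm (r t p)) * (r t p \<bullet> w t p) \<partial>PM)" for t
  have Q': "(Q has_real_derivative fr t / 2) (at t within {0..T})" if t: "t \<in> {0..T}" for t
    unfolding Q_def fr_def
  proof (intro DERIV_cdivide P.has_derivative_integral t)
    fix s p assume s: "s \<in> {0..T}" and p: "p \<in> K \<times> K"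
    have "((\<lambda>s. \<Theta> ((norm (r s p))\<^sup>2)) has_real_derivative \<psi> (sqrt ((norm (r s p))\<^sup>2)) / 2 * (2 * (r s p \<bullet> w s p))) (at s within {0..T})"
      by (rule DERIV_chain2[OF \<Theta>(2) DERIV_norm_sq[OF r_deriv[OF s p]]]) simp
    then show "((\<lambda>s. \<Theta> ((norm (r s p))\<^sup>2)) has_real_derivative \<psi> (norm (r s p)) * (r s p \<bullet> w s p)) (at s within {0..T})"
      by simp
  qed (auto intro!: continuous_intros \<Theta>_comp \<psi>_comp cont_r cont_w joint_cont_r joint_cont_w simp: case_prod_unfold)
  have p': "(p has_real_derivative kinetic t - fr t / 2 - virial t / 2) (at t within {0..T})" if t: "t \<in> {0..T}" for t
  proof -
    have c: "continuous_on UNIV (\<lambda>z. R t z \<bullet> \<alpha> t z)" "continuous_on UNIV (\<lambda>z. (norm (W t z))\<^sup>2)"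
      by (intro continuous_intros section_cont t)+
    have "(p has_real_derivative (\<integral>z. R t z \<bullet> \<alpha> t z + (norm (W t z))\<^sup>2 \<partial>M)) (at t within {0..T})"
      unfolding p_def power2_norm_eq_inner
      by (rule has_derivative_integral[OF _ _ _ _ t])
        (auto intro!: continuous_intros section_cont joint_cont DERIV_inner R' W' t simp: case_prod_unfold)
    moreover have "(\<integral>z. R t z \<bullet> \<alpha> t z + (norm (W t z))\<^sup>2 \<partial>M) = (\<integral>z. R t z \<bullet> \<alpha> t z \<partial>M) + kinetic t"
      unfolding kinetic_def by (intro Bochner_Integration.integral_add integrable_continuous c)
    moreover have "(\<integral>z. R t z \<bullet> \<alpha> t z \<partial>M) = - (1 / 2) * (\<integral>p. pair_acc t p \<bullet> r t p \<partial>PM)"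
      using acceleration_test[OF t section_cont(1)[OF t]] by (simp add: r_def)
    moreover have "(\<integral>p. pair_acc t p \<bullet> r t p \<partial>PM)
        = (\<integral>p. \<psi> (norm (r t p)) * (r t p \<bullet> w t p) + G (r t p) \<bullet> r t p \<partial>PM)"
      by (simp add: pair_acc_def inner_add_left inner_commute[of "w t p" for p])
    moreover have "\<dots> = fr t + virial t"
      unfolding fr_def virial_def
      by (intro Bochner_Integration.integral_add P.integrable_continuous continuous_intros \<psi>_comp G_comp cont_r cont_w t)
    ultimately have "(p has_real_derivative - (1 / 2) * (fr t + virial t) + kinetic t) (at t within {0..T})"
      by simp
    then show ?thesis by (rule DERIV_cong) (simp add: field_simps)
  qed
  \<comment> \<open>The friction term \<open>fr t / 2\<close> cancels, and with the weight
    \<open>1 / m\<close> the energy loss covers \<open>kinetic t\<close>; only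
    \<open>- virial t / 2\<close> is left over.\<close>
  have D': "((\<lambda>t. p t + Q t + energy t / m) has_real_derivative
      (kinetic t - fr t / 2 - virial t / 2) + fr t / 2 + (- dissipation t / 2) / m) (at t within {0..T})"
    if t: "t \<in> {0..T}" for t
    by (intro DERIV_add DERIV_cdivide p' Q' energy_deriv t)
  have m\<Psi>: "m \<le> \<Psi>" using \<psi>_ge[of 0] \<Psi>[of 0] by simp
  have kin0: "kinetic t \<ge> 0" for t by (simp add: kinetic_def)
  show ?thesis
  proof (rule moment_bound_real[OF T m m\<Psi> Vm(1) r0 _ D'])
    fix t assume t: "t \<in> {0..T}"
    show "(inertia has_real_derivative 2 * p t) (at t within {0..T})"
      unfolding p_def by (rule inertia_deriv[OF t])
    show "kinetic t - fr t / 2 - virial t / 2 + fr t / 2 + - dissipation t / 2 / m \<le> 0" if "r0\<^sup>2 \<le> inertia t"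
    proof -
      have "kinetic t \<le> dissipation t / 2 / m" using dissipation_ge[OF t] m by (simp add: field_simps)
      then show ?thesis using vir[OF t that] by simp
    qed
    show "energy t \<le> energy 0"
    proof -
      have "\<exists>x\<in>{0..t}. energy t - energy 0 = - dissipation x / 2 * (t - 0)"
        using t by (intro mvt_subinterval[OF _ _ _ energy_deriv]) auto
      then obtain x where x: "x \<in> {0..t}" "energy t - energy 0 = - dissipation x / 2 * t" by auto
      have "x \<in> {0..T}" using x t by auto
      then have "dissipation x \<ge> 0" using dissipation_ge[of x] kin0[of x] m by (meson mult_nonneg_nonneg less_imp_le order_trans zero_le_numeral)
      then have "dissipation x / 2 * t \<ge> 0" using t by simp
      then show ?thesis using x(2) by linarith
    qed
    have "(\<integral>p. Vm \<partial>PM) \<le> (\<integral>p. V (r t p) \<partial>PM)"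
      by (intro integral_mono P.integrable_continuous V_comp cont_r t) (auto simp: Vm)
    then show "kinetic t / 2 + Vm / 2 \<le> energy t" by (simp add: energy_def P.prob_space)
    show "0 \<le> kinetic t" "0 \<le> inertia t" by (auto simp: kinetic_def inertia_def)
    show "(p t)\<^sup>2 \<le> inertia t * kinetic t"
      unfolding p_def inertia_def kinetic_def by (rule cauchy_schwarz[OF section_cont(1,2)[OF t]])
    have iq: "(\<integral>p. (norm (r t p))\<^sup>2 \<partial>PM) = 2 * inertia t"
      using variance_pair[OF section_cont(1)[OF t] mean_R[OF t]] by (simp add: inertia_def r_def)
    have int: "integrable PM (\<lambda>p. \<Theta> ((norm (r t p))\<^sup>2))" "integrable PM (\<lambda>p. (norm (r t p))\<^sup>2)"
      by (intro P.integrable_continuous continuous_intros \<Theta>_comp cont_r t)+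
    have "(\<integral>p. m / 2 * (norm (r t p))\<^sup>2 \<partial>PM) \<le> (\<integral>p. \<Theta> ((norm (r t p))\<^sup>2) \<partial>PM)"
      using int by (intro integral_mono \<Theta>_bounds) auto
    then show "m / 2 * inertia t \<le> Q t" using iq by (simp add: Q_def)
    have "(\<integral>p. \<Theta> ((norm (r t p))\<^sup>2) \<partial>PM) \<le> (\<integral>p. \<Psi> / 2 * (norm (r t p))\<^sup>2 \<partial>PM)"
      using int by (intro integral_mono \<Theta>_bounds) auto
    then show "Q t \<le> \<Psi> / 2 * inertia t" using iq by (simp add: Q_def)
  qed
qed

text \<open>Stated through an intermediate time, as the mean value theorem gives it, the bound needs
  no integral of \<open>kinetic\<close> over time; this form suffices for the decay to 0.\<close>

lemma energy_decrease:
  assumes "0 \<le> s" "s \<le> t" "t \<le> T"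
  obtains x where "x \<in> {s..t}" "energy t \<le> energy s - m * kinetic x * (t - s)"
proof -
  have "\<exists>x\<in>{s..t}. energy t - energy s = - dissipation x / 2 * (t - s)"
    using assms by (intro mvt_subinterval[OF _ _ _ energy_deriv]) auto
  then obtain x where x: "x \<in> {s..t}" "energy t - energy s = - dissipation x / 2 * (t - s)" by blast
  have "m * kinetic x \<le> dissipation x / 2" using dissipation_ge[of x] x(1) assms by simp
  then have "m * kinetic x * (t - s) \<le> dissipation x / 2 * (t - s)" using assms by (intro mult_right_mono) auto
  then show ?thesis using that[OF x(1)] x(2) by linarith
qed

text \<open>The force can feed velocity at most linearly while friction consumes it quadratically:
  the maximum of CG w - m w^2 over w is CG^2 / (4 m).\<close>

lemma kinetic_growth:
  assumes CG: "\<And>x. norm (G x) \<le> CG" and st: "0 \<le> s" "s \<le> t" "t \<le> T"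
  shows "kinetic t - kinetic s \<le> CG\<^sup>2 / (4 * m) * (t - s)"
proof -
  have "\<exists>x\<in>{s..t}. kinetic t - kinetic s = (- dissipation x - power x) * (t - s)"
    using st by (intro mvt_subinterval[OF _ _ _ kinetic_deriv]) auto
  then obtain x where x: "x \<in> {s..t}" "kinetic t - kinetic s = (- dissipation x - power x) * (t - s)" by blast
  have xT: "x \<in> {0..T}" using x(1) st by auto
  have "- dissipation x - power x = (\<integral>p. - (\<psi> (norm (r x p)) * (norm (w x p))\<^sup>2) - G (r x p) \<bullet> w x p \<partial>PM)"
    unfolding dissipation_def power_def
    by (subst Bochner_Integration.integral_diff)
      (auto intro!: P.integrable_continuous continuous_intros \<psi>_comp G_comp cont_r cont_w xT)
  also have "\<dots> \<le> (\<integral>p. CG\<^sup>2 / (4 * m) \<partial>PM)"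
  proof (intro integral_mono P.integrable_continuous continuous_intros \<psi>_comp G_comp cont_r cont_w xT)
    fix p
    have 1: "m * (norm (w x p))\<^sup>2 \<le> \<psi> (norm (r x p)) * (norm (w x p))\<^sup>2"
      by (intro mult_right_mono \<psi>_ge) auto
    have "- (G (r x p) \<bullet> w x p) \<le> norm (G (r x p)) * norm (w x p)"
      using norm_cauchy_schwarz[of "- G (r x p)" "w x p"] by simp
    also have "\<dots> \<le> CG * norm (w x p)" by (intro mult_right_mono CG) simp
    finally have 2: "- (G (r x p) \<bullet> w x p) \<le> CG * norm (w x p)" .
    have "0 \<le> (2 * m * norm (w x p) - CG)\<^sup>2 / (4 * m)" using m by simp
    also have "\<dots> = m * (norm (w x p))\<^sup>2 - CG * norm (w x p) + CG\<^sup>2 / (4 * m)"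
      using m by (simp add: power2_diff power2_eq_square field_simps)
    finally show "- (\<psi> (norm (r x p)) * (norm (w x p))\<^sup>2) - G (r x p) \<bullet> w x p \<le> CG\<^sup>2 / (4 * m)"
      using 1 2 by linarith
  qed
  also have "\<dots> = CG\<^sup>2 / (4 * m)" by (simp add: P.prob_space)
  finally show ?thesis unfolding x(2) using st by (intro mult_right_mono) auto
qed

text \<open>When the velocities are small during a unit of time, so is the mean force: otherwise the
  force would act long enough in a fixed direction to produce velocity.\<close>

lemma mean_force_small:
  assumes CG: "\<And>x. norm (G x) \<le> CG" and \<Psi>: "\<And>x. x \<ge> 0 \<Longrightarrow> \<psi> x \<le> \<Psi>"
    and modulus: "\<And>x y. norm (G x - G y) \<le> \<eta> + c * (norm (x - y))\<^sup>2" and c: "c \<ge> 0"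
    and t0: "0 \<le> t0" "t0 + 1 \<le> T" and k: "k > 0"
    and kin: "\<And>t. t \<in> {t0..t0 + 1} \<Longrightarrow> kinetic t \<le> k\<^sup>2"
    and ine: "\<And>t. t \<in> {t0..t0 + 1} \<Longrightarrow> inertia t \<le> Cq"
  shows "(\<integral>z. (norm (\<integral>z'. G (R t0 z - R t0 z') \<partial>M))\<^sup>2 \<partial>M)
    \<le> 2 * CG * (1 + \<Psi>) * k + CG * (\<eta> + 4 * c * ((4 * Cq + 1) * k))"
proof -
  have CG0: "CG \<ge> 0" using CG norm_ge_zero order_trans by blast
  have \<Psi>0: "\<Psi> \<ge> 0" using \<Psi>[of 0] \<psi>_ge[of 0] m by linarith
  have I: "{t0..t0 + 1} \<subseteq> {0..T}" using t0 by auto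
  define A where "A t z = (\<integral>z'. G (r t (z, z')) \<partial>M)" for t z
  define Fr where "Fr t z = (\<integral>z'. \<psi> (norm (r t (z, z'))) *\<^sub>R w t (z, z') \<partial>M)" for t z
  have cA: "continuous_on UNIV (A t)" if "t \<in> {0..T}" for t
    unfolding A_def by (rule continuous_integral) (simp add: G_comp[OF cont_r[OF that]])
  have cFr: "continuous_on UNIV (Fr t)" if "t \<in> {0..T}" for t
    unfolding Fr_def
    by (rule continuous_integral) (simp add: continuous_on_scaleR[OF \<psi>_comp[OF cont_r[OF that]] cont_w[OF that]])
  have cz: "continuous_on UNIV (\<lambda>z'. u (z, z'))" if "continuous_on UNIV u" for u :: "'b \<times> 'b \<Rightarrow> 'x::topological_space" and z
    using continuous_on_compose2[OF that continuous_on_Pair_const[of UNIV z]] by simp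
  have A_le: "norm (A t z) \<le> CG" if "t \<in> {0..T}" for t z
    unfolding A_def using CG
    by (intro norm_integral_le integrable_continuous cz G_comp cont_r that)
  have \<alpha>_eq: "\<alpha> t z = - (Fr t z + A t z)" if t: "t \<in> {0..T}" and z: "z \<in> K" for t z
  proof -
    have "(\<integral>z'. \<psi> (norm (r t (z, z'))) *\<^sub>R w t (z, z') + G (r t (z, z')) \<partial>M) = Fr t z + A t z"
      unfolding Fr_def A_def
      by (intro Bochner_Integration.integral_add integrable_continuous continuous_on_scaleR
          cz[OF \<psi>_comp[OF cont_r[OF t]]] cz[OF cont_w[OF t]] cz[OF G_comp[OF cont_r[OF t]]])
    then show ?thesis using \<alpha>[OF t z] by (simp add: r_def w_def)
  qed
  \<comment> \<open>The mean force at \<open>t0\<close>, frozen as a direction of testing. Small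
    velocities keep \<open>J\<close> small, so the acceleration tested against \<open>B\<close> is
    small at some time \<open>x\<close>; it remains to return from \<open>x\<close> to
    \<open>t0\<close>.\<close>
  define B where "B = A t0"
  have t0T: "t0 \<in> {0..T}" using t0 by auto
  have cB: "continuous_on UNIV B" unfolding B_def by (rule cA[OF t0T])
  have B: "norm (B z) \<le> CG" for z unfolding B_def by (rule A_le[OF t0T])
  have W1: "(\<integral>z. norm (W t z) \<partial>M) \<le> k" if t: "t \<in> {t0..t0 + 1}" for t
    using kin[OF t] k I t by (intro integral_norm_le section_cont) (auto simp: kinetic_def)
  define J where "J t = (\<integral>z. W t z \<bullet> B z \<partial>M)" for t
  have J: "\<bar>J t\<bar> \<le> CG * k" if t: "t \<in> {t0..t0 + 1}" for t
  proof -
    have tT: "t \<in> {0..T}" using I t by blast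
    have i: "integrable M (\<lambda>z. W t z \<bullet> B z)" "integrable M (\<lambda>z. norm (W t z))"
      by (intro integrable_continuous continuous_intros section_cont cB tT)+
    have "norm (J t) \<le> (\<integral>z. norm (W t z \<bullet> B z) \<partial>M)" unfolding J_def by (rule integral_norm_bound)
    also have "\<dots> \<le> (\<integral>z. CG * norm (W t z) \<partial>M)"
    proof (rule integral_mono)
      show "integrable M (\<lambda>z. norm (W t z \<bullet> B z))" "integrable M (\<lambda>z. CG * norm (W t z))"
        using i by simp_all
      fix z
      have "norm (W t z \<bullet> B z) \<le> norm (W t z) * norm (B z)" using Cauchy_Schwarz_ineq2 by simp
      also have "\<dots> \<le> CG * norm (W t z)" using B[of z] by (simp add: mult.commute mult_right_mono)
      finally show "norm (W t z \<bullet> B z) \<le> CG * norm (W t z)" .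
    qed
    also have "\<dots> \<le> CG * k" using W1[OF t] CG0 by (simp add: mult_left_mono)
    finally show ?thesis by simp
  qed
  have "(J has_real_derivative (\<integral>z. \<alpha> t z \<bullet> B z \<partial>M)) (at t within {0..T})" if t: "t \<in> {0..T}" for t
    unfolding J_def
    by (rule has_derivative_integral[OF _ _ _ _ t])
      (auto intro!: continuous_intros section_cont joint_cont DERIV_inner_const W' t cB
        continuous_on_compose2[OF cB] simp: case_prod_unfold)
  then have "\<exists>x\<in>{t0..t0 + 1}. J (t0 + 1) - J t0 = (\<integral>z. \<alpha> x z \<bullet> B z \<partial>M) * (t0 + 1 - t0)"
    by (rule mvt_subinterval[rotated 3]) (use t0 in auto)
  then obtain x where x: "x \<in> {t0..t0 + 1}" and Jx: "J (t0 + 1) - J t0 = (\<integral>z. \<alpha> x z \<bullet> B z \<partial>M)" by auto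
  have xT: "x \<in> {0..T}" using I x by blast
  have cAB: "continuous_on UNIV (\<lambda>z. Fr x z \<bullet> B z)" "continuous_on UNIV (\<lambda>z. A x z \<bullet> B z)"
    by (intro continuous_intros cFr cA cB xT)+
  have "(\<integral>z. \<alpha> x z \<bullet> B z \<partial>M) = (\<integral>z. - (Fr x z \<bullet> B z + A x z \<bullet> B z) \<partial>M)"
    by (intro integral_cong_K continuous_intros section_cont xT cB cFr cA)
      (simp add: \<alpha>_eq[OF xT] inner_diff_left)
  also have "\<dots> = - (\<integral>z. Fr x z \<bullet> B z \<partial>M) - (\<integral>z. A x z \<bullet> B z \<partial>M)"
    using integrable_continuous[OF cAB(1)] integrable_continuous[OF cAB(2)] by simp
  finally have AB: "(\<integral>z. A x z \<bullet> B z \<partial>M) = J t0 - J (t0 + 1) - (\<integral>z. Fr x z \<bullet> B z \<partial>M)" using Jx by simp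
  have FrB: "\<bar>\<integral>z. Fr x z \<bullet> B z \<partial>M\<bar> \<le> 2 * CG * \<Psi> * k"
  proof -
    have cw: "continuous_on UNIV (\<lambda>p. norm (w x p))" "continuous_on UNIV (\<lambda>p. \<psi> (norm (r x p)) *\<^sub>R w x p)"
      by (intro continuous_intros \<psi>_comp cont_r cont_w xT)+
    have Fr_le: "norm (Fr x z) \<le> (\<integral>z'. \<Psi> * norm (w x (z, z')) \<partial>M)" for z
    proof -
      have "norm (Fr x z) \<le> (\<integral>z'. norm (\<psi> (norm (r x (z, z'))) *\<^sub>R w x (z, z')) \<partial>M)"
        unfolding Fr_def by (rule integral_norm_bound)
      also have "\<dots> \<le> (\<integral>z'. \<Psi> * norm (w x (z, z')) \<partial>M)"
      proof (intro integral_mono integrable_continuous continuous_on_norm continuous_on_mult_left cz cw cont_w xT)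
        fix z'
        have "\<bar>\<psi> (norm (r x (z, z')))\<bar> \<le> \<Psi>" using \<Psi>[of "norm (r x (z, z'))"] \<psi>_ge[of "norm (r x (z, z'))"] m by simp
        then show "norm (\<psi> (norm (r x (z, z'))) *\<^sub>R w x (z, z')) \<le> \<Psi> * norm (w x (z, z'))"
          by (simp add: mult_right_mono)
      qed
      finally show ?thesis .
    qed
    have "norm (\<integral>z. Fr x z \<bullet> B z \<partial>M) \<le> (\<integral>z. norm (Fr x z \<bullet> B z) \<partial>M)" by (rule integral_norm_bound)
    also have "\<dots> \<le> (\<integral>z. CG * (\<integral>z'. \<Psi> * norm (w x (z, z')) \<partial>M) \<partial>M)"
    proof (intro integral_mono integrable_norm integrable_continuous cAB)
      show "continuous_on UNIV (\<lambda>z. CG * (\<integral>z'. \<Psi> * norm (w x (z, z')) \<partial>M))"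
        by (intro continuous_on_mult_left continuous_integral) (simp add: case_prod_unfold continuous_on_mult_left cw)
      fix z
      have "norm (Fr x z \<bullet> B z) \<le> norm (Fr x z) * norm (B z)" using Cauchy_Schwarz_ineq2 by simp
      also have "\<dots> \<le> (\<integral>z'. \<Psi> * norm (w x (z, z')) \<partial>M) * CG"
        using Fr_le[of z] B[of z] by (intro mult_mono) (auto intro: order_trans[OF norm_ge_zero])
      finally show "norm (Fr x z \<bullet> B z) \<le> CG * (\<integral>z'. \<Psi> * norm (w x (z, z')) \<partial>M)" by (simp add: mult.commute)
    qed
    also have "\<dots> = CG * (\<Psi> * (\<integral>p. norm (w x p) \<partial>PM))"
      using fubini[OF cw(1)] by (simp add: PM_def)
    also have "(\<integral>p. norm (w x p) \<partial>PM) \<le> 2 * k"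
    proof -
      have cW': "continuous_on UNIV (\<lambda>z. norm (W x z))" by (intro continuous_intros section_cont xT)
      have i: "integrable PM (\<lambda>p. norm (W x (fst p)))" "integrable PM (\<lambda>p. norm (W x (snd p)))"
        by (intro P.integrable_continuous c_fst[OF cW'] c_snd[OF cW'])+
      have "(\<integral>p. norm (w x p) \<partial>PM) \<le> (\<integral>p. norm (W x (fst p)) + norm (W x (snd p)) \<partial>PM)"
        using i P.integrable_continuous[OF cw(1)] by (intro integral_mono) (auto simp: w_def norm_triangle_ineq4)
      also have "\<dots> \<le> 2 * k" using i W1[OF x] marginal[OF cW'] by simp
      finally show ?thesis .
    qed
    then have "CG * (\<Psi> * (\<integral>p. norm (w x p) \<partial>PM)) \<le> CG * (\<Psi> * (2 * k))"
      using CG0 \<Psi>0 by (intro mult_left_mono) auto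
    finally show ?thesis by (simp add: algebra_simps)
  qed
  \<comment> \<open>The mean square displacement since \<open>t0\<close>, which controls how far the
    forces at time \<open>x\<close> are from those at \<open>t0\<close>.\<close>
  define S where "S t = (\<integral>z. (norm (R t z - R t0 z))\<^sup>2 \<partial>M)" for t
  have cR0: "continuous_on UNIV (R t0)" by (rule section_cont[OF t0T])
  have jR0: "continuous_on ({0..T} \<times> K) (\<lambda>p. R t0 (snd p))"
    by (rule continuous_on_compose2[OF cR0]) (auto intro!: continuous_intros)
  have "(S has_real_derivative (\<integral>z. 2 * ((R t z - R t0 z) \<bullet> W t z) \<partial>M)) (at t within {0..T})" if t: "t \<in> {0..T}" for t
    unfolding S_def
  proof (rule has_derivative_integral[OF _ _ _ _ t])
    fix s z assume s: "s \<in> {0..T}" "z \<in> K"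
    have "((\<lambda>s. R s z - R t0 z) has_vector_derivative W s z) (at s within {0..T})"
      using has_vector_derivative_diff[OF R'[OF s] has_vector_derivative_const[of "R t0 z"]] by simp
    then show "((\<lambda>s. (norm (R s z - R t0 z))\<^sup>2) has_real_derivative 2 * ((R s z - R t0 z) \<bullet> W s z)) (at s within {0..T})"
      by (rule DERIV_norm_sq)
  qed (auto intro!: continuous_intros section_cont joint_cont jR0 t cR0 simp: case_prod_unfold)
  then have "\<exists>y\<in>{t0..x}. S x - S t0 = (\<integral>z. 2 * ((R y z - R t0 z) \<bullet> W y z) \<partial>M) * (x - t0)"
    by (rule mvt_subinterval[rotated 3]) (use x t0 in auto)
  then obtain y where y: "y \<in> {t0..x}" and Sx: "S x = (\<integral>z. 2 * ((R y z - R t0 z) \<bullet> W y z) \<partial>M) * (x - t0)"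
    by (auto simp: S_def)
  have yI: "y \<in> {t0..t0 + 1}" "y \<in> {0..T}" using y x I by auto
  have "(\<integral>z. 2 * ((R y z - R t0 z) \<bullet> W y z) \<partial>M) \<le> (4 * Cq + 1) * k"
  proof -
    have i: "integrable M (\<lambda>z. 2 * ((R y z - R t0 z) \<bullet> W y z))" "integrable M (\<lambda>z. (norm (R y z))\<^sup>2)"
      "integrable M (\<lambda>z. (norm (R t0 z))\<^sup>2)" "integrable M (\<lambda>z. (norm (W y z))\<^sup>2)"
      by (intro integrable_continuous continuous_intros section_cont yI cR0)+
    have "(\<integral>z. 2 * ((R y z - R t0 z) \<bullet> W y z) \<partial>M)
        \<le> (\<integral>z. 2 * k * (norm (R y z))\<^sup>2 + 2 * k * (norm (R t0 z))\<^sup>2 + (norm (W y z))\<^sup>2 / k \<partial>M)"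
    proof (rule integral_mono)
      fix z
      let ?d = "R y z - R t0 z"
      \<comment> \<open>The weight \<open>k\<close> is adapted to a mean square velocity of at most
        \<open>k\<^sup>2\<close>: both terms on the right are then of order
        \<open>k\<close>.\<close>
      have young: "2 * (d \<bullet> e) \<le> k * (norm d)\<^sup>2 + (norm e)\<^sup>2 / k" for d e :: 'a
      proof -
        have "0 \<le> (norm (k *\<^sub>R d - e))\<^sup>2" by simp
        also have "\<dots> = k * (k * (norm d)\<^sup>2) - k * (2 * (d \<bullet> e)) + (norm e)\<^sup>2"
          unfolding power2_norm_eq_inner by (simp add: inner_diff_left inner_diff_right inner_commute[of e d] right_diff_distrib)
        finally have "k * (2 * (d \<bullet> e)) \<le> k * (k * (norm d)\<^sup>2 + (norm e)\<^sup>2 / k)"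
          using k by (simp add: distrib_left)
        then show ?thesis using k by (simp only: mult_le_cancel_left_pos)
      qed
      have "2 * (?d \<bullet> W y z) \<le> k * (norm ?d)\<^sup>2 + (norm (W y z))\<^sup>2 / k" by (rule young)
      moreover have "0 \<le> (norm (R y z + R t0 z))\<^sup>2" by simp
      then have "(norm ?d)\<^sup>2 \<le> 2 * (norm (R y z))\<^sup>2 + 2 * (norm (R t0 z))\<^sup>2"
        by (simp add: power2_norm_eq_inner inner_diff_left inner_diff_right inner_add_left inner_add_right inner_commute)
      then have "k * (norm ?d)\<^sup>2 \<le> k * (2 * (norm (R y z))\<^sup>2 + 2 * (norm (R t0 z))\<^sup>2)"
        using k by (intro mult_left_mono) auto
      ultimately show "2 * (?d \<bullet> W y z) \<le> 2 * k * (norm (R y z))\<^sup>2 + 2 * k * (norm (R t0 z))\<^sup>2 + (norm (W y z))\<^sup>2 / k"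
        by (simp add: algebra_simps)
    qed (use i in auto)
    also have "\<dots> = 2 * k * inertia y + 2 * k * inertia t0 + kinetic y / k"
      using i by (simp add: inertia_def kinetic_def)
    also have "\<dots> \<le> 2 * k * Cq + 2 * k * Cq + k\<^sup>2 / k"
      using k ine[OF yI(1)] ine[of t0] kin[OF yI(1)]
      by (intro add_mono mult_left_mono divide_right_mono) auto
    also have "\<dots> = (4 * Cq + 1) * k" using k by (simp add: power2_eq_square algebra_simps)
    finally show ?thesis .
  qed
  moreover have "0 \<le> (4 * Cq + 1) * k"
  proof -
    have "0 \<le> inertia t0" by (simp add: inertia_def)
    then have "0 \<le> Cq" using ine[of t0] by simp
    then show ?thesis using k by simp
  qed
  ultimately have Sx': "S x \<le> (4 * Cq + 1) * k"
    unfolding Sx using x mult_mono[of "\<integral>z. 2 * ((R y z - R t0 z) \<bullet> W y z) \<partial>M" "(4 * Cq + 1) * k" "x - t0" 1]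
    by simp
  have BA: "(\<integral>z. norm (B z - A x z) \<partial>M) \<le> \<eta> + 4 * c * ((4 * Cq + 1) * k)"
  proof -
    define D where "D z = R t0 z - R x z" for z
    have cD: "continuous_on UNIV D" unfolding D_def by (intro continuous_intros section_cont xT t0T)
    have cDp: "continuous_on UNIV (\<lambda>p::'b \<times> 'b. \<eta> + c * (norm (D (fst p) - D (snd p)))\<^sup>2)"
      by (intro continuous_intros c_fst c_snd cD)
    have pt: "norm (B z - A x z) \<le> (\<integral>z'. \<eta> + c * (norm (D z - D z'))\<^sup>2 \<partial>M)" for z
    proof -
      have i: "integrable M (\<lambda>z'. G (r t0 (z, z')))" "integrable M (\<lambda>z'. G (r x (z, z')))"
        by (intro integrable_continuous cz G_comp cont_r t0T xT)+
      have "norm (B z - A x z) = norm (\<integral>z'. G (r t0 (z, z')) - G (r x (z, z')) \<partial>M)"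
        using i by (simp add: B_def A_def)
      also have "\<dots> \<le> (\<integral>z'. norm (G (r t0 (z, z')) - G (r x (z, z'))) \<partial>M)" by (rule integral_norm_bound)
      also have "\<dots> \<le> (\<integral>z'. \<eta> + c * (norm (D z - D z'))\<^sup>2 \<partial>M)"
      proof (rule integral_mono)
        show "integrable M (\<lambda>z'. \<eta> + c * (norm (D z - D z'))\<^sup>2)"
          by (intro integrable_continuous continuous_intros cD)
        fix z'
        have "r t0 (z, z') - r x (z, z') = D z - D z'" by (simp add: r_def D_def)
        then show "norm (G (r t0 (z, z')) - G (r x (z, z'))) \<le> \<eta> + c * (norm (D z - D z'))\<^sup>2"
          using modulus[of "r t0 (z, z')" "r x (z, z')"] by simp
      qed (use i in auto)
      finally show ?thesis .
    qed
    have "(\<integral>z. norm (B z - A x z) \<partial>M) \<le> (\<integral>z. (\<integral>z'. \<eta> + c * (norm (D z - D z'))\<^sup>2 \<partial>M) \<partial>M)"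
    proof (intro integral_mono integrable_continuous continuous_intros cB cA xT pt)
      show "continuous_on UNIV (\<lambda>z. \<integral>z'. \<eta> + c * (norm (D z - D z'))\<^sup>2 \<partial>M)"
        using cDp by (intro continuous_integral) (simp add: case_prod_unfold)
    qed
    also have "\<dots> = (\<integral>p. \<eta> + c * (norm (D (fst p) - D (snd p)))\<^sup>2 \<partial>PM)"
      using fubini[OF cDp] by (simp add: PM_def)
    also have "\<dots> = \<eta> + c * (\<integral>p. (norm (D (fst p) - D (snd p)))\<^sup>2 \<partial>PM)"
    proof -
      have "integrable PM (\<lambda>p. (norm (D (fst p) - D (snd p)))\<^sup>2)"
        by (intro P.integrable_continuous continuous_intros c_fst c_snd cD)
      then show ?thesis by (simp add: P.prob_space)
    qed
    also have "\<dots> \<le> \<eta> + c * (4 * S x)"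
      using pair_norm_sq_le[OF cD] c by (simp add: mult_left_mono S_def D_def norm_minus_commute)
    also have "\<dots> \<le> \<eta> + c * (4 * ((4 * Cq + 1) * k))" using Sx' c by (simp add: mult_left_mono)
    finally show ?thesis by (simp add: algebra_simps)
  qed
  have cBB: "continuous_on UNIV (\<lambda>z. (B z - A x z) \<bullet> B z)" "continuous_on UNIV (\<lambda>z. norm (B z - A x z))"
    by (intro continuous_intros cB cA xT)+
  \<comment> \<open>The force at \<open>x\<close> tested against \<open>B\<close> has been estimated
    through \<open>J\<close> and the friction, the remaining difference of forces through the
    displacement \<open>S x\<close>.\<close>
  have "(\<integral>z. (norm (B z))\<^sup>2 \<partial>M) = (\<integral>z. A x z \<bullet> B z + (B z - A x z) \<bullet> B z \<partial>M)"
    by (simp add: power2_norm_eq_inner inner_diff_left)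
  also have "\<dots> = (\<integral>z. A x z \<bullet> B z \<partial>M) + (\<integral>z. (B z - A x z) \<bullet> B z \<partial>M)"
    by (intro Bochner_Integration.integral_add integrable_continuous cAB cBB)
  also have "(\<integral>z. A x z \<bullet> B z \<partial>M) \<le> 2 * CG * (1 + \<Psi>) * k"
  proof -
    have "t0 \<in> {t0..t0 + 1}" "t0 + 1 \<in> {t0..t0 + 1}" by auto
    then show ?thesis using AB FrB J[of t0] J[of "t0 + 1"] by (simp add: algebra_simps)
  qed
  also have "(\<integral>z. (B z - A x z) \<bullet> B z \<partial>M) \<le> (\<integral>z. CG * norm (B z - A x z) \<partial>M)"
  proof (intro integral_mono integrable_continuous cBB continuous_on_mult_left)
    fix z
    have "(B z - A x z) \<bullet> B z \<le> norm (B z - A x z) * norm (B z)" by (rule norm_cauchy_schwarz)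
    also have "\<dots> \<le> CG * norm (B z - A x z)" using B[of z] by (simp add: mult.commute mult_right_mono)
    finally show "(B z - A x z) \<bullet> B z \<le> CG * norm (B z - A x z)" .
  qed
  also have "\<dots> \<le> CG * (\<eta> + 4 * c * ((4 * Cq + 1) * k))" using BA CG0 by (simp add: mult_left_mono)
  finally show ?thesis by (simp add: B_def A_def r_def)
qed

end

section \<open>Convergence to equilibrium\<close>

text \<open>If \<open>K t\<close> is at least \<open>e\<close>, the growth bound keeps
  \<open>K\<close> above \<open>e / 2\<close> during the preceding time span \<open>d\<close>, and
  this costs at least the energy \<open>g\<close>. Once \<open>H\<close> is within \<open>g\<close>
  of its infimum, that is impossible.\<close>

lemma tendsto_0_of_dissipation:
  fixes H K :: "real \<Rightarrow> real"
  assumes H: "\<And>s t. 0 \<le> s \<Longrightarrow> s \<le> t \<Longrightarrow> \<exists>x\<in>{s..t}. H t \<le> H s - m * K x * (t - s)"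
    and K: "\<And>s t. 0 \<le> s \<Longrightarrow> s \<le> t \<Longrightarrow> K t - K s \<le> c * (t - s)"
    and bdd: "\<And>t. 0 \<le> t \<Longrightarrow> h \<le> H t" and K0: "\<And>t. 0 \<le> t \<Longrightarrow> 0 \<le> K t" and m: "m > 0" and c: "c \<ge> 0"
  shows "(K \<longlongrightarrow> 0) at_top"
proof (rule tendstoI)
  fix e :: real assume e: "e > 0"
  \<comment> \<open>The added 1 makes the quotient meaningful for \<open>c = 0\<close>.\<close>
  define d where "d = e / (2 * (c + 1))"
  have d: "d > 0" "c * d \<le> e / 2"
    using e c by (auto simp: d_def field_simps)
  define g where "g = m * (e / 2) * d"
  have g: "g > 0" using m e d by (simp add: g_def)
  define h0 where "h0 = (INF t\<in>{0..}. H t)"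
  have b: "bdd_below (H ` {0..})" using bdd by (auto simp: bdd_below_def)
  have lower: "h0 \<le> H t" if "t \<ge> 0" for t unfolding h0_def using that by (intro cINF_lower b) simp
  obtain t1 where t1: "t1 \<ge> 0" "H t1 < h0 + g"
    using cINF_less_iff[OF _ b, of "h0 + g"] g unfolding h0_def by auto
  have mono: "H t \<le> H s" if st: "0 \<le> s" "s \<le> t" for s t
  proof -
    obtain x where x: "x \<in> {s..t}" "H t \<le> H s - m * K x * (t - s)" using H[OF st] by blast
    have "0 \<le> m * K x * (t - s)" using x(1) st K0[of x] m by (intro mult_nonneg_nonneg) auto
    then show ?thesis using x(2) by linarith
  qed
  have "K t < e" if t: "t \<ge> t1 + d" for t
  proof (rule ccontr)
    assume K_ge: "\<not> K t < e"
    have td: "0 \<le> t - d" "t - d \<le> t" using t t1 d by auto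
    obtain x where x: "x \<in> {t - d..t}" "H t \<le> H (t - d) - m * K x * (t - (t - d))" using H[OF td] by blast
    have "K t - K x \<le> c * (t - x)" using x(1) td by (intro K) auto
    also have "\<dots> \<le> c * d" using x(1) c by (intro mult_left_mono) auto
    finally have "K x \<ge> e / 2" using K_ge d(2) by linarith
    then have "g \<le> m * K x * d" unfolding g_def using m d by (intro mult_right_mono mult_left_mono) auto
    moreover have "H (t - d) \<le> H t1" using t t1 by (intro mono) auto
    ultimately have "H t < h0" using x(2) t1(2) by simp
    moreover have "h0 \<le> H t" using t t1 d by (intro lower) auto
    ultimately show False by simp
  qed
  then show "\<forall>\<^sub>F t in at_top. dist (K t) 0 < e"
    using t1 d K0 unfolding eventually_at_top_linorder by (intro exI[of _ "t1 + d"]) auto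
qed

text \<open>Close points are handled by uniform continuity, distant ones by boundedness, since 2 CG
  is at most \<open>c\<close> times the squared distance. A quadratic modulus is wanted because its
  average over pairs is a second moment.\<close>

lemma quadratic_modulus:
  fixes G :: "'a::real_normed_vector \<Rightarrow> 'c::real_normed_vector"
  assumes uc: "uniformly_continuous_on UNIV G" and CG: "\<And>x. norm (G x) \<le> CG" and \<eta>: "\<eta> > 0"
  obtains c where "c \<ge> 0" "\<And>x y. norm (G x - G y) \<le> \<eta> + c * (norm (x - y))\<^sup>2"
proof -
  obtain d where d: "d > 0" "\<And>x y. dist x y < d \<Longrightarrow> dist (G x) (G y) < \<eta>"
    using uc \<eta> unfolding uniformly_continuous_on_def by (metis UNIV_I)
  have CG0: "CG \<ge> 0" using CG norm_ge_zero order_trans by blast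
  define c where "c = 2 * CG / d\<^sup>2"
  have c: "c \<ge> 0" using CG0 by (simp add: c_def)
  have "norm (G x - G y) \<le> \<eta> + c * (norm (x - y))\<^sup>2" for x y
  proof (cases "norm (x - y) < d")
    case True
    then have "norm (G x - G y) \<le> \<eta>" using d(2)[of x y] by (simp add: dist_norm)
    moreover have "0 \<le> c * (norm (x - y))\<^sup>2" using c by simp
    ultimately show ?thesis by linarith
  next
    case False
    then have "d\<^sup>2 \<le> (norm (x - y))\<^sup>2" using d(1) by (intro power_mono) auto
    then have "c * d\<^sup>2 \<le> c * (norm (x - y))\<^sup>2" using c by (rule mult_left_mono)
    moreover have "c * d\<^sup>2 = 2 * CG" using d(1) by (simp add: c_def)
    moreover have "norm (G x - G y) \<le> 2 * CG" using norm_triangle_ineq4[of "G x" "G y"] CG[of x] CG[of y] by linarith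
    ultimately show ?thesis using \<eta> by linarith
  qed
  with c show ?thesis using that by blast
qed

text \<open>Above a level \<open>L\<close> the power is at most L^(p-2) times the square, whose
  integral is bounded; the factor is small for large \<open>L\<close> because \<open>p\<close> is
  below 2. Below \<open>L\<close>, dominated convergence applies.\<close>

lemma (in prob_space) powr_integral_tendsto_0:
  fixes D :: "nat \<Rightarrow> 'a \<Rightarrow> real"
  assumes D: "\<And>n. D n \<in> borel_measurable M" "\<And>n x. D n x \<ge> 0"
    and lim: "AE x in M. (\<lambda>n. D n x) \<longlonglongrightarrow> 0"
    and int: "\<And>n. integrable M (\<lambda>x. (D n x)\<^sup>2)" and C: "\<And>n. (\<integral>x. (D n x)\<^sup>2 \<partial>M) \<le> C"
    and p: "1 \<le> p" "p < 2"
  shows "(\<lambda>n. \<integral>x. D n x powr p \<partial>M) \<longlonglongrightarrow> 0"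
proof (rule tendstoI)
  fix e :: real assume e: "e > 0"
  have "0 \<le> (\<integral>x. (D 0 x)\<^sup>2 \<partial>M)" by simp
  then have C0: "C \<ge> 0" using C[of 0] by linarith
  have "((\<lambda>L. L powr (p - 2)) \<longlongrightarrow> 0) at_top"
    using p by (intro tendsto_neg_powr filterlim_ident) auto
  then have "\<forall>\<^sub>F L in at_top. L powr (p - 2) < e / 2 / (C + 1)"
    using e C0 by (intro order_tendstoD(2)) auto
  from eventually_happens'[OF trivial_limit_at_top_linorder eventually_conj[OF this eventually_gt_at_top[of 0]]]
  obtain L where L: "L > 0" "L powr (p - 2) < e / 2 / (C + 1)" by blast
  have CL: "C * L powr (p - 2) < e / 2"
  proof -
    have "C * L powr (p - 2) \<le> (C + 1) * L powr (p - 2)" by (intro mult_right_mono) auto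
    also have "\<dots> < e / 2"
      using L(2) C0 pos_less_divide_eq[of "C + 1" "L powr (p - 2)" "e / 2"] by (subst mult.commute) auto
    finally show ?thesis .
  qed
  define Tr where "Tr n x = (min (D n x) L) powr p" for n x
  have mTr: "Tr n \<in> borel_measurable M" for n unfolding Tr_def using D(1) by measurable
  have TrL: "norm (Tr n x) \<le> L powr p" for n x
    unfolding Tr_def using D(2) L p by (simp add: powr_mono2)
  have iTr: "integrable M (Tr n)" for n
    by (rule integrable_const_bound[OF _ mTr]) (use TrL in auto)
  have "(\<lambda>n. \<integral>x. Tr n x \<partial>M) \<longlonglongrightarrow> (\<integral>x. 0 \<partial>M)"
  proof (rule integral_dominated_convergence[where w="\<lambda>_. L powr p"])
    show "AE x in M. (\<lambda>n. Tr n x) \<longlonglongrightarrow> 0"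
      using lim
    proof eventually_elim
      case (elim x)
      have "(\<lambda>n. min (D n x) L) \<longlonglongrightarrow> min 0 L" by (intro tendsto_min elim tendsto_const)
      then have "(\<lambda>n. min (D n x) L) \<longlonglongrightarrow> 0" using L by simp
      then have "(\<lambda>n. (min (D n x) L) powr p) \<longlonglongrightarrow> 0 powr p"
        using p D(2) L by (intro tendsto_powr2) (auto intro: tendsto_const always_eventually)
      then show ?case using p by (simp add: Tr_def)
    qed
  qed (use mTr TrL in auto)
  then have "(\<lambda>n. \<integral>x. Tr n x \<partial>M) \<longlonglongrightarrow> 0" by simp
  then have "\<forall>\<^sub>F n in sequentially. (\<integral>x. Tr n x \<partial>M) < e / 2" using e by (intro order_tendstoD(2)) auto
  then show "\<forall>\<^sub>F n in sequentially. dist (\<integral>x. D n x powr p \<partial>M) 0 < e"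
  proof eventually_elim
    case (elim n)
    have le: "D n x powr p \<le> Tr n x + L powr (p - 2) * (D n x)\<^sup>2" for x
    proof (cases "D n x \<le> L")
      case True
      then show ?thesis using D(2) by (simp add: Tr_def)
    next
      case False
      then have "D n x powr p = D n x powr (p - 2) * D n x powr 2" by (simp add: powr_add[symmetric])
      also have "\<dots> = D n x powr (p - 2) * (D n x)\<^sup>2" using False L by simp
      also have "\<dots> \<le> L powr (p - 2) * (D n x)\<^sup>2"
        using False L p by (intro mult_right_mono powr_mono2') auto
      finally show ?thesis by (simp add: Tr_def add_increasing)
    qed
    have ii: "integrable M (\<lambda>x. Tr n x + L powr (p - 2) * (D n x)\<^sup>2)" using iTr int by simp
    have "integrable M (\<lambda>x. D n x powr p)"
    proof (rule Bochner_Integration.integrable_bound[OF ii])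
      show "(\<lambda>x. D n x powr p) \<in> borel_measurable M" using D(1) by measurable
      show "AE x in M. norm (D n x powr p) \<le> norm (Tr n x + L powr (p - 2) * (D n x)\<^sup>2)"
        by (rule AE_I2) (use le order_trans[OF _ abs_ge_self] in auto)
    qed
    then have "(\<integral>x. D n x powr p \<partial>M) \<le> (\<integral>x. Tr n x + L powr (p - 2) * (D n x)\<^sup>2 \<partial>M)"
      by (intro integral_mono ii le)
    also have "\<dots> = (\<integral>x. Tr n x \<partial>M) + L powr (p - 2) * (\<integral>x. (D n x)\<^sup>2 \<partial>M)"
      using iTr int by simp
    also have "\<dots> \<le> (\<integral>x. Tr n x \<partial>M) + L powr (p - 2) * C"
      using C by (intro add_left_mono mult_left_mono) auto
    also have "\<dots> < e" using elim CL by (simp add: mult.commute)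
    finally show ?case by (simp add: abs_of_nonneg integral_nonneg_AE)
  qed
qed

lemma pair_return:
  fixes g :: "'b::euclidean_space measure" and v :: "'c::euclidean_space"
  assumes g: "g \<in> borel_prob"
  shows "g \<Otimes>\<^sub>M return borel v = distr g borel (\<lambda>x. (x, v))"
proof -
  have s: "sets g = sets borel" using g by (simp add: borel_prob_def)
  interpret g: prob_space g using g by (simp add: borel_prob_def)
  interpret v: prob_space "return borel v" by (rule prob_space_return) simp
  have m: "(\<lambda>x. (x, v)) \<in> borel_measurable g"
    by (subst measurable_cong_sets[OF s refl]) (intro borel_measurable_continuous_onI continuous_intros)
  show ?thesis
  proof (rule pair_measure_eqI)
    show "sigma_finite_measure g" "sigma_finite_measure (return borel v)" by unfold_locales
    show "sets (g \<Otimes>\<^sub>M return borel v) = sets (distr g borel (\<lambda>x. (x, v)))"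
      using sets_pair_measure_cong[OF s sets_return[of borel v]] borel_prod by (metis sets_distr)
    fix A B assume A: "A \<in> sets g" and B: "B \<in> sets (return borel v)"
    have AB: "A \<times> B \<in> sets borel"
      using A B s by (metis borel_prod pair_measureI sets_return)
    have "emeasure (distr g borel (\<lambda>x. (x, v))) (A \<times> B) = emeasure g ((\<lambda>x. (x, v)) -` (A \<times> B) \<inter> space g)"
      by (rule emeasure_distr[OF m AB])
    also have "(\<lambda>x. (x, v)) -` (A \<times> B) \<inter> space g = (if v \<in> B then A else {})"
      using A sets.sets_into_space by auto
    finally show "emeasure g A * emeasure (return borel v) B = emeasure (distr g borel (\<lambda>x. (x, v))) (A \<times> B)"
      using B by (auto simp: indicator_def)
  qed
qed

text \<open>Continuity makes the zero set of the limiting mean force closed; a force vanishing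
  almost everywhere then vanishes on the whole support, as \<open>equilibria\<close>
  demands.\<close>

lemma continuous_convolution:
  fixes G :: "'b::euclidean_space \<Rightarrow> 'd::euclidean_space" and g :: "'b measure"
  assumes g: "g \<in> borel_prob" and G: "continuous_on UNIV G" "\<And>x. norm (G x) \<le> CG"
  shows "continuous_on UNIV (\<lambda>x. \<integral>y. G (x - y) \<partial>g)"
proof -
  have s: "sets g = sets borel" using g by (simp add: borel_prob_def)
  interpret g: prob_space g using g by (simp add: borel_prob_def)
  have m: "(\<lambda>y. G (x - y)) \<in> borel_measurable g" for x
    by (subst measurable_cong_sets[OF s refl])
      (intro borel_measurable_continuous_onI continuous_on_compose2[OF G(1)] continuous_intros, simp)
  show ?thesis
    unfolding continuous_on_sequentially
  proof (intro allI ballI impI, elim conjE)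
    fix x and u :: "nat \<Rightarrow> 'b" assume u: "u \<longlonglongrightarrow> x"
    have "(\<lambda>n. \<integral>y. G (u n - y) \<partial>g) \<longlonglongrightarrow> (\<integral>y. G (x - y) \<partial>g)"
    proof (rule integral_dominated_convergence[where w="\<lambda>_. CG"])
      show "AE y in g. (\<lambda>n. G (u n - y)) \<longlonglongrightarrow> G (x - y)"
      proof (rule AE_I2)
        fix y
        have "isCont G (x - y)" using G(1) by (simp add: continuous_on_eq_continuous_at)
        then show "(\<lambda>n. G (u n - y)) \<longlonglongrightarrow> G (x - y)"
          by (rule isCont_tendsto_compose) (intro tendsto_intros u)
      qed
    qed (use m G(2) in auto)
    then show "((\<lambda>x. \<integral>y. G (x - y) \<partial>g) \<circ> u) \<longlonglongrightarrow> (\<integral>y. G (x - y) \<partial>g)"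
      by (simp add: comp_def)
  qed
qed

section \<open>Moments and energy of the solution, and their Lagrangian form\<close>

locale mean_field_dissipative = mean_field_lipschitz +
  fixes m CG \<Psi> Vmin :: real
  assumes V_C1: "Ck_on 1 UNIV V" and V_ge: "\<And>x. Vmin \<le> V x"
    and gradV_odd: "\<And>x. grad V (- x) = - grad V x" and CG: "\<And>x. norm (grad V x) \<le> CG"
    and m: "m > 0" and \<psi>_ge: "\<And>x. x \<ge> 0 \<Longrightarrow> m \<le> \<psi> x" and \<psi>_le: "\<And>x. x \<ge> 0 \<Longrightarrow> \<psi> x \<le> \<Psi>"
    and centered: "(\<integral>z. fst z \<partial>f0) = 0"
begin

abbreviation vbar :: 'a where "vbar \<equiv> mean_velocity f0"

definition kinetic_at :: "real \<Rightarrow> real" where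
  "kinetic_at t = (\<integral>z. (norm (snd z - vbar))\<^sup>2 \<partial>(f t))"
definition inertia_at :: "real \<Rightarrow> real" where
  "inertia_at t = (\<integral>z. (norm (fst z))\<^sup>2 \<partial>(f t))"
definition energy_at :: "real \<Rightarrow> real" where
  "energy_at t = kinetic_at t / 2 + (\<integral>z. (\<integral>z'. V (fst z - fst z') \<partial>(f t)) \<partial>(f t)) / 2"
definition mean_force_at :: "real \<Rightarrow> real" where
  "mean_force_at t = (\<integral>z. (norm (\<integral>z'. grad V (fst z - fst z') \<partial>(f t)))\<^sup>2 \<partial>(f t))"

sublocale f0: compact_prob f0 "msupport f0"
  by (rule compact_prob_Pc[OF f0_Pc])

lemma gradV: "(V has_derivative (\<lambda>y. grad V x \<bullet> y)) (at x)"
proof -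
  obtain V' where "\<And>x. (V has_derivative (\<lambda>y. V' x \<bullet> y)) (at x)"
    using Ck_on_1_gradient[OF V_C1] by blast
  then show ?thesis using grad_eq[of V] by metis
qed

lemma V_cont: "continuous_on UNIV V"
  using gradV by (meson continuous_at_imp_continuous_on has_derivative_continuous)

text \<open>Subtracting \<open>vbar\<close> centres the velocities; positions need no shift, because
  the transport velocity in the equation is already relative to \<open>vbar\<close>.\<close>

lemma lagrangian_flow:
  assumes T: "T \<ge> 0"
  obtains R W \<alpha> where "lagrangian f0 (msupport f0) (f0 \<Otimes>\<^sub>M f0) T R W \<alpha> V (grad V) \<psi> m"
    "\<forall>t\<in>{0..T}. f t = distr f0 borel (\<lambda>z. (R t z, W t z + vbar))"
    "\<And>z. R 0 z = fst z" "\<And>z. W 0 z = snd z - vbar"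
proof -
  obtain \<Phi> where c: "continuous_on ({0..T} \<times> UNIV) (\<lambda>(t, z). \<Phi> t z)" and \<Phi>0: "\<And>z. \<Phi> 0 z = z"
    and push: "\<And>t. t \<in> {0..T} \<Longrightarrow> f t = distr f0 borel (\<Phi> t)"
    and ode: "\<And>t z. t \<in> {0..T} \<Longrightarrow> z \<in> msupport f0 \<Longrightarrow>
      ((\<lambda>s. \<Phi> s z) has_vector_derivative field t (\<Phi> t z)) (at t within {0..T})"
    using flow_representation[OF T] by blast
  define R where "R t z = fst (\<Phi> t z)" for t z
  define W where "W t z = snd (\<Phi> t z) - vbar" for t z
  define \<alpha> where "\<alpha> t z = - force t (\<Phi> t z)" for t z
  have c': "continuous_on ({0..T} \<times> UNIV) (\<lambda>p. \<Phi> (fst p) (snd p))" using c by (simp add: case_prod_unfold)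
  have ct: "continuous_on UNIV (\<Phi> t)" if "t \<in> {0..T}" for t by (rule continuous_on_section[OF c that])
  have "lagrangian f0 (msupport f0) (f0 \<Otimes>\<^sub>M f0) T R W \<alpha> V (grad V) \<psi> m"
  proof unfold_locales
    show "f0 \<Otimes>\<^sub>M f0 = f0 \<Otimes>\<^sub>M f0" ..
    show "0 \<le> T" by (rule T)
    show "continuous_on ({0..T} \<times> UNIV) (\<lambda>(t, z). R t z)" "continuous_on ({0..T} \<times> UNIV) (\<lambda>(t, z). W t z)"
      unfolding R_def W_def case_prod_unfold by (intro continuous_intros c')+
    have "continuous_on ({0..T} \<times> UNIV) (\<lambda>p. (\<lambda>(t, z). force t z) (fst p, \<Phi> (fst p) (snd p)))"
      by (rule continuous_on_compose2[OF continuous_force]) (auto intro!: continuous_intros c')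
    then show "continuous_on ({0..T} \<times> UNIV) (\<lambda>(t, z). \<alpha> t z)"
      unfolding \<alpha>_def by (auto simp: case_prod_unfold intro!: continuous_intros)
    fix t z assume t: "t \<in> {0..T}" and z: "z \<in> msupport f0"
    show "((\<lambda>s. R s z) has_vector_derivative W t z) (at t within {0..T})"
      using bounded_linear.has_vector_derivative[OF bounded_linear_fst ode[OF t z]]
      by (simp add: R_def W_def field_def)
    show "((\<lambda>s. W s z) has_vector_derivative \<alpha> t z) (at t within {0..T})"
      using has_vector_derivative_diff[OF bounded_linear.has_vector_derivative[OF bounded_linear_snd ode[OF t z]]
          has_vector_derivative_const[of vbar]]
      by (simp add: \<alpha>_def W_def field_def)
    show "\<alpha> t z = - (\<integral>z'. \<psi> (norm (R t z - R t z')) *\<^sub>R (W t z - W t z') + grad V (R t z - R t z') \<partial>f0)"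
    proof -
      have m1: "\<Phi> t \<in> borel_measurable f0"
        by (intro f0.measurable_M borel_measurable_continuous_onI ct t)
      have m2: "pair_force (\<Phi> t z) \<in> borel_measurable borel"
        using continuous_on_compose2[OF continuous_pair_force continuous_on_Pair_const[of UNIV "\<Phi> t z"]]
        by (intro borel_measurable_continuous_onI) simp
      have "force t (\<Phi> t z) = (\<integral>z'. pair_force (\<Phi> t z) (\<Phi> t z') \<partial>f0)"
        unfolding force_def push[OF t] by (rule integral_distr[OF m1 m2])
      also have "\<dots> = (\<integral>z'. \<psi> (norm (R t z - R t z')) *\<^sub>R (W t z - W t z') + grad V (R t z - R t z') \<partial>f0)"
        \<comment> \<open>Antisymmetry turns - grad V (r' - r) in \<open>pair_force\<close> into
          grad V (r - r').\<close>
        using gradV_odd[of "R t z - R t z'" for z']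
        by (intro Bochner_Integration.integral_cong) (auto simp: pair_force_def R_def W_def)
      finally show ?thesis by (simp add: \<alpha>_def)
    qed
  next
    show "(\<integral>z. R 0 z \<partial>f0) = 0" using centered by (simp add: R_def \<Phi>0)
    have "integrable f0 (\<lambda>z. snd z)" by (intro f0.integrable_continuous continuous_intros)
    then show "(\<integral>z. W 0 z \<partial>f0) = 0" by (simp add: W_def \<Phi>0 mean_velocity_def f0.prob_space)
  qed (auto simp: gradV_odd gradV_cont gradV \<psi>_cont m \<psi>_ge)
  moreover have "f t = distr f0 borel (\<lambda>z. (R t z, W t z + vbar))" if "t \<in> {0..T}" for t
    using push[OF that] by (simp add: R_def W_def)
  ultimately show ?thesis using that[of R W \<alpha>] by (simp add: R_def W_def \<Phi>0)
qed

text \<open>Each time horizon comes with its own \<open>R\<close> and \<open>W\<close>. The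
  quantities on the left are defined by \<open>f t\<close> alone, so estimates obtained on different
  horizons can be combined as time tends to infinity.\<close>

lemma lagrangian_quantities:
  assumes L: "lagrangian f0 (msupport f0) (f0 \<Otimes>\<^sub>M f0) T R W \<alpha> V (grad V) \<psi> m"
    and push: "\<forall>t\<in>{0..T}. f t = distr f0 borel (\<lambda>z. (R t z, W t z + vbar))"
    and t: "t \<in> {0..T}"
  shows "kinetic_at t = lagrangian.kinetic f0 W t" "inertia_at t = lagrangian.inertia f0 R t"
    and "energy_at t = lagrangian.energy f0 (f0 \<Otimes>\<^sub>M f0) R W V t"
    and "mean_force_at t = (\<integral>z. (norm (\<integral>z'. grad V (R t z - R t z') \<partial>f0))\<^sup>2 \<partial>f0)"
proof -
  interpret L: lagrangian f0 "msupport f0" "f0 \<Otimes>\<^sub>M f0" T R W \<alpha> V "grad V" \<psi> m by (rule L)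
  have t0: "t \<ge> 0" using t by simp
  interpret t: compact_prob "f t" "msupport (f t)" by (rule f_compact_prob[OF t0])
  have mm: "(\<lambda>z. (R t z, W t z + vbar)) \<in> borel_measurable f0"
    by (intro f0.measurable_M borel_measurable_continuous_onI continuous_intros L.section_cont t)
  have dist: "(\<integral>z. g z \<partial>(f t)) = (\<integral>z. g (R t z, W t z + vbar) \<partial>f0)"
    if "continuous_on UNIV g" for g :: "'a \<times> 'a \<Rightarrow> 'x::euclidean_space"
    unfolding bspec[OF push t] by (rule integral_distr[OF mm borel_measurable_continuous_onI[OF that]])
  show kin: "kinetic_at t = L.kinetic t"
    unfolding kinetic_at_def L.kinetic_def by (subst dist) (auto intro!: continuous_intros)
  show "inertia_at t = L.inertia t"
    unfolding inertia_at_def L.inertia_def by (subst dist) (auto intro!: continuous_intros)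
  have c1: "continuous_on UNIV (\<lambda>z::'a \<times> 'a. \<integral>z'. V (fst z - fst z') \<partial>(f t))"
    by (rule t.continuous_integral)
      (auto simp: case_prod_unfold intro!: continuous_intros continuous_on_compose2[OF V_cont])
  have c2: "continuous_on UNIV (\<lambda>z::'a \<times> 'a. \<integral>z'. grad V (fst z - fst z') \<partial>(f t))"
    by (rule t.continuous_integral)
      (auto simp: case_prod_unfold intro!: continuous_intros continuous_on_compose2[OF gradV_cont[of UNIV]])
  have i1: "(\<integral>z'. V (x - fst z') \<partial>(f t)) = (\<integral>z'. V (x - R t z') \<partial>f0)" for x
    by (subst dist) (auto intro!: continuous_intros continuous_on_compose2[OF V_cont])
  have i2: "(\<integral>z'. grad V (x - fst z') \<partial>(f t)) = (\<integral>z'. grad V (x - R t z') \<partial>f0)" for x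
    by (subst dist) (auto intro!: continuous_intros continuous_on_compose2[OF gradV_cont[of UNIV]])
  have "(\<integral>z. (\<integral>z'. V (fst z - fst z') \<partial>(f t)) \<partial>(f t)) = (\<integral>z. (\<integral>z'. V (R t z - R t z') \<partial>f0) \<partial>f0)"
    by (subst dist[OF c1]) (simp add: i1)
  also have "\<dots> = (\<integral>p. V (L.r t p) \<partial>(f0 \<Otimes>\<^sub>M f0))"
    using f0.fubini[OF L.V_comp[OF L.cont_r[OF t]]] by (simp add: L.r_def)
  finally show "energy_at t = L.energy t" by (simp add: energy_at_def L.energy_def kin)
  show "mean_force_at t = (\<integral>z. (norm (\<integral>z'. grad V (R t z - R t z') \<partial>f0))\<^sup>2 \<partial>f0)"
  proof -
    have "mean_force_at t = (\<integral>z. (norm (\<integral>z'. grad V (fst (R t z, W t z + vbar) - fst z') \<partial>(f t)))\<^sup>2 \<partial>f0)"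
      unfolding mean_force_at_def by (rule dist) (intro continuous_intros c2)
    then show ?thesis by (simp add: i2)
  qed
qed

text \<open>Equality of \<open>f 0\<close> and \<open>f0\<close> as measures is drawn from the flow
  on the degenerate interval \<open>{0..0}\<close>, where the flow map is the identity.\<close>

lemma energy_at_0: "energy_at 0 = hamiltonian V f0" and inertia_at_0: "inertia_at 0 = (\<integral>z. (norm (fst z))\<^sup>2 \<partial>f0)"
proof -
  have "f 0 = f0"
  proof -
    obtain R W \<alpha> where "lagrangian f0 (msupport f0) (f0 \<Otimes>\<^sub>M f0) 0 R W \<alpha> V (grad V) \<psi> m"
      "\<forall>t\<in>{0..0}. f t = distr f0 borel (\<lambda>z. (R t z, W t z + vbar))"
      "\<And>z. R 0 z = fst z" "\<And>z. W 0 z = snd z - vbar"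
      using lagrangian_flow[of 0] by blast
    then have "f 0 = distr f0 borel (\<lambda>z. z)" by simp
    also have "\<dots> = f0" by (rule distr_id2) (simp add: f0.sets_M)
    finally show ?thesis .
  qed
  then show "energy_at 0 = hamiltonian V f0" "inertia_at 0 = (\<integral>z. (norm (fst z))\<^sup>2 \<partial>f0)"
    by (simp_all add: energy_at_def kinetic_at_def hamiltonian_def inertia_at_def)
qed

text \<open>The lower bound \<open>Vm\<close> is separate from \<open>Vmin\<close>, so that a
  potential with positive \<open>Vmin\<close> can be treated with a nonpositive bound.\<close>

lemma moment_bound_at:
  assumes t: "t \<ge> 0" and Vm: "Vm \<le> 0" "Vm \<le> Vmin" and r0: "r0 \<ge> 0"
    and cond: "\<And>R::'a \<times> 'a \<Rightarrow> 'a. R \<in> borel_measurable f0 \<Longrightarrow> integrable f0 (\<lambda>z. (norm (R z))\<^sup>2) \<Longrightarrow>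
      (\<integral>z. R z \<partial>f0) = 0 \<Longrightarrow> sqrt (\<integral>z. (norm (R z))\<^sup>2 \<partial>f0) \<ge> r0 \<Longrightarrow>
      (\<integral>z. (\<integral>z'. grad V (R z - R z') \<bullet> (R z - R z') \<partial>f0) \<partial>f0) \<ge> 0"
  shows "inertia_at t \<le> 1 / m * (1 + 2 * sqrt 2 * sqrt (hamiltonian V f0 - Vm)) * max r0 (sqrt (inertia_at 0))
    + \<Psi> / m * max (r0\<^sup>2) (inertia_at 0) + 2 / m\<^sup>2 * (hamiltonian V f0 - Vm)"
proof -
  obtain R W \<alpha> where L: "lagrangian f0 (msupport f0) (f0 \<Otimes>\<^sub>M f0) t R W \<alpha> V (grad V) \<psi> m"
    and push: "\<forall>s\<in>{0..t}. f s = distr f0 borel (\<lambda>z. (R s z, W s z + vbar))"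
    by (rule lagrangian_flow[OF t]) (rule that)
  interpret L: lagrangian f0 "msupport f0" "f0 \<Otimes>\<^sub>M f0" t R W \<alpha> V "grad V" \<psi> m by (rule L)
  note q = lagrangian_quantities[OF L push]
  have t0: "0 \<in> {0..t}" "t \<in> {0..t}" using t by auto
  have "L.inertia t \<le> 1 / m * (1 + 2 * sqrt 2 * sqrt (L.energy 0 - Vm)) * max r0 (sqrt (L.inertia 0))
    + \<Psi> / m * max (r0\<^sup>2) (L.inertia 0) + 2 / m\<^sup>2 * (L.energy 0 - Vm)"
  proof (rule L.moment_bound[OF \<psi>_le Vm(1) _ r0])
    show "Vm \<le> V x" for x using Vm(2) V_ge[of x] by linarith
    fix s assume s: "s \<in> {0..t}" and ge: "r0\<^sup>2 \<le> L.inertia s"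
    have c: "continuous_on UNIV (\<lambda>p. grad V (L.r s p) \<bullet> L.r s p)"
      by (intro continuous_intros L.G_comp L.cont_r s)
    have "L.virial s = (\<integral>z. (\<integral>z'. grad V (R s z - R s z') \<bullet> (R s z - R s z') \<partial>f0) \<partial>f0)"
      using f0.fubini[OF c] by (simp add: L.virial_def L.r_def)
    also have "\<dots> \<ge> 0"
    \<comment> \<open>The hypothesis on \<open>f0\<close> is applied to the position at time
      \<open>s\<close> as a function of the initial point, a centred square-integrable map.\<close>
    proof (rule cond)
      show "R s \<in> borel_measurable f0"
        by (intro f0.measurable_M borel_measurable_continuous_onI L.section_cont s)
      show "integrable f0 (\<lambda>z. (norm (R s z))\<^sup>2)"
        by (intro f0.integrable_continuous continuous_intros L.section_cont s)
      show "(\<integral>z. R s z \<partial>f0) = 0" by (rule L.mean_R[OF s])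
      show "r0 \<le> sqrt (\<integral>z. (norm (R s z))\<^sup>2 \<partial>f0)"
        using ge r0 by (intro real_le_rsqrt) (simp add: L.inertia_def)
    qed
    finally show "0 \<le> L.virial s" .
  qed
  then show ?thesis using q(2)[OF t0(1)] q(2)[OF t0(2)] q(3)[OF t0(1)] energy_at_0 by simp
qed

lemma energy_decrease_at:
  assumes "0 \<le> s" "s \<le> t"
  shows "\<exists>x\<in>{s..t}. energy_at t \<le> energy_at s - m * kinetic_at x * (t - s)"
proof -
  have t: "0 \<le> t" using assms by simp
  obtain R W \<alpha> where L: "lagrangian f0 (msupport f0) (f0 \<Otimes>\<^sub>M f0) t R W \<alpha> V (grad V) \<psi> m"
    and push: "\<forall>s\<in>{0..t}. f s = distr f0 borel (\<lambda>z. (R s z, W s z + vbar))"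
    by (rule lagrangian_flow[OF t]) (rule that)
  interpret L: lagrangian f0 "msupport f0" "f0 \<Otimes>\<^sub>M f0" t R W \<alpha> V "grad V" \<psi> m by (rule L)
  note q = lagrangian_quantities[OF L push]
  obtain x where x: "x \<in> {s..t}" "L.energy t \<le> L.energy s - m * L.kinetic x * (t - s)"
    using L.energy_decrease[OF assms order_refl] by blast
  have "x \<in> {0..t}" "s \<in> {0..t}" "t \<in> {0..t}" using x(1) assms by auto
  then show ?thesis using x q by (intro bexI[of _ x]) auto
qed

lemma kinetic_growth_at:
  assumes "0 \<le> s" "s \<le> t"
  shows "kinetic_at t - kinetic_at s \<le> CG\<^sup>2 / (4 * m) * (t - s)"
proof -
  have t: "0 \<le> t" using assms by simp
  obtain R W \<alpha> where L: "lagrangian f0 (msupport f0) (f0 \<Otimes>\<^sub>M f0) t R W \<alpha> V (grad V) \<psi> m"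
    and push: "\<forall>s\<in>{0..t}. f s = distr f0 borel (\<lambda>z. (R s z, W s z + vbar))"
    by (rule lagrangian_flow[OF t]) (rule that)
  interpret L: lagrangian f0 "msupport f0" "f0 \<Otimes>\<^sub>M f0" t R W \<alpha> V "grad V" \<psi> m by (rule L)
  note q = lagrangian_quantities[OF L push]
  have "s \<in> {0..t}" "t \<in> {0..t}" using assms by auto
  then show ?thesis using L.kinetic_growth[OF CG assms order_refl] q by simp
qed

section \<open>Decay of velocities and forces, and limit points at large times\<close>

lemma kinetic_at_nonneg: "0 \<le> kinetic_at t"
  by (simp add: kinetic_at_def)

lemma energy_at_ge:
  assumes t: "t \<ge> 0"
  shows "kinetic_at t / 2 + Vmin / 2 \<le> energy_at t"
proof -
  interpret t: compact_prob "f t" "msupport (f t)" by (rule f_compact_prob[OF t])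
  have c1: "continuous_on UNIV (\<lambda>z::'a \<times> 'a. \<integral>z'. V (fst z - fst z') \<partial>(f t))"
    by (rule t.continuous_integral)
      (auto simp: case_prod_unfold intro!: continuous_intros continuous_on_compose2[OF V_cont])
  have c2: "continuous_on UNIV (\<lambda>z'::'a \<times> 'a. V (x - fst z'))" for x
    by (intro continuous_intros continuous_on_compose2[OF V_cont]) auto
  have "Vmin \<le> (\<integral>z'. V (x - fst z') \<partial>(f t))" for x
  proof -
    have "(\<integral>z'. Vmin \<partial>(f t)) \<le> (\<integral>z'. V (x - fst z') \<partial>(f t))"
      by (intro integral_mono t.integrable_continuous c2 V_ge) auto
    then show ?thesis by (simp add: t.prob_space)
  qed
  then have "(\<integral>z. Vmin \<partial>(f t)) \<le> (\<integral>z. (\<integral>z'. V (fst z - fst z') \<partial>(f t)) \<partial>(f t))"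
    by (intro integral_mono t.integrable_continuous c1) auto
  then show ?thesis by (simp add: energy_at_def t.prob_space)
qed

lemma kinetic_at_tendsto_0: "(kinetic_at \<longlongrightarrow> 0) at_top"
proof (rule tendsto_0_of_dissipation[OF energy_decrease_at kinetic_growth_at _ kinetic_at_nonneg m])
  show "Vmin / 2 \<le> energy_at t" if "0 \<le> t" for t
    using energy_at_ge[OF that] kinetic_at_nonneg[of t] by linarith
  show "0 \<le> CG\<^sup>2 / (4 * m)" using m by simp
qed

lemma mean_force_at_tendsto_0:
  assumes Cq: "\<And>t. t \<ge> 0 \<Longrightarrow> inertia_at t \<le> Cq"
  shows "(mean_force_at \<longlongrightarrow> 0) at_top"
proof (rule tendstoI)
  fix e :: real assume e: "e > 0"
  have CG0: "CG \<ge> 0" using CG norm_ge_zero order_trans by blast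
  have \<Psi>0: "\<Psi> \<ge> 0" using \<psi>_le[of 0] \<psi>_ge[of 0] m by linarith
  have "inertia_at 0 \<ge> 0" by (simp add: inertia_at_def)
  then have Cq0: "Cq \<ge> 0" using Cq[of 0] by simp
  define \<eta> where "\<eta> = e / (2 * (CG + 1))"
  have \<eta>: "\<eta> > 0" "CG * \<eta> \<le> e / 2" using e CG0 by (auto simp: \<eta>_def field_simps)
  obtain c where c: "c \<ge> 0" "\<And>x y. norm (grad V x - grad V y) \<le> \<eta> + c * (norm (x - y))\<^sup>2"
    using quadratic_modulus[OF gradV_uc CG \<eta>(1)] by blast
  define A where "A = 2 * CG * (1 + \<Psi>) + CG * (4 * c * (4 * Cq + 1))"
  have A0: "A \<ge> 0" unfolding A_def using CG0 \<Psi>0 c(1) Cq0 by simp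
  \<comment> \<open>\<open>c\<close>, and with it \<open>A\<close>, depends on
    \<open>\<eta>\<close>, so the velocity bound \<open>k\<close> has to be chosen last; the added 1
    covers \<open>A = 0\<close>.\<close>
  define k where "k = e / (4 * (A + 1))"
  have k: "k > 0" "A * k < e / 2"
  proof -
    show "k > 0" using e A0 by (simp add: k_def)
    have "A * k \<le> (A + 1) * k" using \<open>k > 0\<close> by (simp add: mult_right_mono)
    also have "\<dots> = e / 4" using A0 by (simp add: k_def divide_simps)
    finally show "A * k < e / 2" using e by simp
  qed
  have "\<forall>\<^sub>F t in at_top. kinetic_at t < k\<^sup>2"
    using kinetic_at_tendsto_0 k(1) by (intro order_tendstoD(2)) auto
  then obtain t1 where t1: "\<And>t. t \<ge> t1 \<Longrightarrow> kinetic_at t < k\<^sup>2" unfolding eventually_at_top_linorder by blast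
  have "mean_force_at t < e" if t: "t \<ge> max t1 0" for t
  proof -
    have T: "0 \<le> t + 1" "0 \<le> t" using t by auto
    obtain R W \<alpha> where L: "lagrangian f0 (msupport f0) (f0 \<Otimes>\<^sub>M f0) (t + 1) R W \<alpha> V (grad V) \<psi> m"
      and push: "\<forall>s\<in>{0..t + 1}. f s = distr f0 borel (\<lambda>z. (R s z, W s z + vbar))"
      by (rule lagrangian_flow[OF T(1)]) (rule that)
    interpret L: lagrangian f0 "msupport f0" "f0 \<Otimes>\<^sub>M f0" "t + 1" R W \<alpha> V "grad V" \<psi> m by (rule L)
    note q = lagrangian_quantities[OF L push]
    have "mean_force_at t = (\<integral>z. (norm (\<integral>z'. grad V (R t z - R t z') \<partial>f0))\<^sup>2 \<partial>f0)"
      using T by (intro q) auto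
    also have "\<dots> \<le> 2 * CG * (1 + \<Psi>) * k + CG * (\<eta> + 4 * c * ((4 * Cq + 1) * k))"
    proof (rule L.mean_force_small[OF CG \<psi>_le c(2) c(1) T(2) order_refl k(1)])
      fix s assume s: "s \<in> {t..t + 1}"
      then have s': "s \<in> {0..t + 1}" using T by auto
      show "L.kinetic s \<le> k\<^sup>2" using t1[of s] s t q(1)[OF s'] by simp
      show "L.inertia s \<le> Cq" using Cq[of s] s' q(2)[OF s'] by simp
    qed
    also have "\<dots> = A * k + CG * \<eta>" by (simp add: A_def algebra_simps)
    also have "\<dots> < e" using k(2) \<eta>(2) by linarith
    finally show ?thesis .
  qed
  moreover have "mean_force_at t \<ge> 0" for t by (simp add: mean_force_at_def)
  ultimately show "\<forall>\<^sub>F t in at_top. dist (mean_force_at t) 0 < e"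
    unfolding eventually_at_top_linorder by (intro exI[of _ "max t1 0"]) auto
qed

lemma wasserstein_le:
  assumes \<pi>: "\<pi> \<in> couplings \<mu> \<nu>"
  shows "wasserstein p \<mu> \<nu> \<le> (\<integral>z. norm (fst z - snd z) powr p \<partial>\<pi>) powr (1 / p)"
  unfolding wasserstein_def
  by (rule cINF_lower[OF _ \<pi>]) (auto simp: bdd_below_def intro!: exI[of _ 0])

text \<open>Extends the bound from positions to phase space: the energy never exceeds its initial
  value and the potential is bounded below, so the kinetic part is bounded, and \<open>vbar\<close>
  is fixed.\<close>

lemma second_moment_bound:
  assumes Cq: "\<And>t. t \<ge> 0 \<Longrightarrow> inertia_at t \<le> Cq"
  obtains C where "\<And>t. t \<ge> 0 \<Longrightarrow> (\<integral>z. (norm z)\<^sup>2 \<partial>(f t)) \<le> C"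
proof -
  have "(\<integral>z. (norm z)\<^sup>2 \<partial>(f t)) \<le> Cq + 2 * (2 * energy_at 0 - Vmin) + 2 * (norm vbar)\<^sup>2" if t: "t \<ge> 0" for t
  proof -
    interpret t: compact_prob "f t" "msupport (f t)" by (rule f_compact_prob[OF t])
    have i: "integrable (f t) (\<lambda>z. (norm z)\<^sup>2)" "integrable (f t) (\<lambda>z. (norm (fst z))\<^sup>2)"
      "integrable (f t) (\<lambda>z. (norm (snd z - vbar))\<^sup>2)"
      by (intro t.integrable_continuous continuous_intros)+
    have "(\<integral>z. (norm z)\<^sup>2 \<partial>(f t)) \<le> (\<integral>z. (norm (fst z))\<^sup>2 + 2 * (norm (snd z - vbar))\<^sup>2 + 2 * (norm vbar)\<^sup>2 \<partial>(f t))"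
    proof (rule integral_mono)
      fix z :: "'a \<times> 'a"
      have n: "(norm z)\<^sup>2 = (norm (fst z))\<^sup>2 + (norm (snd z))\<^sup>2" by (simp add: norm_prod_def)
      have "0 \<le> (norm ((snd z - vbar) - vbar))\<^sup>2" by simp
      moreover have "(norm (snd z))\<^sup>2 = (norm ((snd z - vbar) + vbar))\<^sup>2" by simp
      moreover have "(norm (a + b))\<^sup>2 + (norm (a - b))\<^sup>2 = 2 * (norm a)\<^sup>2 + 2 * (norm b)\<^sup>2" for a b :: 'a
        by (simp add: power2_norm_eq_inner inner_add_left inner_add_right inner_diff_left inner_diff_right inner_commute)
      from this[of "snd z - vbar" vbar] calculation
      have "(norm (snd z))\<^sup>2 \<le> 2 * (norm (snd z - vbar))\<^sup>2 + 2 * (norm vbar)\<^sup>2" by linarith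
      then show "(norm z)\<^sup>2 \<le> (norm (fst z))\<^sup>2 + 2 * (norm (snd z - vbar))\<^sup>2 + 2 * (norm vbar)\<^sup>2" using n by simp
    qed (use i in auto)
    also have "\<dots> = inertia_at t + 2 * kinetic_at t + 2 * (norm vbar)\<^sup>2"
      using i by (simp add: inertia_at_def kinetic_at_def t.prob_space)
    also have "kinetic_at t \<le> 2 * energy_at 0 - Vmin"
    proof -
      obtain x where "x \<in> {0..t}" "energy_at t \<le> energy_at 0 - m * kinetic_at x * (t - 0)"
        using energy_decrease_at[OF order_refl t] by blast
      moreover have "0 \<le> m * kinetic_at x * (t - 0)"
        using m t kinetic_at_nonneg by (intro mult_nonneg_nonneg) auto
      ultimately show ?thesis using energy_at_ge[OF t] by linarith
    qed
    finally show ?thesis using Cq[OF t] by linarith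
  qed
  then show ?thesis using that by blast
qed

theorem dist_equilibria_tendsto_0:
  assumes Cq: "\<And>t. t \<ge> 0 \<Longrightarrow> inertia_at t \<le> Cq" and p: "1 \<le> p" "p < 2"
  shows "((\<lambda>t. dist_Pp p (f t) (equilibria V vbar)) \<longlongrightarrow> 0) at_top"
proof (rule order_tendstoI)
  fix e :: ennreal assume e: "0 < e"
  show "\<forall>\<^sub>F t in at_top. dist_Pp p (f t) (equilibria V vbar) < e"
  proof (rule ccontr)
    assume neg: "\<not> ?thesis"
    \<comment> \<open>Along times at which the distance stays above \<open>e\<close>, it suffices to
      find a single index with smaller distance; a convergent subsequence provides it.\<close>
    then have "\<exists>t\<ge>real n. e \<le> dist_Pp p (f t) (equilibria V vbar)" for n
      unfolding eventually_at_top_linorder by (meson not_le)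
    then obtain \<tau> where \<tau>: "\<And>n. \<tau> n \<ge> real n" "\<And>n. e \<le> dist_Pp p (f (\<tau> n)) (equilibria V vbar)"
      by metis
    have \<tau>0: "\<tau> n \<ge> 0" for n using \<tau>(1)[of n] by linarith
    obtain C where C: "\<And>t. t \<ge> 0 \<Longrightarrow> (\<integral>z. (norm z)\<^sup>2 \<partial>(f t)) \<le> C" using second_moment_bound[OF Cq] by blast
    have int2: "integrable (f t) (\<lambda>z. (norm z)\<^sup>2)" if "t \<ge> 0" for t
      by (intro compact_prob.integrable_continuous[OF f_compact_prob[OF that]] continuous_intros)
    have mom: "(\<integral>\<^sup>+z. ennreal ((norm z)\<^sup>2) \<partial>(f (\<tau> n))) \<le> ennreal C" for n
      using C[OF \<tau>0[of n]] int2[OF \<tau>0[of n]] by (subst nn_integral_eq_integral) (auto intro: ennreal_leI)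
    have prob: "f (\<tau> n) \<in> borel_prob" for n using f_Pc[OF \<tau>0[of n]] by (simp add: Pc_def)
    obtain r :: "nat \<Rightarrow> nat" and \<Omega> :: "real measure" and X Y where r: "strict_mono r" and \<Omega>: "prob_space \<Omega>"
      and mX: "\<And>n. X n \<in> borel_measurable \<Omega>" and mY: "Y \<in> borel_measurable \<Omega>"
      and law: "\<And>n. distr \<Omega> borel (X n) = f (\<tau> (r n))"
      and lim: "AE \<omega> in \<Omega>. (\<lambda>n. X n \<omega>) \<longlonglongrightarrow> (Y \<omega> :: 'a \<times> 'a)"
      using skorohod_compactness[of "\<lambda>n. f (\<tau> n)", OF prob mom] by blast
    interpret \<Omega>: prob_space \<Omega> by (rule \<Omega>)
    have sub: "filterlim (\<lambda>n. \<tau> (r n)) at_top sequentially"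
    proof (rule filterlim_at_top_mono)
      show "filterlim (\<lambda>n. real n) at_top sequentially" by (rule filterlim_real_sequentially)
      show "\<forall>\<^sub>F n in sequentially. real n \<le> \<tau> (r n)"
      proof (intro always_eventually allI)
        fix n
        have "real n \<le> real (r n)" using seq_suble[OF r, of n] by simp
        then show "real n \<le> \<tau> (r n)" using \<tau>(1)[of "r n"] by linarith
      qed
    qed
    have law_int: "(\<integral>\<omega>. u (X n \<omega>) \<partial>\<Omega>) = (\<integral>z. u z \<partial>(f (\<tau> (r n))))" "integrable \<Omega> (\<lambda>\<omega>. u (X n \<omega>))"
      if "continuous_on UNIV u" for n and u :: "'a \<times> 'a \<Rightarrow> 'x::euclidean_space"
    proof -
      have mu: "u \<in> borel_measurable borel" by (rule borel_measurable_continuous_onI[OF that])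
      show "(\<integral>\<omega>. u (X n \<omega>) \<partial>\<Omega>) = (\<integral>z. u z \<partial>(f (\<tau> (r n))))"
        unfolding law[symmetric] by (rule integral_distr[OF mX mu, symmetric])
      have "integrable (f (\<tau> (r n))) u"
        by (rule compact_prob.integrable_continuous[OF f_compact_prob[OF \<tau>0] that])
      then show "integrable \<Omega> (\<lambda>\<omega>. u (X n \<omega>))"
        unfolding law[symmetric] by (simp add: integrable_distr_eq[OF mX mu])
    qed
    have CG0: "CG \<ge> 0" using CG norm_ge_zero order_trans by blast
    have iX: "integrable \<Omega> (\<lambda>\<omega>. (norm (X n \<omega>))\<^sup>2)" and EX: "(\<integral>\<omega>. (norm (X n \<omega>))\<^sup>2 \<partial>\<Omega>) \<le> C" for n
    proof -
      have c: "continuous_on UNIV (\<lambda>z::'a \<times> 'a. (norm z)\<^sup>2)" by (intro continuous_intros)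
      show "integrable \<Omega> (\<lambda>\<omega>. (norm (X n \<omega>))\<^sup>2)" by (rule law_int(2)[OF c])
      show "(\<integral>\<omega>. (norm (X n \<omega>))\<^sup>2 \<partial>\<Omega>) \<le> C" using law_int(1)[OF c, of n] C[OF \<tau>0[of "r n"]] by simp
    qed
    \<comment> \<open>Fatou's lemma hands the second moment bound on to \<open>Y\<close>. Both
      membership of the limit in \<open>Pp 2\<close> and the bound on the mean square of
      \<open>X n - Y\<close> rest on it.\<close>
    have "(\<integral>\<^sup>+\<omega>. ennreal ((norm (Y \<omega>))\<^sup>2) \<partial>\<Omega>) = (\<integral>\<^sup>+\<omega>. liminf (\<lambda>n. ennreal ((norm (X n \<omega>))\<^sup>2)) \<partial>\<Omega>)"
    proof (rule nn_integral_cong_AE)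
      show "AE \<omega> in \<Omega>. ennreal ((norm (Y \<omega>))\<^sup>2) = liminf (\<lambda>n. ennreal ((norm (X n \<omega>))\<^sup>2))"
        using lim
      proof eventually_elim
        case (elim \<omega>)
        have "(\<lambda>n. ennreal ((norm (X n \<omega>))\<^sup>2)) \<longlonglongrightarrow> ennreal ((norm (Y \<omega>))\<^sup>2)"
          by (intro tendsto_ennrealI tendsto_intros elim)
        then show ?case by (rule lim_imp_Liminf[OF sequentially_bot, symmetric])
      qed
    qed
    also have "\<dots> \<le> liminf (\<lambda>n. \<integral>\<^sup>+\<omega>. ennreal ((norm (X n \<omega>))\<^sup>2) \<partial>\<Omega>)"
      using mX by (intro nn_integral_liminf) measurable
    also have "\<dots> \<le> liminf (\<lambda>n::nat. ennreal C)"
      using EX iX by (intro Liminf_mono always_eventually allI)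
        (subst nn_integral_eq_integral, auto intro: ennreal_leI)
    finally have EY': "(\<integral>\<^sup>+\<omega>. ennreal ((norm (Y \<omega>))\<^sup>2) \<partial>\<Omega>) \<le> ennreal C" by (simp add: Liminf_const)
    have "0 \<le> (\<integral>\<omega>. (norm (X 0 \<omega>))\<^sup>2 \<partial>\<Omega>)" by simp
    then have C0: "C \<ge> 0" using EX[of 0] by linarith
    have iY: "integrable \<Omega> (\<lambda>\<omega>. (norm (Y \<omega>))\<^sup>2)"
      using mY EY' by (intro integrableI_bounded) (auto intro: le_less_trans)
    have EY: "(\<integral>\<omega>. (norm (Y \<omega>))\<^sup>2 \<partial>\<Omega>) \<le> C"
      using EY' iY C0 by (subst (asm) nn_integral_eq_integral) auto
    \<comment> \<open>Fatou's lemma for the kinetic part, which tends to 0 along the sequence, shows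
      that the limit velocity is almost surely \<open>vbar\<close>.\<close>
    have "(\<integral>\<^sup>+\<omega>. ennreal ((norm (snd (Y \<omega>) - vbar))\<^sup>2) \<partial>\<Omega>)
        = (\<integral>\<^sup>+\<omega>. liminf (\<lambda>n. ennreal ((norm (snd (X n \<omega>) - vbar))\<^sup>2)) \<partial>\<Omega>)"
    proof (rule nn_integral_cong_AE)
      show "AE \<omega> in \<Omega>. ennreal ((norm (snd (Y \<omega>) - vbar))\<^sup>2) = liminf (\<lambda>n. ennreal ((norm (snd (X n \<omega>) - vbar))\<^sup>2))"
        using lim
      proof eventually_elim
        case (elim \<omega>)
        have "(\<lambda>n. ennreal ((norm (snd (X n \<omega>) - vbar))\<^sup>2)) \<longlonglongrightarrow> ennreal ((norm (snd (Y \<omega>) - vbar))\<^sup>2)"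
          by (intro tendsto_ennrealI tendsto_intros elim)
        then show ?case by (rule lim_imp_Liminf[OF sequentially_bot, symmetric])
      qed
    qed
    also have "\<dots> \<le> liminf (\<lambda>n. \<integral>\<^sup>+\<omega>. ennreal ((norm (snd (X n \<omega>) - vbar))\<^sup>2) \<partial>\<Omega>)"
    proof (rule nn_integral_liminf)
      have "(\<lambda>z::'a \<times> 'a. ennreal ((norm (snd z - vbar))\<^sup>2)) \<in> borel_measurable borel"
        by (intro measurable_compose[OF _ measurable_ennreal] borel_measurable_continuous_onI continuous_intros)
      then show "(\<lambda>\<omega>. ennreal ((norm (snd (X n \<omega>) - vbar))\<^sup>2)) \<in> borel_measurable \<Omega>" for n
        using measurable_compose[OF mX] by blast
    qed
    also have "(\<lambda>n. \<integral>\<^sup>+\<omega>. ennreal ((norm (snd (X n \<omega>) - vbar))\<^sup>2) \<partial>\<Omega>) = (\<lambda>n. ennreal (kinetic_at (\<tau> (r n))))"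
    proof
      fix n
      have c: "continuous_on UNIV (\<lambda>z::'a \<times> 'a. (norm (snd z - vbar))\<^sup>2)" by (intro continuous_intros)
      show "(\<integral>\<^sup>+\<omega>. ennreal ((norm (snd (X n \<omega>) - vbar))\<^sup>2) \<partial>\<Omega>) = ennreal (kinetic_at (\<tau> (r n)))"
        using law_int[OF c, of n] by (subst nn_integral_eq_integral) (auto simp: kinetic_at_def)
    qed
    also have "liminf (\<lambda>n. ennreal (kinetic_at (\<tau> (r n)))) = ennreal 0"
      by (intro lim_imp_Liminf tendsto_ennrealI filterlim_compose[OF kinetic_at_tendsto_0 sub]) simp
    finally have "(\<integral>\<^sup>+\<omega>. ennreal ((norm (snd (Y \<omega>) - vbar))\<^sup>2) \<partial>\<Omega>) = 0" by simp
    moreover have mv: "(\<lambda>\<omega>. ennreal ((norm (snd (Y \<omega>) - vbar))\<^sup>2)) \<in> borel_measurable \<Omega>"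
    proof -
      have "(\<lambda>z::'a \<times> 'a. ennreal ((norm (snd z - vbar))\<^sup>2)) \<in> borel_measurable borel"
        by (intro measurable_compose[OF _ measurable_ennreal] borel_measurable_continuous_onI continuous_intros)
      then show ?thesis using measurable_compose[OF mY] by blast
    qed
    ultimately have "AE \<omega> in \<Omega>. ennreal ((norm (snd (Y \<omega>) - vbar))\<^sup>2) = 0"
      by (subst (asm) nn_integral_0_iff_AE) auto
    then have snd_Y: "AE \<omega> in \<Omega>. snd (Y \<omega>) = vbar" by eventually_elim simp
    define g where "g = distr \<Omega> borel (\<lambda>\<omega>. fst (Y \<omega>))"
    define \<nu> where "\<nu> = distr \<Omega> borel Y"
    have mfst: "fst \<in> borel_measurable (borel :: ('a \<times> 'a) measure)"
      by (intro borel_measurable_continuous_onI continuous_intros)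
    have mY1: "(\<lambda>\<omega>. fst (Y \<omega>)) \<in> borel_measurable \<Omega>" by (rule measurable_compose[OF mY mfst])
    have g: "g \<in> borel_prob" unfolding g_def borel_prob_def using \<Omega>.prob_space_distr[OF mY1] by simp
    have \<nu>: "\<nu> \<in> borel_prob" unfolding \<nu>_def borel_prob_def using \<Omega>.prob_space_distr[OF mY] by simp
    have mpair: "(\<lambda>x. (x, vbar)) \<in> borel_measurable (borel :: 'a measure)"
      by (intro borel_measurable_continuous_onI continuous_intros)
    have \<nu>_eq: "\<nu> = g \<Otimes>\<^sub>M return borel vbar"
    proof -
      have "g \<Otimes>\<^sub>M return borel vbar = distr \<Omega> borel (\<lambda>\<omega>. (fst (Y \<omega>), vbar))"
        unfolding pair_return[OF g] unfolding g_def using distr_distr[OF mpair mY1] by (simp add: comp_def)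
      also have "\<dots> = \<nu>"
        unfolding \<nu>_def
      proof (rule distr_cong_AE)
        show "AE \<omega> in \<Omega>. (fst (Y \<omega>), vbar) = Y \<omega>" using snd_Y by eventually_elim (simp add: prod_eq_iff)
        show "(\<lambda>\<omega>. (fst (Y \<omega>), vbar)) \<in> borel_measurable \<Omega>" by (rule measurable_compose[OF mY1 mpair])
      qed (use mY in auto)
      finally show ?thesis by simp
    qed
    define h where "h x = (\<integral>y. grad V (x - y) \<partial>g)" for x
    have ch: "continuous_on UNIV h" unfolding h_def by (rule continuous_convolution[OF g gradV_cont CG])
    define hn where "hn n x = (\<integral>z. grad V (x - fst z) \<partial>(f (\<tau> (r n))))" for n x
    have chn: "continuous_on UNIV (hn n)" for n
      unfolding hn_def
      by (rule compact_prob.continuous_integral[OF f_compact_prob[OF \<tau>0]])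
        (auto simp: case_prod_unfold intro!: continuous_intros continuous_on_compose2[OF gradV_cont[of UNIV]])
    have cG: "continuous_on UNIV (\<lambda>z::'a \<times> 'a. grad V (x - fst z))" for x
      by (intro continuous_intros continuous_on_compose2[OF gradV_cont[of UNIV]]) auto
    have cGy: "(\<lambda>y. grad V (x - y)) \<in> borel_measurable borel" for x
      by (intro borel_measurable_continuous_onI continuous_intros continuous_on_compose2[OF gradV_cont[of UNIV]]) auto
    have h_\<Omega>: "h x = (\<integral>\<omega>'. grad V (x - fst (Y \<omega>')) \<partial>\<Omega>)" for x
      unfolding h_def g_def by (rule integral_distr[OF mY1 cGy])
    have hn_\<Omega>: "hn n x = (\<integral>\<omega>'. grad V (x - fst (X n \<omega>')) \<partial>\<Omega>)" for n x
      unfolding hn_def by (rule law_int(1)[OF cG, symmetric])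
    have mGX: "(\<lambda>\<omega>'. grad V (x - fst (X n \<omega>'))) \<in> borel_measurable \<Omega>" for n x
      by (rule borel_measurable_integrable[OF law_int(2)[OF cG]])
    have mGY: "(\<lambda>\<omega>'. grad V (x - fst (Y \<omega>'))) \<in> borel_measurable \<Omega>" for x
      by (rule measurable_compose[OF mY1 cGy])
    have isG: "isCont (grad V) x" for x using gradV_cont[of UNIV] by (simp add: continuous_on_eq_continuous_at)
    \<comment> \<open>The argument of the mean force and the measure defining it vary together. With
      the measure represented by a second, independent sample point, both converge inside the
      bounded continuous function \<open>grad V\<close>.\<close>
    have inner: "AE \<omega> in \<Omega>. (\<lambda>n. hn n (fst (X n \<omega>))) \<longlonglongrightarrow> h (fst (Y \<omega>))"
      using lim
    proof eventually_elim
      case (elim \<omega>)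
      show ?case
        unfolding hn_\<Omega> h_\<Omega>
      proof (rule integral_dominated_convergence[where w="\<lambda>_. CG"])
        show "AE \<omega>' in \<Omega>. (\<lambda>n. grad V (fst (X n \<omega>) - fst (X n \<omega>'))) \<longlonglongrightarrow> grad V (fst (Y \<omega>) - fst (Y \<omega>'))"
          using lim
        proof eventually_elim
          case (elim \<omega>')
          show ?case
            by (rule isCont_tendsto_compose[OF isG]) (intro tendsto_intros elim \<open>(\<lambda>n. X n \<omega>) \<longlonglongrightarrow> Y \<omega>\<close>)
        qed
      qed (use mGX mGY CG in auto)
    qed
    have hn_le: "norm (hn n x) \<le> CG" for n x
      unfolding hn_def
      by (intro compact_prob.norm_integral_le[OF f_compact_prob[OF \<tau>0]] CG
          compact_prob.integrable_continuous[OF f_compact_prob[OF \<tau>0]] cG)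
    have mhX: "(\<lambda>\<omega>. (norm (hn n (fst (X n \<omega>))))\<^sup>2) \<in> borel_measurable \<Omega>" for n
      by (intro borel_measurable_integrable[OF law_int(2)] continuous_intros continuous_on_compose2[OF chn]) auto
    have mhY: "(\<lambda>\<omega>. (norm (h (fst (Y \<omega>))))\<^sup>2) \<in> borel_measurable \<Omega>"
      by (rule measurable_compose[OF mY1]) (intro borel_measurable_continuous_onI continuous_intros ch)
    have "(\<lambda>n. \<integral>\<omega>. (norm (hn n (fst (X n \<omega>))))\<^sup>2 \<partial>\<Omega>) \<longlonglongrightarrow> (\<integral>\<omega>. (norm (h (fst (Y \<omega>))))\<^sup>2 \<partial>\<Omega>)"
    proof (rule integral_dominated_convergence[where w="\<lambda>_. CG\<^sup>2"])
      show "AE \<omega> in \<Omega>. (\<lambda>n. (norm (hn n (fst (X n \<omega>))))\<^sup>2) \<longlonglongrightarrow> (norm (h (fst (Y \<omega>))))\<^sup>2"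
        using inner by eventually_elim (intro tendsto_intros)
      show "AE \<omega> in \<Omega>. norm ((norm (hn n (fst (X n \<omega>))))\<^sup>2) \<le> CG\<^sup>2" for n
        using hn_le by (auto intro!: power_mono)
    qed (use mhX mhY in auto)
    moreover have "(\<integral>\<omega>. (norm (hn n (fst (X n \<omega>))))\<^sup>2 \<partial>\<Omega>) = mean_force_at (\<tau> (r n))" for n
      unfolding mean_force_at_def hn_def[symmetric]
      by (rule law_int(1)) (intro continuous_intros continuous_on_compose2[OF chn], auto)
    moreover have "(\<lambda>n. mean_force_at (\<tau> (r n))) \<longlonglongrightarrow> 0"
      by (rule filterlim_compose[OF mean_force_at_tendsto_0[OF Cq] sub])
    ultimately have h0: "(\<integral>\<omega>. (norm (h (fst (Y \<omega>))))\<^sup>2 \<partial>\<Omega>) = 0" using LIMSEQ_unique by simp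
    have h_le: "norm (h x) \<le> CG" for x
    proof -
      have "norm (h x) \<le> (\<integral>\<omega>'. norm (grad V (x - fst (Y \<omega>'))) \<partial>\<Omega>)" unfolding h_\<Omega> by (rule integral_norm_bound)
      also have "\<dots> \<le> (\<integral>\<omega>'. CG \<partial>\<Omega>)"
      proof (rule integral_mono)
        show "integrable \<Omega> (\<lambda>\<omega>'. norm (grad V (x - fst (Y \<omega>'))))"
          by (intro integrable_norm \<Omega>.integrable_const_bound[where B=CG] mGY) (simp add: CG)
      qed (simp_all add: CG)
      finally show ?thesis by (simp add: \<Omega>.prob_space)
    qed
    have ih: "integrable \<Omega> (\<lambda>\<omega>. (norm (h (fst (Y \<omega>))))\<^sup>2)"
      using h_le by (intro \<Omega>.integrable_const_bound[where B="CG\<^sup>2"] mhY) (auto intro!: power_mono)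
    have "AE \<omega> in \<Omega>. (norm (h (fst (Y \<omega>))))\<^sup>2 = 0"
      using h0 integral_nonneg_eq_0_iff_AE[OF ih] by simp
    then have "AE \<omega> in \<Omega>. h (fst (Y \<omega>)) = 0" by eventually_elim simp
    then have AEg: "AE x in g. x \<in> {x. h x = 0}"
      unfolding g_def
      by (subst AE_distr_iff[OF mY1])
        (use borel_measurable_continuous_onI[OF ch] in \<open>auto intro!: borel_closed closed_Collect_eq ch\<close>)
    have clos: "closed {x. h x = 0}" by (intro closed_Collect_eq ch continuous_on_const)
    have supp: "msupport g \<subseteq> {x. h x = 0}"
      by (rule msupport_subset[OF clos AEg]) (simp add: g_def)
    have n2: "(\<lambda>x. norm x powr 2) = (\<lambda>x::'a \<times> 'a. (norm x)\<^sup>2)"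
      by (rule ext) (simp add: powr_numeral)
    have "integrable \<nu> (\<lambda>x. (norm x)\<^sup>2)"
      unfolding \<nu>_def using iY mY by (subst integrable_distr_eq) auto
    then have "\<nu> \<in> Pp 2" using \<nu> unfolding Pp_def n2 by simp
    then have eq: "\<nu> \<in> equilibria V vbar"
      unfolding equilibria_def using g \<nu>_eq supp by (auto simp: h_def)
    define D where "D n \<omega> = norm (X n \<omega> - Y \<omega>)" for n \<omega>
    have mD: "D n \<in> borel_measurable \<Omega>" for n unfolding D_def using mX mY by measurable
    have par: "(norm (a - b))\<^sup>2 \<le> 2 * (norm a)\<^sup>2 + 2 * (norm b)\<^sup>2" for a b :: "'a \<times> 'a"
    proof -
      have "0 \<le> (norm (a + b))\<^sup>2" by simp
      moreover have "(norm (a + b))\<^sup>2 + (norm (a - b))\<^sup>2 = 2 * (norm a)\<^sup>2 + 2 * (norm b)\<^sup>2"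
        by (simp add: power2_norm_eq_inner inner_add_left inner_add_right inner_diff_left inner_diff_right inner_commute)
      ultimately show ?thesis by linarith
    qed
    have iS: "integrable \<Omega> (\<lambda>\<omega>. 2 * (norm (X n \<omega>))\<^sup>2 + 2 * (norm (Y \<omega>))\<^sup>2)" for n using iX iY by simp
    have iD: "integrable \<Omega> (\<lambda>\<omega>. (D n \<omega>)\<^sup>2)" for n
    proof (rule Bochner_Integration.integrable_bound[OF iS[of n]])
      show "(\<lambda>\<omega>. (D n \<omega>)\<^sup>2) \<in> borel_measurable \<Omega>" using mD by measurable
      show "AE \<omega> in \<Omega>. norm ((D n \<omega>)\<^sup>2) \<le> norm (2 * (norm (X n \<omega>))\<^sup>2 + 2 * (norm (Y \<omega>))\<^sup>2)"
        by (rule AE_I2) (simp add: D_def par)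
    qed
    have D4: "(\<integral>\<omega>. (D n \<omega>)\<^sup>2 \<partial>\<Omega>) \<le> 4 * C" for n
    proof -
      have "(\<integral>\<omega>. (D n \<omega>)\<^sup>2 \<partial>\<Omega>) \<le> (\<integral>\<omega>. 2 * (norm (X n \<omega>))\<^sup>2 + 2 * (norm (Y \<omega>))\<^sup>2 \<partial>\<Omega>)"
        by (intro integral_mono iD iS) (simp add: D_def par)
      also have "\<dots> = 2 * (\<integral>\<omega>. (norm (X n \<omega>))\<^sup>2 \<partial>\<Omega>) + 2 * (\<integral>\<omega>. (norm (Y \<omega>))\<^sup>2 \<partial>\<Omega>)"
        using iX iY by simp
      finally show ?thesis using EX[of n] EY by linarith
    qed
    have "(\<lambda>n. \<integral>\<omega>. D n \<omega> powr p \<partial>\<Omega>) \<longlonglongrightarrow> 0"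
    proof (rule \<Omega>.powr_integral_tendsto_0[OF mD _ _ iD D4 p])
      show "0 \<le> D n \<omega>" for n \<omega> by (simp add: D_def)
      show "AE \<omega> in \<Omega>. (\<lambda>n. D n \<omega>) \<longlonglongrightarrow> 0"
        using lim
      proof eventually_elim
        case (elim \<omega>)
        have "(\<lambda>n. norm (X n \<omega> - Y \<omega>)) \<longlonglongrightarrow> norm (Y \<omega> - Y \<omega>)" by (intro tendsto_intros elim)
        then show ?case by (simp add: D_def)
      qed
    qed
    then have "(\<lambda>n. (\<integral>\<omega>. D n \<omega> powr p \<partial>\<Omega>) powr (1 / p)) \<longlonglongrightarrow> 0 powr (1 / p)"
      using p by (intro tendsto_powr2) (auto intro!: always_eventually)
    then have "(\<lambda>n. ennreal ((\<integral>\<omega>. D n \<omega> powr p \<partial>\<Omega>) powr (1 / p))) \<longlonglongrightarrow> ennreal 0"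
      using p by (intro tendsto_ennrealI) simp
    then have "\<forall>\<^sub>F n in sequentially. ennreal ((\<integral>\<omega>. D n \<omega> powr p \<partial>\<Omega>) powr (1 / p)) < e"
      using e by (intro order_tendstoD(2)) auto
    from eventually_happens'[OF sequentially_bot this]
    obtain n where n: "ennreal ((\<integral>\<omega>. D n \<omega> powr p \<partial>\<Omega>) powr (1 / p)) < e" by blast
    \<comment> \<open>The joint law on the common probability space is a coupling, and its cost is
      the expectation just shown to be small.\<close>
    define \<pi> where "\<pi> = distr \<Omega> borel (\<lambda>\<omega>. (X n \<omega>, Y \<omega>))"
    have mXY: "(\<lambda>\<omega>. (X n \<omega>, Y \<omega>)) \<in> borel_measurable \<Omega>"
      using mX mY by (simp add: borel_measurable_Pair)
    have m2: "fst \<in> borel_measurable (borel :: (('a \<times> 'a) \<times> ('a \<times> 'a)) measure)"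
      "snd \<in> borel_measurable (borel :: (('a \<times> 'a) \<times> ('a \<times> 'a)) measure)"
      by (intro borel_measurable_continuous_onI continuous_intros)+
    have "distr \<pi> borel fst = f (\<tau> (r n))" "distr \<pi> borel snd = \<nu>"
      unfolding \<pi>_def \<nu>_def using distr_distr[OF m2(1) mXY] distr_distr[OF m2(2) mXY] law[of n]
      by (simp_all add: comp_def)
    then have "\<pi> \<in> couplings (f (\<tau> (r n))) \<nu>"
      using \<Omega>.prob_space_distr[OF mXY] by (simp add: couplings_def borel_prob_def \<pi>_def)
    from wasserstein_le[OF this, of p]
    have "wasserstein p (f (\<tau> (r n))) \<nu> \<le> (\<integral>z. norm (fst z - snd z) powr p \<partial>\<pi>) powr (1 / p)" .
    also have "(\<integral>z. norm (fst z - snd z) powr p \<partial>\<pi>) = (\<integral>\<omega>. D n \<omega> powr p \<partial>\<Omega>)"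
    proof -
      have "(\<lambda>z::('a \<times> 'a) \<times> ('a \<times> 'a). norm (fst z - snd z)) \<in> borel_measurable borel"
        by (intro borel_measurable_continuous_onI continuous_intros)
      then have "(\<lambda>z::('a \<times> 'a) \<times> ('a \<times> 'a). norm (fst z - snd z) powr p) \<in> borel_measurable borel"
        by measurable
      then show ?thesis unfolding \<pi>_def D_def by (subst integral_distr[OF mXY]) auto
    qed
    finally have "ennreal (wasserstein p (f (\<tau> (r n))) \<nu>) < e" using n by (meson ennreal_leI le_less_trans)
    moreover have "dist_Pp p (f (\<tau> (r n))) (equilibria V vbar) \<le> ennreal (wasserstein p (f (\<tau> (r n))) \<nu>)"
      unfolding dist_Pp_def by (rule INF_lower[OF eq])
    ultimately show False using \<tau>(2)[of "r n"] by (meson le_less_trans not_le)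
  qed
qed simp

end

theorem theorem1p5:
  fixes V :: "'a::euclidean_space \<Rightarrow> real" and Vmin :: real
    and \<psi> :: "real \<Rightarrow> real" and \<psi>min :: real
    and f0 :: "('a \<times> 'a) measure" and r0 :: real
    and f :: "real \<Rightarrow> ('a \<times> 'a) measure"
  assumes V_C1: "Ck_on 1 UNIV V"
    and V_bounded_below: "\<forall>x. Vmin \<le> V x"
    and gradV_antisymmetric: "\<forall>x. grad V (- x) = - grad V x"
    and gradV_uniformly_continuous: "uniformly_continuous_on UNIV (grad V)"
    and gradV_locally_lipschitz: "locally_lipschitz_on UNIV (grad V)"
    and gradV_bounded: "bounded (range (grad V))"
    and \<psi>_nonneg: "\<forall>x\<ge>0. \<psi> x \<ge> 0"
    and \<psi>_continuous: "continuous_on {0..} \<psi>"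
    and \<psi>_bounded: "bounded (\<psi> ` {0..})"
    and \<psi>_locally_lipschitz: "locally_lipschitz_on {0..} \<psi>"
    and \<psi>min_pos: "\<psi>min > 0"
    and \<psi>_lower_bound: "\<forall>x\<ge>0. \<psi> x \<ge> \<psi>min"
    and f0_Pc: "f0 \<in> Pc"
    and f0_centered: "(\<integral>z. fst z \<partial>f0) = 0"
    and r0_nonneg: "r0 \<ge> 0"
    and r0_condition:
      "\<forall>R::'a \<times> 'a \<Rightarrow> 'a.
         R \<in> borel_measurable f0 \<and> integrable f0 (\<lambda>z. (norm (R z))\<^sup>2) \<and>
         (\<integral>z. R z \<partial>f0) = 0 \<and> sqrt (\<integral>z. (norm (R z))\<^sup>2 \<partial>f0) \<ge> r0 \<longrightarrow>
         (\<integral>z. (\<integral>z'. grad V (R z - R z') \<bullet> (R z - R z') \<partial>f0) \<partial>f0) \<ge> 0"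
    and f_solution: "mean_field_solution V \<psi> f0 f"
  shows "(Vmin \<le> 0 \<longrightarrow>
           (\<forall>t\<ge>0.
             (\<integral>z. (norm (fst z))\<^sup>2 \<partial>(f t))
             \<le> 1 / \<psi>min * (1 + 2 * sqrt 2 * sqrt (hamiltonian V f0 - Vmin))
                  * max r0 (sqrt (\<integral>z. (norm (fst z))\<^sup>2 \<partial>f0))
               + (SUP x\<in>{0..}. \<bar>\<psi> x\<bar>) / \<psi>min
                  * max (r0\<^sup>2) (\<integral>z. (norm (fst z))\<^sup>2 \<partial>f0)
               + 2 / \<psi>min\<^sup>2 * (hamiltonian V f0 - Vmin)))
       \<and> (\<forall>p. 1 \<le> p \<and> p < 2 \<longrightarrow>
           ((\<lambda>t. dist_Pp p (f t) (equilibria V (mean_velocity f0))) \<longlongrightarrow> 0) at_top)"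
proof -
  define \<Psi> where "\<Psi> = (SUP x\<in>{0..}. \<bar>\<psi> x\<bar>)"
  obtain CG where CG: "\<And>x. norm (grad V x) \<le> CG"
    using gradV_bounded by (auto simp: bounded_iff)
  have \<psi>_le: "\<psi> x \<le> \<Psi>" if "x \<ge> 0" for x
  proof -
    have "bounded ((\<lambda>x. \<bar>\<psi> x\<bar>) ` {0..})" using \<psi>_bounded by (simp add: bounded_iff)
    then have "bdd_above ((\<lambda>x. \<bar>\<psi> x\<bar>) ` {0..})" by (rule bounded_imp_bdd_above)
    then have "\<bar>\<psi> x\<bar> \<le> \<Psi>" unfolding \<Psi>_def using that by (intro cSUP_upper) auto
    then show ?thesis by linarith
  qed
  interpret mean_field_dissipative V \<psi> f0 f \<psi>min CG \<Psi> Vmin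
    by unfold_locales (use assms CG \<psi>_le in auto)
  have bound: "inertia_at t \<le> 1 / \<psi>min * (1 + 2 * sqrt 2 * sqrt (hamiltonian V f0 - Vm)) * max r0 (sqrt (inertia_at 0))
      + \<Psi> / \<psi>min * max (r0\<^sup>2) (inertia_at 0) + 2 / \<psi>min\<^sup>2 * (hamiltonian V f0 - Vm)"
    if "t \<ge> 0" "Vm \<le> 0" "Vm \<le> Vmin" for t Vm
    using r0_condition by (intro moment_bound_at that r0_nonneg) blast
  show ?thesis
  proof (intro conjI impI allI)
    fix t :: real assume "Vmin \<le> 0" "0 \<le> t"
    then show "(\<integral>z. (norm (fst z))\<^sup>2 \<partial>(f t))
             \<le> 1 / \<psi>min * (1 + 2 * sqrt 2 * sqrt (hamiltonian V f0 - Vmin))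
                  * max r0 (sqrt (\<integral>z. (norm (fst z))\<^sup>2 \<partial>f0))
               + (SUP x\<in>{0..}. \<bar>\<psi> x\<bar>) / \<psi>min
                  * max (r0\<^sup>2) (\<integral>z. (norm (fst z))\<^sup>2 \<partial>f0)
               + 2 / \<psi>min\<^sup>2 * (hamiltonian V f0 - Vmin)"
      using bound[of t Vmin] unfolding inertia_at_0 \<Psi>_def by (simp add: inertia_at_def)
  next
    fix p :: real assume "1 \<le> p \<and> p < 2"
    then show "((\<lambda>t. dist_Pp p (f t) (equilibria V (mean_velocity f0))) \<longlongrightarrow> 0) at_top"
      \<comment> \<open>The convergence is claimed for either sign of \<open>Vmin\<close>. The
        smaller of \<open>Vmin\<close> and 0 is a nonpositive lower bound of the potential, and only
        uniformity in time of the resulting moment bound matters here.\<close>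
      using bound[of _ "min Vmin 0"] by (intro dist_equilibria_tendsto_0) auto
  qed
qed

end
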